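(* Let $d=1$, $X=[0,1]$, $Y\subset\mathbb{R}$ compact, $c(x,y)=h(x-y)$ with $h$ strictly convex, $\mu^n=\mu=\mathcal{L}|_{[0,1]}$, $\varepsilon^n=0$ and $\pi^n_{\mathrm{init}}=\pi_{\mathrm{init}}\in\Pi(\mu,\nu)$ for all $n$. Then the domain decomposition iterates $\pi^{n,k}$ described in the context satisfy, for all $n\in2\mathbb{N}$ and $k\in\mathbb{N}$, $$\mathrm{WTVB}(\pi^{n,k})\le2\,\mathrm{WTV}(\pi_{\mathrm{init}})+4\,\mathrm{diam}\,Y.$$
   Context: $\mathbb{N}=\{0,1,\dots\}$, $2\mathbb{N}$ denotes the positive even integers, $\mathcal{L}$ is Lebesgue measure, $\nu$ is a probability measure on $Y$, $\Pi(\alpha,\beta)$ is the set of non-negative measures with marginals $\alpha,\beta$, $\rho|_A$ is the restriction of a measure $\rho$ to $A$, $P_Y$ is the $Y$-marginal, and $W_Y$ is the Wasserstein-1 metric on probability measures on $Y$. The cost $c$ is of class $C^1$ on $X\times Y$ and is used at all scales $n$ (i.e. $c^n=c$), and $\nu^n=\nu$. Cells. For $n\in2\mathbb{N}$ the basic cells are $X^n_i=[i/n,(i+1)/n]$, $i\in\{0,\dots,n-1\}$. The composite partitions of the index set are $\mathcal{J}^n_A=\{\{0,1\},\{2,3\},\dots,\{n-2,n-1\}\}$ and $\mathcal{J}^n_B=\{\{0\},\{1,2\},\{3,4\},\dots,\{n-3,n-2\},\{n-1\}\}$; $X^n_J=\bigcup_{i\in J}X^n_i$, $\mu_J=\mu|_{X^n_J}$.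 Set $\mathcal{J}^{n,k}=\mathcal{J}^n_A$ for $k$ odd and $\mathcal{J}^n_B$ for $k$ even. Iterates. $\pi^{n,0}=\pi_{\mathrm{init}}$; for $k\ge1$, $\pi^{n,k}=\sum_{J\in\mathcal{J}^{n,k}}\pi^{n,k}_J$, where $\pi^{n,k}_J$ minimizes $\int_{X^n_J\times Y}c\,d\pi$ over $\pi\in\Pi(\mu_J,P_Y(\pi^{n,k-1}|_{X^n_J\times Y}))$. The normalized basic cell marginals are $\rho^{n,k}_i=n\,P_Y(\pi^{n,k}|_{X^n_i\times Y})$. Variations. $\mathrm{WTVB}(\pi^{n,k})=\sum_{i=0}^{n-3}W_Y(\rho^{n,k}_i,\rho^{n,k}_{i+2})$ (the basic-cell Wasserstein variation for $d=1$). For $\pi$ with first marginal $\mu$ and disintegration $x\mapsto\pi_x$ with respect to $\mu$, $\mathrm{WTV}(\pi)\in[0,\infty]$ is the total variation on $(0,1)$ of the map $x\mapsto\pi_x$ with values in the metric space $(\mathcal{P}(Y),W_Y)$ in the sense of Ambrosio: for a map $u:\Omega\to E$ into a metric space, $|Du|$ is the least measure $m$ on the open set $\Omega$ such that $|D(\varphi\circ u)|\le m$ for all 1-Lipschitz $\varphi:E\to\mathbb{R}$, and the total variation is $|Du|(\Omega)$ ($+\infty$ if no finite such measure exists). *)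

theory Defs
  imports "HOL-Probability.Probability"
begin

text \<open>
  A measure on a closed set \<open>Y\<close> of reals is represented by its extension by zero, i.e. by a Borel
  measure on the real line that vanishes outside \<open>Y\<close>; likewise for measures on \<open>X \<times> Y\<close>.
  Restricting a measure to \<open>A\<close> keeps the underlying space and multiplies by the indicator of \<open>A\<close>.
\<close>

definition prob_on :: "real set \<Rightarrow> real measure set" where
  "prob_on Y = {\<alpha>. prob_space \<alpha> \<and> sets \<alpha> = sets borel \<and> emeasure \<alpha> (- Y) = 0}"

definition restr :: "'a measure \<Rightarrow> 'a set \<Rightarrow> 'a measure" where
  "restr \<rho> A = density \<rho> (indicator A)"

definition marginalX :: "(real \<times> real) measure \<Rightarrow> real measure" where
  "marginalX \<pi> = distr \<pi> borel fst"

definition marginalY :: "(real \<times> real) measure \<Rightarrow> real measure" where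
  "marginalY \<pi> = distr \<pi> borel snd"

definition couplings :: "real measure \<Rightarrow> real measure \<Rightarrow> (real \<times> real) measure set" where
  "couplings \<alpha> \<beta> = {\<pi>. sets \<pi> = sets borel \<and> marginalX \<pi> = \<alpha> \<and> marginalY \<pi> = \<beta>}"

definition wasserstein :: "real measure \<Rightarrow> real measure \<Rightarrow> ennreal" where
  "wasserstein \<alpha> \<beta> = (INF \<gamma>\<in>couplings \<alpha> \<beta>. \<integral>\<^sup>+z. ennreal (dist (fst z) (snd z)) \<partial>\<gamma>)"

definition strictly_convex :: "(real \<Rightarrow> real) \<Rightarrow> bool" where
  "strictly_convex h \<longleftrightarrow>
    (\<forall>x y t. x \<noteq> y \<longrightarrow> 0 < t \<longrightarrow> t < 1 \<longrightarrow>
      h (t * x + (1 - t) * y) < t * h x + (1 - t) * h y)"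

text \<open>
  Continuous differentiability relative to a set that need not be open: the derivatives are taken
  within \<open>S\<close>.
\<close>

definition C1_on :: "(real \<times> real) set \<Rightarrow> (real \<times> real \<Rightarrow> real) \<Rightarrow> bool" where
  "C1_on S f \<longleftrightarrow>
    (\<exists>f' :: real \<times> real \<Rightarrow> (real \<times> real) \<Rightarrow>\<^sub>L real.
      (\<forall>z\<in>S. (f has_derivative blinfun_apply (f' z)) (at z within S)) \<and> continuous_on S f')"

abbreviation X :: "real set" where
  "X \<equiv> {0..1}"

definition \<mu> :: "real measure" where
  "\<mu> = restr lborel X"


subsection \<open>Domain decomposition\<close>

definition cell :: "nat \<Rightarrow> nat \<Rightarrow> real set" where
  "cell n i = {real i / real n .. (real i + 1) / real n}"

definition composite_cell :: "nat \<Rightarrow> nat set \<Rightarrow> real set" where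
  "composite_cell n J = (\<Union>i\<in>J. cell n i)"

definition partition_A :: "nat \<Rightarrow> nat set set" where
  "partition_A n = {{i, i + 1} |i. even i \<and> i + 1 < n}"

definition partition_B :: "nat \<Rightarrow> nat set set" where
  "partition_B n = {{0}, {n - 1}} \<union> {{i, i + 1} |i. odd i \<and> i + 1 < n - 1}"

definition composite_partition :: "nat \<Rightarrow> nat \<Rightarrow> nat set set" where
  "composite_partition n k = (if odd k then partition_A n else partition_B n)"

definition is_cell_minimizer ::
  "(real \<times> real \<Rightarrow> real) \<Rightarrow> real set \<Rightarrow> nat \<Rightarrow> (real \<times> real) measure \<Rightarrow> nat set
    \<Rightarrow> (real \<times> real) measure \<Rightarrow> bool" where
  "is_cell_minimizer c Y n \<pi>_prev J =
    is_arg_min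
      (\<lambda>\<pi>. LINT z:composite_cell n J \<times> Y|\<pi>. c z)
      (\<lambda>\<pi>. \<pi> \<in> couplings (restr \<mu> (composite_cell n J))
                        (marginalY (restr \<pi>_prev (composite_cell n J \<times> Y))))"

text \<open>\<open>is_measure_sum I m s\<close>: the Borel measure \<open>s\<close> is the finite sum of the measures \<open>m J\<close>, \<open>J \<in> I\<close>.\<close>

definition is_measure_sum ::
  "nat set set \<Rightarrow> (nat set \<Rightarrow> (real \<times> real) measure) \<Rightarrow> (real \<times> real) measure \<Rightarrow> bool" where
  "is_measure_sum I m s \<longleftrightarrow>
    sets s = sets borel \<and> (\<forall>B\<in>sets borel. emeasure s B = (\<Sum>J\<in>I. emeasure (m J) B))"

definition is_dd_iterates ::
  "(real \<times> real \<Rightarrow> real) \<Rightarrow> real set \<Rightarrow> (real \<times> real) measure \<Rightarrow> nat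
    \<Rightarrow> (nat \<Rightarrow> (real \<times> real) measure) \<Rightarrow> bool" where
  "is_dd_iterates c Y \<pi>_init n \<pi> \<longleftrightarrow>
    \<pi> 0 = \<pi>_init \<and>
    (\<forall>k\<ge>1. \<exists>\<pi>_cell.
      (\<forall>J\<in>composite_partition n k. is_cell_minimizer c Y n (\<pi> (k - 1)) J (\<pi>_cell J)) \<and>
      is_measure_sum (composite_partition n k) \<pi>_cell (\<pi> k))"

definition cell_marginal :: "real set \<Rightarrow> nat \<Rightarrow> (real \<times> real) measure \<Rightarrow> nat \<Rightarrow> real measure" where
  "cell_marginal Y n \<pi> i = scale_measure (of_nat n) (marginalY (restr \<pi> (cell n i \<times> Y)))"

text \<open>For \<open>n = 2\<close> the sum is empty.\<close>

definition WTVB :: "real set \<Rightarrow> nat \<Rightarrow> (real \<times> real) measure \<Rightarrow> ennreal" where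
  "WTVB Y n \<pi> =
    (\<Sum>i<n - 2. wasserstein (cell_marginal Y n \<pi> i) (cell_marginal Y n \<pi> (i + 2)))"


subsection \<open>Total variation of metric-space valued maps\<close>

text \<open>
  For open \<open>A\<close>, \<open>variation_open v A\<close> is the mass on \<open>A\<close> of the total variation of the distributional
  derivative of \<open>v\<close>; \<open>variation_measure\<close> is its outer regular extension to the subsets of an open
  set \<open>\<Omega>\<close>. On Borel sets this is \<open>\<bar>D v\<bar>\<close> if \<open>v\<close> has bounded variation on \<open>\<Omega>\<close>; otherwise its value
  on \<open>\<Omega>\<close> is infinite.
\<close>

definition test_functions :: "real set \<Rightarrow> (real \<Rightarrow> real) set" where
  "test_functions A =
    {\<psi>. \<psi> C1_differentiable_on UNIV \<and> compact (closure {x. \<psi> x \<noteq> 0}) \<and>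
        closure {x. \<psi> x \<noteq> 0} \<subseteq> A \<and> (\<forall>x. \<bar>\<psi> x\<bar> \<le> 1)}"

definition variation_open :: "(real \<Rightarrow> real) \<Rightarrow> real set \<Rightarrow> ennreal" where
  "variation_open v A = (SUP \<psi>\<in>test_functions A. ennreal (LBINT x:A. v x * deriv \<psi> x))"

definition variation_measure :: "real set \<Rightarrow> (real \<Rightarrow> real) \<Rightarrow> real set \<Rightarrow> ennreal" where
  "variation_measure \<Omega> v B = (INF A\<in>{A. open A \<and> B \<subseteq> A \<and> A \<subseteq> \<Omega>}. variation_open v A)"

text \<open>The metric space is given by a carrier \<open>E\<close> and a distance \<open>d\<close> on it.\<close>

definition lipschitz1 :: "'e set \<Rightarrow> ('e \<Rightarrow> 'e \<Rightarrow> ennreal) \<Rightarrow> ('e \<Rightarrow> real) set" where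
  "lipschitz1 E d = {\<phi>. \<forall>\<alpha>\<in>E. \<forall>\<beta>\<in>E. ennreal \<bar>\<phi> \<alpha> - \<phi> \<beta>\<bar> \<le> d \<alpha> \<beta>}"

definition dominates_variation ::
  "real set \<Rightarrow> 'e set \<Rightarrow> ('e \<Rightarrow> 'e \<Rightarrow> ennreal) \<Rightarrow> (real \<Rightarrow> 'e) \<Rightarrow> real measure \<Rightarrow> bool" where
  "dominates_variation \<Omega> E d u m \<longleftrightarrow>
    sets m = sets (restrict_space borel \<Omega>) \<and> finite_measure m \<and>
    (\<forall>\<phi>\<in>lipschitz1 E d. \<forall>B\<in>sets m. variation_measure \<Omega> (\<phi> \<circ> u) B \<le> emeasure m B)"

text \<open>
  The order on measures with the same measurable sets is setwise, so the \<open>LEAST\<close> below is Ambrosio's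
  measure \<open>\<bar>D u\<bar>\<close>.
\<close>

definition metric_total_variation ::
  "real set \<Rightarrow> 'e set \<Rightarrow> ('e \<Rightarrow> 'e \<Rightarrow> ennreal) \<Rightarrow> (real \<Rightarrow> 'e) \<Rightarrow> ennreal" where
  "metric_total_variation \<Omega> E d u =
    (if \<exists>m. dominates_variation \<Omega> E d u m
     then emeasure (LEAST m. dominates_variation \<Omega> E d u m) \<Omega> else \<infinity>)"

text \<open>\<open>\<kappa>\<close> is a version of the disintegration of \<open>\<pi>\<close> with respect to its first marginal \<open>\<mu>\<close>.\<close>

definition is_disintegration ::
  "real set \<Rightarrow> (real \<times> real) measure \<Rightarrow> (real \<Rightarrow> real measure) \<Rightarrow> bool" where
  "is_disintegration Y \<pi> \<kappa> \<longleftrightarrow>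
    \<kappa> \<in> restrict_space borel X \<rightarrow>\<^sub>M prob_algebra borel \<and>
    (\<forall>x\<in>X. \<kappa> x \<in> prob_on Y) \<and>
    (\<forall>A\<in>sets borel. \<forall>B\<in>sets borel.
      emeasure \<pi> (A \<times> B) = (\<integral>\<^sup>+x\<in>A. emeasure (\<kappa> x) B \<partial>\<mu>))"

text \<open>
  The variation depends on a plan only through its disintegration, which is unique up to a null set
  and is passed in place of the plan.
\<close>

definition WTV :: "real set \<Rightarrow> (real \<Rightarrow> real measure) \<Rightarrow> ennreal" where
  "WTV Y \<kappa> = metric_total_variation {0<..<1} (prob_on Y) wasserstein \<kappa>"

end

theory Submission
  imports Defs
begin

text \<open>
  On the line everything can be read off distribution functions. The Wasserstein distance is the
  \<open>L\<^sup>1\<close> distance of distribution functions (\<open>wasserstein_eq_cdf\<close>), so it suffices to fix a level \<open>t\<close>,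
  to write \<open>a\<^sub>i \<in> [0, 1]\<close> for the value at \<open>t\<close> of the distribution function of the \<open>i\<close>-th cell marginal,
  to bound \<open>\<Sum>\<^sub>i \<bar>a\<^sub>i - a\<^sub>i\<^sub>+\<^sub>2\<bar>\<close>, and to integrate over the levels between \<open>inf Y\<close> and \<open>sup Y\<close>.

  A cell minimizer is the monotone coupling: for a strictly convex cost, a positive mass of crossing
  pairs could be uncrossed at a profit (\<open>minimizer_no_crossing\<close>). Hence at level \<open>t\<close> a composite cell
  \<open>{i, i + 1}\<close> simply moves as much as possible of the mass \<open>a\<^sub>i + a\<^sub>i\<^sub>+\<^sub>1\<close> to the left half, replacing the
  pair by \<open>(min 1 (a\<^sub>i + a\<^sub>i\<^sub>+\<^sub>1), max 0 (a\<^sub>i + a\<^sub>i\<^sub>+\<^sub>1 - 1))\<close> (\<open>step_pair\<close>). This map of pairs is a contraction in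
  \<open>\<ell>\<^sup>1\<close>, and the sum of \<open>\<bar>a\<^sub>i - a\<^sub>i\<^sub>+\<^sub>2\<bar>\<close> compares consecutive pairs of the partition, so it cannot increase,
  up to the terms at the two ends. Those are tamed by padding the sequence with ones on the left
  and zeros on the right: the padding is fixed by the same map, the singleton
  cells \<open>{0}\<close> and \<open>{n - 1}\<close> become halves of ordinary pairs, and the padded sum is
  nonincreasing along the iteration (\<open>padded_skip_variation_antimono\<close>). The padding adds at most
  four terms of size at most one, whence the term \<open>4 diam Y\<close>.

  It remains to bound the initial plan. By Kantorovich duality the distance of the marginals of the
  cells \<open>i\<close> and \<open>i + 2\<close> is the difference of the means over these cells of a real function
  \<open>v = \<phi> \<circ> \<kappa>\<close> with \<open>\<phi>\<close> 1-Lipschitz. Subdividing the cells into \<open>N\<close> pieces of length \<open>\<delta>\<close>, a difference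
  of means over two pieces at distance \<open>2 / n\<close> is at most the variation of \<open>v\<close> on the interval they
  span, and these intervals cover each point at most \<open>2 N + 1\<close> times
  (\<open>skip_cell_differences_le\<close>). For \<open>N \<rightarrow> \<infinity>\<close> this gives the factor two, for every measure that
  dominates all the variations \<open>\<bar>D (\<phi> \<circ> \<kappa>)\<bar>\<close>.

  The total variation \<open>\<bar>D \<kappa>\<bar>\<close> is by definition the least such measure, and that a least one exists is
  part of what has to be shown (\<open>WTV_attained\<close>). The dominating measures are closed under binary
  infima, because each \<open>\<bar>D v\<bar>\<close> is finitely subadditive, and under decreasing limits; an infimum of
  minimal total mass is least. Subadditivity needs \<open>\<phi> \<circ> \<kappa>\<close> to be measurable for every 1-Lipschitz \<open>\<phi>\<close>,
  which holds because measures on \<open>Y\<close> are determined up to a small distance by the values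
  of their distribution function, rounded, at finitely many points
  (\<open>measurable_lipschitz_kernel\<close>).
\<close>

section \<open>The Wasserstein distance on the line\<close>

text \<open>
  The length of the interval between two numbers is the measure of the levels that separate
  them; Fubini exchanges the points and the levels.
\<close>

lemma layer_cake_abs_diff:
  fixes f g :: "'a \<Rightarrow> real"
  assumes "sigma_finite_measure M" and [measurable]: "f \<in> borel_measurable M" "g \<in> borel_measurable M"
  shows "(\<integral>\<^sup>+z. ennreal \<bar>f z - g z\<bar> \<partial>M)
    = (\<integral>\<^sup>+t. emeasure M {z \<in> space M. min (f z) (g z) \<le> t \<and> t < max (f z) (g z)} \<partial>lborel)"
proof -
  interpret sigma_finite_measure M by fact
  interpret pair_sigma_finite M lborel ..
  have seg: "ennreal \<bar>x - y\<bar> = (\<integral>\<^sup>+t. indicator {min x y ..< max x y} t \<partial>lborel)" for x y :: real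
    by (simp add: min_def max_def)
  have "(\<integral>\<^sup>+z. ennreal \<bar>f z - g z\<bar> \<partial>M)
      = (\<integral>\<^sup>+z. (\<integral>\<^sup>+t. indicator {z \<in> space (M \<Otimes>\<^sub>M lborel). min (f (fst z)) (g (fst z)) \<le> snd z \<and> snd z < max (f (fst z)) (g (fst z))} (z, t) \<partial>lborel) \<partial>M)"
    unfolding seg
    by (intro nn_integral_cong) (auto simp: indicator_def space_pair_measure intro!: nn_integral_cong)
  also have "\<dots> = (\<integral>\<^sup>+t. (\<integral>\<^sup>+z. indicator {z \<in> space (M \<Otimes>\<^sub>M lborel). min (f (fst z)) (g (fst z)) \<le> snd z \<and> snd z < max (f (fst z)) (g (fst z))} (z, t) \<partial>M) \<partial>lborel)"
    by (subst Fubini') auto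
  also have "\<dots> = (\<integral>\<^sup>+t. (\<integral>\<^sup>+z. indicator {z \<in> space M. min (f z) (g z) \<le> t \<and> t < max (f z) (g z)} z \<partial>M) \<partial>lborel)"
    by (intro nn_integral_cong) (auto simp: indicator_def space_pair_measure)
  also have "\<dots> = (\<integral>\<^sup>+t. emeasure M {z \<in> space M. min (f z) (g z) \<le> t \<and> t < max (f z) (g z)} \<partial>lborel)"
    by (intro nn_integral_cong nn_integral_indicator) auto
  finally show ?thesis .
qed

text \<open>
  In both directions \<open>\<bar>x - y\<bar>\<close> is the measure of the levels \<open>t\<close> separating \<open>x\<close> from \<open>y\<close>. Any coupling
  must move at least \<open>\<bar>F(t) - G(t)\<bar>\<close> mass across the level \<open>t\<close>, and coupling the two quantile
  functions by the same uniform variable moves no more than that.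
\<close>

lemma wasserstein_eq_cdf:
  assumes "real_distribution \<alpha>" "real_distribution \<beta>"
  shows "wasserstein \<alpha> \<beta> = (\<integral>\<^sup>+t. ennreal \<bar>cdf \<alpha> t - cdf \<beta> t\<bar> \<partial>lborel)"
proof (rule antisym)
  interpret A: cdf_distribution \<alpha> using assms by (simp add: cdf_distribution_def)
  interpret B: cdf_distribution \<beta> using assms by (simp add: cdf_distribution_def)
  define U where "U = restrict_space lborel {0<..<1::real}"
  interpret U: prob_space U
    unfolding U_def by (auto simp add: emeasure_restrict_space space_restrict_space intro!: prob_spaceI)
  have sU: "space U = {0<..<1}" by (simp add: U_def space_restrict_space)
  have U_le: "emeasure U (T \<inter> {0<..<1}) \<le> emeasure lborel T" if "T \<in> sets borel" for T
    using that emeasure_mono[of "T \<inter> {0<..<1}" T lborel]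
    by (simp add: U_def emeasure_restrict_space)
  have mA[measurable]: "A.I \<in> borel_measurable U" and mB[measurable]: "B.I \<in> borel_measurable U"
    using A.measurable_CI B.measurable_CI
    by (simp_all add: U_def cong: measurable_cong_sets sets_restrict_space_cong)
  define \<gamma> where "\<gamma> = distr U borel (\<lambda>u. (A.I u, B.I u))"
  have \<gamma>: "\<gamma> \<in> couplings \<alpha> \<beta>"
    using A.distr_I_eq_M B.distr_I_eq_M
    by (simp add: couplings_def \<gamma>_def marginalX_def marginalY_def distr_distr comp_def borel_prod[symmetric] U_def[symmetric])
  have "wasserstein \<alpha> \<beta> \<le> (\<integral>\<^sup>+z. ennreal (dist (fst z) (snd z)) \<partial>\<gamma>)"
    unfolding wasserstein_def by (rule INF_lower[OF \<gamma>])
  also have "\<dots> = (\<integral>\<^sup>+u. ennreal \<bar>A.I u - B.I u\<bar> \<partial>U)"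
    unfolding \<gamma>_def dist_real_def by (subst nn_integral_distr) (simp_all add: borel_prod[symmetric])
  also have "\<dots> = (\<integral>\<^sup>+t. emeasure U {u \<in> space U. min (A.I u) (B.I u) \<le> t \<and> t < max (A.I u) (B.I u)} \<partial>lborel)"
    by (rule layer_cake_abs_diff) (auto intro: U.sigma_finite_measure_axioms)
  also have "\<dots> \<le> (\<integral>\<^sup>+t. ennreal \<bar>cdf \<alpha> t - cdf \<beta> t\<bar> \<partial>lborel)"
  proof (rule nn_integral_mono)
    fix t :: real
    \<comment> \<open>by the Galois property of quantiles, the level set lies between the two distribution functions\<close>
    have "emeasure U {u \<in> space U. min (A.I u) (B.I u) \<le> t \<and> t < max (A.I u) (B.I u)}
        \<le> emeasure U ({min (cdf \<alpha> t) (cdf \<beta> t) <.. max (cdf \<alpha> t) (cdf \<beta> t)} \<inter> {0<..<1})"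
    proof (rule emeasure_mono)
      show "{u \<in> space U. min (A.I u) (B.I u) \<le> t \<and> t < max (A.I u) (B.I u)}
          \<subseteq> {min (cdf \<alpha> t) (cdf \<beta> t)<..max (cdf \<alpha> t) (cdf \<beta> t)} \<inter> {0<..<1}"
      proof safe
        fix u assume u: "u \<in> space U" "min (A.I u) (B.I u) \<le> t" "t < max (A.I u) (B.I u)"
        then have "A.I u \<le> t \<longleftrightarrow> u \<le> cdf \<alpha> t" "B.I u \<le> t \<longleftrightarrow> u \<le> cdf \<beta> t"
          using A.pseudoinverse[of u t] B.pseudoinverse[of u t] by (auto simp: sU)
        with u show "u \<in> {min (cdf \<alpha> t) (cdf \<beta> t)<..max (cdf \<alpha> t) (cdf \<beta> t)}" "u \<in> {0<..<1}"
          by (auto simp: sU min_def max_def split: if_splits)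
      qed
      show "{min (cdf \<alpha> t) (cdf \<beta> t)<..max (cdf \<alpha> t) (cdf \<beta> t)} \<inter> {0<..<1} \<in> sets U"
        by (simp add: U_def sets_restrict_space_iff)
    qed
    also have "\<dots> \<le> emeasure lborel {min (cdf \<alpha> t) (cdf \<beta> t) <.. max (cdf \<alpha> t) (cdf \<beta> t)}"
      by (rule U_le) simp
    also have "\<dots> = ennreal \<bar>cdf \<alpha> t - cdf \<beta> t\<bar>"
      by (simp add: min_def max_def)
    finally show "emeasure U {u \<in> space U. min (A.I u) (B.I u) \<le> t \<and> t < max (A.I u) (B.I u)} \<le> \<dots>" .
  qed
  finally show "wasserstein \<alpha> \<beta> \<le> (\<integral>\<^sup>+t. ennreal \<bar>cdf \<alpha> t - cdf \<beta> t\<bar> \<partial>lborel)" .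
next
  show "(\<integral>\<^sup>+t. ennreal \<bar>cdf \<alpha> t - cdf \<beta> t\<bar> \<partial>lborel) \<le> wasserstein \<alpha> \<beta>"
    unfolding wasserstein_def
  proof (rule INF_greatest)
    fix \<gamma> assume "\<gamma> \<in> couplings \<alpha> \<beta>"
    then have s[measurable_cong]: "sets \<gamma> = sets borel" and X: "distr \<gamma> borel fst = \<alpha>" and Y: "distr \<gamma> borel snd = \<beta>"
      by (auto simp: couplings_def marginalX_def marginalY_def)
    have [measurable]: "fst \<in> borel_measurable \<gamma>" "snd \<in> borel_measurable \<gamma>"
      by (simp_all add: measurable_cong_sets[OF s refl] borel_prod[symmetric])
    have "prob_space (distr \<gamma> borel fst)"
      unfolding X using assms(1) by (simp add: real_distribution_def)
    then have "prob_space \<gamma>"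
      by (rule prob_space_distrD[rotated]) measurable
    then interpret G: prob_space \<gamma> .
    have "(\<integral>\<^sup>+t. ennreal \<bar>cdf \<alpha> t - cdf \<beta> t\<bar> \<partial>lborel)
        \<le> (\<integral>\<^sup>+t. emeasure \<gamma> {z \<in> space \<gamma>. min (fst z) (snd z) \<le> t \<and> t < max (fst z) (snd z)} \<partial>lborel)"
    proof (rule nn_integral_mono)
      fix t :: real
      let ?S = "{z \<in> space \<gamma>. min (fst z) (snd z) \<le> t \<and> t < max (fst z) (snd z)}"
      have a: "cdf \<alpha> t = measure \<gamma> {z \<in> space \<gamma>. fst z \<le> t}" 
        unfolding cdf_def X[symmetric] by (subst measure_distr) (auto intro!: arg_cong[where f="measure \<gamma>"])
      have b: "cdf \<beta> t = measure \<gamma> {z \<in> space \<gamma>. snd z \<le> t}" 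
        unfolding cdf_def Y[symmetric] by (subst measure_distr) (auto intro!: arg_cong[where f="measure \<gamma>"])
      have "measure \<gamma> {z \<in> space \<gamma>. fst z \<le> t} \<le> measure \<gamma> ({z \<in> space \<gamma>. snd z \<le> t} \<union> ?S)"
        by (intro G.finite_measure_mono) auto
      also have "\<dots> \<le> measure \<gamma> {z \<in> space \<gamma>. snd z \<le> t} + measure \<gamma> ?S"
        by (intro measure_Un_le) auto
      finally have 1: "cdf \<alpha> t - cdf \<beta> t \<le> measure \<gamma> ?S" by (simp add: a b)
      have "measure \<gamma> {z \<in> space \<gamma>. snd z \<le> t} \<le> measure \<gamma> ({z \<in> space \<gamma>. fst z \<le> t} \<union> ?S)"
        by (intro G.finite_measure_mono) auto
      also have "\<dots> \<le> measure \<gamma> {z \<in> space \<gamma>. fst z \<le> t} + measure \<gamma> ?S"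
        by (intro measure_Un_le) auto
      finally have "cdf \<beta> t - cdf \<alpha> t \<le> measure \<gamma> ?S" by (simp add: a b)
      with 1 show "ennreal \<bar>cdf \<alpha> t - cdf \<beta> t\<bar> \<le> emeasure \<gamma> ?S"
        by (simp add: G.emeasure_eq_measure ennreal_leI)
    qed
    also have "\<dots> = (\<integral>\<^sup>+z. ennreal \<bar>fst z - snd z\<bar> \<partial>\<gamma>)"
      by (rule layer_cake_abs_diff[symmetric]) (auto intro: G.sigma_finite_measure_axioms)
    finally show "(\<integral>\<^sup>+t. ennreal \<bar>cdf \<alpha> t - cdf \<beta> t\<bar> \<partial>lborel) \<le> (\<integral>\<^sup>+z. ennreal (dist (fst z) (snd z)) \<partial>\<gamma>)"
      by (simp add: dist_real_def)
  qed
qed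

section \<open>Minimizers for strictly convex costs do not cross\<close>

lemma strictly_convex_imp_convex_on:
  assumes "strictly_convex h" shows "convex_on UNIV h"
proof (intro convex_onI)
  fix t x y :: real assume "0 < t" "t < 1"
  then show "h ((1 - t) *\<^sub>R x + t *\<^sub>R y) \<le> (1 - t) * h x + t * h y"
    using assms[unfolded strictly_convex_def, rule_format, of y x t] by (cases "x = y") (auto simp: algebra_simps)
qed simp

lemma strictly_convex_continuous:
  assumes "strictly_convex h" shows "continuous_on UNIV h"
  by (rule convex_on_continuous) (auto intro: strictly_convex_imp_convex_on assms)

text \<open>
  Both inner arguments \<open>x - y\<close> and \<open>x' - y'\<close> lie strictly between the outer ones \<open>x - y'\<close> and \<open>x' - y\<close>,
  and the two pairs have the same sum.
\<close>

lemma strictly_convex_swap: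
  assumes "strictly_convex h" "(x::real) < x'" "y < y'"
  shows "h (x - y) + h (x' - y') < h (x - y') + h (x' - y)"
proof -
  let ?p = "x - y'" and ?q = "x' - y"
  define t where "t = (y' - y) / (x' - x + (y' - y))"
  have pos: "0 < x' - x + (y' - y)" using assms by simp
  have t: "0 < t" "t < 1" using assms by (auto simp: t_def field_simps)
  have e: "t * (x' - x + (y' - y)) = y' - y" using pos by (simp add: t_def)
  have 1: "x - y = t * ?q + (1 - t) * ?p" "x' - y' = t * ?p + (1 - t) * ?q"
    using e by (simp_all add: algebra_simps)
  have ne: "?p \<noteq> ?q" using assms by simp
  have "h (t * ?q + (1 - t) * ?p) < t * h ?q + (1 - t) * h ?p"
     "h (t * ?p + (1 - t) * ?q) < t * h ?p + (1 - t) * h ?q"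
    using assms(1)[unfolded strictly_convex_def, rule_format, OF ne t]
      assms(1)[unfolded strictly_convex_def, rule_format, OF ne[symmetric] t] by simp_all
  then show ?thesis unfolding 1[symmetric] by (simp add: algebra_simps)
qed

text \<open>
  Applied to two independent samples of a plan, the first sample takes over the second
  coordinate of the other one whenever the two cross. As the crossing relation is symmetric in the
  two samples, this changes neither marginal.
\<close>

definition uncross :: "(real \<times> real) \<times> (real \<times> real) \<Rightarrow> real \<times> real" where
  "uncross p = (fst (fst p),
    if (fst (fst p) - fst (snd p)) * (snd (fst p) - snd (snd p)) < 0 then snd (snd p) else snd (fst p))"

lemma measurable_uncross[measurable]: "uncross \<in> (borel \<Otimes>\<^sub>M borel) \<rightarrow>\<^sub>M borel"
  unfolding uncross_def[abs_def] borel_prod[symmetric] by measurable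

text \<open>
  The competitor is the normalized image of \<open>\<pi> \<otimes> \<pi>\<close> under \<^const>\<open>uncross\<close>. It has the same marginals
  as \<open>\<pi>\<close>, and averaging over the two orders of the samples shows that its cost is lower by the
  integral of a quantity that is positive exactly on crossing pairs. Optimality forces these
  pairs to be null. The set \<open>G\<close> has full measure, and on it uncrossing lowers the cost strictly.
\<close>

lemma minimizer_no_crossing:
  fixes \<pi> :: "(real \<times> real) measure" and f :: "real \<times> real \<Rightarrow> real"
  assumes "finite_measure \<pi>" and s: "sets \<pi> = sets borel"
    and f[measurable]: "f \<in> borel_measurable borel" and bnd: "\<And>z. \<bar>f z\<bar> \<le> C"
    and G[measurable]: "G \<in> sets borel" and fh: "AE z in \<pi>. z \<in> G" "\<And>x y x' y'. (x, y) \<in> G \<Longrightarrow> (x', y') \<in> G \<Longrightarrow> x < x' \<Longrightarrow> y' < y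
        \<Longrightarrow> f (x, y') + f (x', y) < f (x, y) + f (x', y')"
    and opt: "\<And>\<pi>'. \<pi>' \<in> couplings (marginalX \<pi>) (marginalY \<pi>) \<Longrightarrow> (LINT z|\<pi>. f z) \<le> (LINT z|\<pi>'. f z)"
  shows "AE p in \<pi> \<Otimes>\<^sub>M \<pi>. \<not> (fst (fst p) - fst (snd p)) * (snd (fst p) - snd (snd p)) < 0"
proof (cases "measure \<pi> UNIV = 0")
  case True
  interpret finite_measure \<pi> by fact
  interpret P: pair_sigma_finite \<pi> \<pi> ..
  have sp: "space \<pi> = UNIV" using sets_eq_imp_space_eq[OF s] by simp
  have "emeasure (\<pi> \<Otimes>\<^sub>M \<pi>) (UNIV \<times> UNIV) = emeasure \<pi> UNIV * emeasure \<pi> UNIV"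
    by (rule emeasure_pair_measure_Times) (simp_all add: s)
  also have "\<dots> = 0" using True by (simp add: emeasure_eq_measure)
  finally have "emeasure (\<pi> \<Otimes>\<^sub>M \<pi>) UNIV = 0" by simp
  moreover have "UNIV \<in> sets (\<pi> \<Otimes>\<^sub>M \<pi>)"
    using sets.top[of "\<pi> \<Otimes>\<^sub>M \<pi>"] by (simp add: space_pair_measure sp)
  ultimately show ?thesis by (intro AE_I'[of UNIV]) (auto simp: null_sets_def)
next
  case False
  interpret finite_measure \<pi> by fact
  interpret P: pair_sigma_finite \<pi> \<pi> ..
  interpret N: finite_measure "\<pi> \<Otimes>\<^sub>M \<pi>" by (rule finite_measure_pair_measure) fact+
  define M where "M = measure \<pi> UNIV"
  have M: "M > 0" using False by (simp add: M_def zero_less_measure_iff)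
  have sp: "space \<pi> = UNIV" using sets_eq_imp_space_eq[OF s] by simp
  let ?N = "\<pi> \<Otimes>\<^sub>M \<pi>"
  have mT[measurable]: "uncross \<in> ?N \<rightarrow>\<^sub>M borel"
    using measurable_uncross by (simp add: measurable_cong_sets[OF sets_pair_measure_cong[OF s s] refl])
  have m1[measurable]: "fst \<in> ?N \<rightarrow>\<^sub>M borel" and m2[measurable]: "snd \<in> ?N \<rightarrow>\<^sub>M borel"
    using measurable_fst[of \<pi> \<pi>] measurable_snd[of \<pi> \<pi>] by (simp_all add: measurable_cong_sets[OF refl s])
  have mf[measurable]: "(\<lambda>p. f (fst p)) \<in> borel_measurable ?N" "(\<lambda>p. f (snd p)) \<in> borel_measurable ?N"
    "(\<lambda>p. f (uncross p)) \<in> borel_measurable ?N" "(\<lambda>p. f (uncross (snd p, fst p))) \<in> borel_measurable ?N"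
    using measurable_compose[OF m1 f] measurable_compose[OF m2 f] measurable_compose[OF mT f]
      measurable_compose[OF measurable_compose[OF measurable_pair_swap'[of \<pi> \<pi>] mT] f] by (simp_all add: case_prod_beta' split_beta')
  have int: "integrable ?N g" if "g \<in> borel_measurable ?N" "\<And>p. \<bar>g p\<bar> \<le> C" for g :: "_ \<Rightarrow> real"
    using that by (intro N.integrable_const_bound[where B=C]) auto
  have swap: "integral\<^sup>L ?N (\<lambda>p. g (snd p, fst p)) = integral\<^sup>L ?N g" if "g \<in> borel_measurable ?N" for g :: "_ \<Rightarrow> real"
    using P.integral_product_swap[OF that] by (simp add: case_prod_beta' split_beta')
  have sN: "space ?N = UNIV" by (simp add: space_pair_measure sp)
  have mcoord: "(\<lambda>p. fst (fst p)) \<in> borel_measurable ?N" "(\<lambda>p. snd (fst p)) \<in> borel_measurable ?N"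
    "(\<lambda>p. fst (snd p)) \<in> borel_measurable ?N" "(\<lambda>p. snd (snd p)) \<in> borel_measurable ?N"
    using measurable_compose[OF m1, of fst borel] measurable_compose[OF m1, of snd borel]
      measurable_compose[OF m2, of fst borel] measurable_compose[OF m2, of snd borel]
    by (simp_all add: borel_prod[symmetric])
  note mcoord[measurable]
  define S where "S = {p. (fst (fst p) - fst (snd p)) * (snd (fst p) - snd (snd p)) < (0::real)}"
  have S[measurable]: "S \<in> sets ?N"
  proof -
    have "{p \<in> space ?N. (fst (fst p) - fst (snd p)) * (snd (fst p) - snd (snd p)) < 0} \<in> sets ?N" by measurable
    then show ?thesis by (simp add: S_def sN)
  qed
  have em_swap: "emeasure ?N A = emeasure ?N {p. (snd p, fst p) \<in> A}" if "A \<in> sets ?N" for A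
    using that by (subst P.distr_pair_swap) (simp add: emeasure_distr sN vimage_def case_prod_beta')
  \<comment> \<open>the constant \<open>1 / M\<close> undoes the mass of the second sample\<close>
  define \<pi>' where "\<pi>' = density (distr ?N borel uncross) (\<lambda>_. ennreal (1 / M))"
  have em': "emeasure \<pi>' A = ennreal (1 / M) * emeasure ?N {p. uncross p \<in> A}" if "A \<in> sets borel" for A
    using that by (simp add: \<pi>'_def emeasure_density_const emeasure_distr sN vimage_def)
  have norm: "ennreal (1 / M) * emeasure ?N (A \<times> UNIV) = emeasure \<pi> A" if "A \<in> sets borel" for A
  proof -
    have "emeasure ?N (A \<times> UNIV) = emeasure \<pi> A * emeasure \<pi> UNIV"
      using that by (intro emeasure_pair_measure_Times) (simp_all add: s)
    also have "emeasure \<pi> UNIV = ennreal M" by (simp add: emeasure_eq_measure M_def)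
    finally show ?thesis using M
      by (simp add: emeasure_eq_measure ennreal_mult[symmetric])
  qed
  have mfs: "fst \<in> borel_measurable (borel :: (real \<times> real) measure)" "snd \<in> borel_measurable (borel :: (real \<times> real) measure)"
    by (simp_all add: borel_prod[symmetric])
  have fs_sets: "fst -` A \<in> sets (borel :: (real \<times> real) measure)" "snd -` A \<in> sets (borel :: (real \<times> real) measure)"
    if "A \<in> sets borel" for A
    using measurable_sets_borel[OF mfs(1) that] measurable_sets_borel[OF mfs(2) that] by simp_all
  have s': "sets \<pi>' = sets borel" by (simp add: \<pi>'_def)
  have meas_fs: "fst \<in> borel_measurable \<pi>" "snd \<in> borel_measurable \<pi>" "fst \<in> borel_measurable \<pi>'" "snd \<in> borel_measurable \<pi>'"
    using mfs s s' by (simp_all cong: measurable_cong_sets)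
  have "marginalX \<pi>' = marginalX \<pi>"
  proof (rule measure_eqI)
    fix A :: "real set" assume "A \<in> sets (marginalX \<pi>')"
    then have A: "A \<in> sets borel" by (simp add: marginalX_def)
    have "emeasure (marginalX \<pi>') A = emeasure \<pi>' (fst -` A)"
      using A meas_fs sets_eq_imp_space_eq[OF s'] by (simp add: marginalX_def emeasure_distr)
    also have "\<dots> = ennreal (1 / M) * emeasure ?N ((fst -` A) \<times> UNIV)"
      unfolding em'[OF fs_sets(1)[OF A]]
      by (intro arg_cong[where f="\<lambda>S. _ * emeasure ?N S"]) (auto simp: uncross_def)
    also have "\<dots> = emeasure \<pi> (fst -` A)" by (rule norm[OF fs_sets(1)[OF A]])
    also have "\<dots> = emeasure (marginalX \<pi>) A"
      using A meas_fs sp by (simp add: marginalX_def emeasure_distr)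
    finally show "emeasure (marginalX \<pi>') A = emeasure (marginalX \<pi>) A" .
  qed (simp add: marginalX_def)
  moreover have "marginalY \<pi>' = marginalY \<pi>"
  proof (rule measure_eqI)
    fix A :: "real set" assume "A \<in> sets (marginalY \<pi>')"
    then have A[measurable]: "A \<in> sets borel" by (simp add: marginalY_def)
    have m: "{p. snd (snd p) \<in> A} \<in> sets ?N" "{p. snd (fst p) \<in> A} \<in> sets ?N"
      using measurable_sets[OF mcoord(4) A] measurable_sets[OF mcoord(2) A] by (simp_all add: sN vimage_def)
    \<comment> \<open>the crossing relation is symmetric, so exchanging the two points preserves the measure of the swapped part\<close>
    have sw: "emeasure ?N ({p. snd (snd p) \<in> A} \<inter> S) = emeasure ?N ({p. snd (fst p) \<in> A} \<inter> S)"
    proof -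
      have "{p. (snd p, fst p) \<in> {p. snd (snd p) \<in> A} \<inter> S} = {p. snd (fst p) \<in> A} \<inter> S"
        by (auto simp: S_def algebra_simps)
      then show ?thesis using em_swap[OF sets.Int[OF m(1) S]] by simp
    qed
    have "{p. snd (uncross p) \<in> A} = ({p. snd (snd p) \<in> A} \<inter> S) \<union> ({p. snd (fst p) \<in> A} - S)"
      by (auto simp: uncross_def S_def split: if_splits)
    then have "emeasure ?N {p. snd (uncross p) \<in> A} = emeasure ?N ({p. snd (snd p) \<in> A} \<inter> S) + emeasure ?N ({p. snd (fst p) \<in> A} - S)"
      using m by (simp only:) (rule plus_emeasure[symmetric], auto)
    also have "\<dots> = emeasure ?N (({p. snd (fst p) \<in> A} \<inter> S) \<union> ({p. snd (fst p) \<in> A} - S))"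
      using m unfolding sw by (intro plus_emeasure) auto
    also have "({p. snd (fst p) \<in> A} \<inter> S) \<union> ({p. snd (fst p) \<in> A} - S) = (snd -` A) \<times> UNIV" by auto
    finally have eq: "emeasure ?N {p. snd (uncross p) \<in> A} = emeasure ?N ((snd -` A) \<times> UNIV)" .
    have "emeasure (marginalY \<pi>') A = emeasure \<pi>' (snd -` A)"
      using A meas_fs sets_eq_imp_space_eq[OF s'] by (simp add: marginalY_def emeasure_distr)
    also have "\<dots> = ennreal (1 / M) * emeasure ?N ((snd -` A) \<times> UNIV)"
      unfolding em'[OF fs_sets(2)[OF A]] using eq by simp
    also have "\<dots> = emeasure \<pi> (snd -` A)" by (rule norm[OF fs_sets(2)[OF A]])
    also have "\<dots> = emeasure (marginalY \<pi>) A"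
      using A meas_fs sp by (simp add: marginalY_def emeasure_distr)
    finally show "emeasure (marginalY \<pi>') A = emeasure (marginalY \<pi>) A" .
  qed (simp add: marginalY_def)
  ultimately have "\<pi>' \<in> couplings (marginalX \<pi>) (marginalY \<pi>)"
    by (simp add: couplings_def s')
  then have "(LINT z|\<pi>. f z) \<le> (LINT z|\<pi>'. f z)" by (rule opt)
  also have "\<dots> = (1 / M) * (LINT p|?N. f (uncross p))"
    using M by (simp add: \<pi>'_def integral_density integral_distr)
  finally have le: "M * (LINT z|\<pi>. f z) \<le> (LINT p|?N. f (uncross p))"
    using M by (simp add: field_simps)
  have i1: "(LINT p|?N. f (fst p)) = M * (LINT z|\<pi>. f z)"
  proof -
    have "(LINT z|\<pi>. LINT w|\<pi>. f z) = (LINT p|?N. f (fst p))"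
      using P.integral_fst[of "\<lambda>z w. f z"] int[OF mf(1)] bnd by (simp add: case_prod_beta')
    then show ?thesis by (simp add: M_def sp)
  qed
  \<comment> \<open>the gain of uncrossing, summed over both orders of the two samples\<close>
  define g where "g p = f (fst p) + f (snd p) - f (uncross p) - f (uncross (snd p, fst p))" for p
  have ints: "integrable ?N (\<lambda>p. f (fst p))" "integrable ?N (\<lambda>p. f (snd p))"
    "integrable ?N (\<lambda>p. f (uncross p))" "integrable ?N (\<lambda>p. f (uncross (snd p, fst p)))"
    by (rule int[OF mf(1)] int[OF mf(2)] int[OF mf(3)] int[OF mf(4)], rule bnd)+
  have intg: "integrable ?N g" unfolding g_def[abs_def] by (intro Bochner_Integration.integrable_diff Bochner_Integration.integrable_add ints)
  have "integral\<^sup>L ?N g = 2 * M * (LINT z|\<pi>. f z) - 2 * (LINT p|?N. f (uncross p))"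
    unfolding g_def[abs_def] using ints swap[OF mf(1)] swap[OF mf(3)] i1 by simp
  with le have le0: "integral\<^sup>L ?N g \<le> 0" by simp
  have aeG: "AE p in ?N. fst p \<in> G" "AE p in ?N. snd p \<in> G"
  proof -
    have "{p \<in> space ?N. fst p \<in> G} \<in> sets ?N" "{p \<in> space ?N. snd p \<in> G} \<in> sets ?N"
      using measurable_sets[OF m1 G] measurable_sets[OF m2 G] by (simp_all add: vimage_def Int_def sN)
    moreover have "AE z in \<pi>. AE w in \<pi>. fst (z, w) \<in> G" "AE z in \<pi>. AE w in \<pi>. snd (z, w) \<in> G"
      using fh(1) by (auto elim: eventually_mono)
    ultimately show "AE p in ?N. fst p \<in> G" "AE p in ?N. snd p \<in> G"
      by (auto intro!: P.AE_pair_measure)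
  qed
  have pos: "0 \<le> g p \<and> (p \<in> S \<longrightarrow> 0 < g p)" if "fst p \<in> G" "snd p \<in> G" for p
    using that fh(2)[of "fst (fst p)" "snd (fst p)" "fst (snd p)" "snd (snd p)"]
      fh(2)[of "fst (snd p)" "snd (snd p)" "fst (fst p)" "snd (fst p)"]
    by (cases p) (auto simp: g_def uncross_def S_def mult_less_0_iff mult.commute not_less)
  have g0: "AE p in ?N. 0 \<le> g p" using aeG pos by (auto elim!: eventually_elim2)
  have "integral\<^sup>L ?N g = 0" using le0 integral_nonneg_AE[OF g0] by simp
  with g0 intg have "AE p in ?N. g p = 0" by (simp add: integral_nonneg_eq_0_iff_AE)
  with aeG have "AE p in ?N. p \<notin> S" 
    by eventually_elim (use pos in force)
  then show ?thesis by (simp add: S_def)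
qed

section \<open>Sequences under monotone rearrangement of pairs\<close>

text \<open>
  If \<open>p\<close> and \<open>q\<close> are the fractions of the mass of two cells that lie below a level, then \<open>p'\<close> and \<open>q'\<close> are
  these fractions after the mass has been rearranged monotonically.
\<close>

definition half_split :: "real \<Rightarrow> real \<Rightarrow> real \<Rightarrow> real \<Rightarrow> bool" where
  "half_split p q p' q' \<longleftrightarrow> p' = min 1 (p + q) \<and> q' = max 0 (p + q - 1)"

text \<open>
  The sequence \<open>a\<^sub>0, \<dots>, a\<^sub>n\<^sub>-\<^sub>1\<close> preceded by two ones and followed by zeros. Any pair \<open>(1, a)\<close>
  or \<open>(a, 0)\<close> with \<open>a \<in> [0, 1]\<close> is a fixed point of \<^const>\<open>half_split\<close>, so that the padding makes the
  boundary cells indistinguishable from interior ones.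
\<close>

definition pad :: "nat \<Rightarrow> (nat \<Rightarrow> real) \<Rightarrow> nat \<Rightarrow> real" where
  "pad n a j = (if j < 2 then 1 else if j < n + 2 then a (j - 2) else 0)"

text \<open>
  The functions \<open>min 1 s\<close> and \<open>max 0 (s - 1)\<close> are nondecreasing and add up to \<open>s\<close>, so the left-hand side
  equals \<open>\<bar>(p + q) - (r + s)\<bar>\<close>.
\<close>

lemma half_split_contracts:
  assumes "half_split p q p' q'" "half_split r s r' s'"
  shows "\<bar>p' - r'\<bar> + \<bar>q' - s'\<bar> \<le> \<bar>p - r\<bar> + \<bar>q - s\<bar>"
  using assms unfolding half_split_def by (auto simp: min_def max_def abs_if split: if_splits)

lemma sum_pairs: "(\<Sum>j<2 * m. f j) = (\<Sum>l<m. f (2 * l) + f (2 * l + 1))" for f :: "nat \<Rightarrow> real"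
  by (induction m) (auto simp: algebra_simps)

lemma skip_variation_contracts_even:
  fixes b b' :: "nat \<Rightarrow> real"
  assumes "\<And>l. half_split (b (2 * l)) (b (2 * l + 1)) (b' (2 * l)) (b' (2 * l + 1))"
  shows "(\<Sum>j<2 * m. \<bar>b' j - b' (j + 2)\<bar>) \<le> (\<Sum>j<2 * m. \<bar>b j - b (j + 2)\<bar>)"
  unfolding sum_pairs
proof (rule sum_mono)
  fix l
  show "\<bar>b' (2 * l) - b' (2 * l + 2)\<bar> + \<bar>b' (2 * l + 1) - b' (2 * l + 1 + 2)\<bar>
      \<le> \<bar>b (2 * l) - b (2 * l + 2)\<bar> + \<bar>b (2 * l + 1) - b (2 * l + 1 + 2)\<bar>"
    using half_split_contracts[OF assms[of l] assms[of "l + 1"]] by (simp add: algebra_simps)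
qed

text \<open>
  The two outermost terms of the sum are left alone, and the others group into pairs starting at
  odd positions.
\<close>

lemma skip_variation_contracts_odd:
  fixes b b' :: "nat \<Rightarrow> real"
  assumes "\<And>l. half_split (b (2 * l + 1)) (b (2 * l + 2)) (b' (2 * l + 1)) (b' (2 * l + 2))"
    and ends: "b' 0 = b 0" "b' 2 = b 2" "b' (2 * m + 1) = b (2 * m + 1)" "b' (2 * m + 3) = b (2 * m + 3)"
  shows "(\<Sum>j<2 * m + 2. \<bar>b' j - b' (j + 2)\<bar>) \<le> (\<Sum>j<2 * m + 2. \<bar>b j - b (j + 2)\<bar>)"
proof -
  have cut: "(\<Sum>j<2 * m + 2. \<bar>f j - f (j + 2)\<bar>)
      = \<bar>f 0 - f 2\<bar> + (\<Sum>j<2 * m. \<bar>f (Suc j) - f (Suc j + 2)\<bar>) + \<bar>f (2 * m + 1) - f (2 * m + 3)\<bar>"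
    for f :: "nat \<Rightarrow> real" and m :: nat
    using sum.lessThan_Suc_shift[of "\<lambda>j. \<bar>f j - f (j + 2)\<bar>" "2 * m"] by (simp add: numeral_3_eq_3 numeral_2_eq_2)
  have "(\<Sum>j<2 * m. \<bar>b' (Suc j) - b' (Suc (j + 2))\<bar>) \<le> (\<Sum>j<2 * m. \<bar>b (Suc j) - b (Suc (j + 2))\<bar>)"
    using assms(1) by (intro skip_variation_contracts_even) simp
  then show ?thesis unfolding cut using ends by simp
qed

text \<open>
  The two alternatives are the two composite partitions. Padding shifts positions by the even
  number two and hence preserves the parity of the pairs.
\<close>

lemma padded_skip_variation_antimono:
  assumes "even n" "0 < n" and a: "\<And>i. i < n \<Longrightarrow> 0 \<le> a i \<and> a i \<le> 1"
    and step: "(\<forall>i. even i \<longrightarrow> i + 1 < n \<longrightarrow> half_split (a i) (a (i + 1)) (a' i) (a' (i + 1))) \<or>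
      (\<forall>i. odd i \<longrightarrow> i + 1 < n \<longrightarrow> half_split (a i) (a (i + 1)) (a' i) (a' (i + 1))) \<and>
        a' 0 = a 0 \<and> a' (n - 1) = a (n - 1)"
  shows "(\<Sum>j<n + 2. \<bar>pad n a' j - pad n a' (j + 2)\<bar>) \<le> (\<Sum>j<n + 2. \<bar>pad n a j - pad n a (j + 2)\<bar>)"
  using step
proof
  from \<open>even n\<close> obtain m where m: "n = 2 * m" by blast
  assume A: "\<forall>i. even i \<longrightarrow> i + 1 < n \<longrightarrow> half_split (a i) (a (i + 1)) (a' i) (a' (i + 1))"
  have "half_split (pad n a (2 * l)) (pad n a (2 * l + 1)) (pad n a' (2 * l)) (pad n a' (2 * l + 1))" for l
  proof -
    consider "l = 0" | i where "l = Suc i" "i < m" | i where "l = Suc i" "i \<ge> m" 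
      by (metis not_less not0_implies_Suc)
    then show ?thesis
    proof cases
      case (2 i)
      then have "2 * l - 2 = 2 * i" "2 * l + 1 - 2 = 2 * i + 1" "2 * i + 1 < n" by (auto simp: m)
      with A 2 show ?thesis by (auto simp: pad_def m)
    qed (auto simp: pad_def half_split_def m)
  qed
  from skip_variation_contracts_even[of "pad n a" "pad n a'" "m + 1", OF this]
  show ?thesis by (simp add: m)
next
  from \<open>even n\<close> obtain m where m: "n = 2 * m" by blast
  assume B: "(\<forall>i. odd i \<longrightarrow> i + 1 < n \<longrightarrow> half_split (a i) (a (i + 1)) (a' i) (a' (i + 1))) \<and>
        a' 0 = a 0 \<and> a' (n - 1) = a (n - 1)"
  have m0: "m > 0" using m \<open>0 < n\<close> by simp
  have "half_split (pad n a (2 * l + 1)) (pad n a (2 * l + 2)) (pad n a' (2 * l + 1)) (pad n a' (2 * l + 2))" for l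
  proof -
    consider "l = 0" | i where "l = Suc i" "i + 1 < m" | i where "l = Suc i" "i + 1 = m" | i where "l = Suc i" "i \<ge> m" 
      by (metis less_SucE Suc_eq_plus1 not_less not0_implies_Suc Suc_lessI)
    then show ?thesis
    proof cases
      case 1
      then show ?thesis using B a[of 0] m0 by (auto simp: pad_def half_split_def m)
    next
      case (2 i)
      then have "2 * l + 1 - 2 = 2 * i + 1" "2 * l + 2 - 2 = 2 * i + 1 + 1" "2 * i + 1 + 1 < n" by (auto simp: m)
      with B 2 show ?thesis by (auto simp: pad_def m)
    next
      case (3 i)
      then have "2 * l + 1 - 2 = n - 1" by (auto simp: m)
      with B 3 a[of "n - 1"] m0 show ?thesis by (auto simp: pad_def half_split_def m)
    qed (auto simp: pad_def half_split_def m)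
  qed
  from skip_variation_contracts_odd[of "pad n a" "pad n a'" "m", OF this]
  show ?thesis using B m0 by (simp add: m pad_def)
qed

lemma padded_skip_variation_bounds:
  assumes "2 \<le> n" and a: "\<And>i. i < n \<Longrightarrow> 0 \<le> a i \<and> a i \<le> 1"
  shows "(\<Sum>i<n - 2. \<bar>a i - a (i + 2)\<bar>) \<le> (\<Sum>j<n + 2. \<bar>pad n a j - pad n a (j + 2)\<bar>)"
    and "(\<Sum>j<n + 2. \<bar>pad n a j - pad n a (j + 2)\<bar>) \<le> (\<Sum>i<n - 2. \<bar>a i - a (i + 2)\<bar>) + 4"
proof -
  obtain p where p: "n = p + 2" using assms(1) by (metis le_add_diff_inverse2)
  let ?f = "\<lambda>j. \<bar>pad n a j - pad n a (j + 2)\<bar>"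
  have mid: "(\<Sum>i<p. ?f (Suc (Suc i))) = (\<Sum>i<p. \<bar>a i - a (i + 2)\<bar>)"
    by (intro sum.cong) (auto simp: pad_def p)
  have cut: "(\<Sum>j<p + 4. g j) = g 0 + g 1 + (\<Sum>i<p. g (Suc (Suc i))) + g (p + 2) + g (p + 3)"
    for g :: "nat \<Rightarrow> real"
    by (induction p) (simp_all add: numeral_eq_Suc)
  have np: "n + 2 = p + 4" by (simp add: p)
  have "(\<Sum>j<n + 2. ?f j) = ?f 0 + ?f 1 + (\<Sum>i<p. ?f (Suc (Suc i))) + ?f (p + 2) + ?f (p + 3)"
    unfolding np by (rule cut)
  moreover have "0 \<le> ?f j" "?f j \<le> 1" for j
    using a[of "j - 2"] a[of j] by (cases "j - 2 < n"; cases "j < n"; auto simp: pad_def)+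
  ultimately show "(\<Sum>i<n - 2. \<bar>a i - a (i + 2)\<bar>) \<le> (\<Sum>j<n + 2. ?f j)"
    "(\<Sum>j<n + 2. ?f j) \<le> (\<Sum>i<n - 2. \<bar>a i - a (i + 2)\<bar>) + 4"
    unfolding mid by (smt (verit) p add_diff_cancel_right')+
qed

section \<open>One step of the domain decomposition\<close>

text \<open>
  The invariant of the iteration: only the facts about the first marginal that the cell structure
  sees, namely the mass of each cell and the absence of atoms (so that common endpoints of
  adjacent cells do not matter), together with concentration on \<open>Y\<close> in the second variable.
\<close>

definition uniform_plan :: "nat \<Rightarrow> real set \<Rightarrow> (real \<times> real) measure \<Rightarrow> bool" where
  "uniform_plan n Y \<rho> \<longleftrightarrow> sets \<rho> = sets borel \<and> finite_measure \<rho> \<and> (AE z in \<rho>. snd z \<in> Y) \<and>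
    (\<forall>p. AE z in \<rho>. fst z \<noteq> p) \<and> (\<forall>i<n. emeasure \<rho> (cell n i \<times> UNIV) = ennreal (1 / real n))"

definition cell_cdf :: "nat \<Rightarrow> (real \<times> real) measure \<Rightarrow> nat \<Rightarrow> real \<Rightarrow> real" where
  "cell_cdf n \<rho> i t = real n * measure \<rho> (cell n i \<times> {..t})"

lemma sets_cell[measurable]: "cell n i \<in> sets borel"
  by (simp add: cell_def)

lemma sets_composite_cell: "finite J \<Longrightarrow> composite_cell n J \<in> sets borel"
  unfolding composite_cell_def by (intro sets.finite_UN) auto

lemma emeasure_mu: "A \<in> sets borel \<Longrightarrow> emeasure \<mu> A = emeasure lborel (X \<inter> A)"
  unfolding \<mu>_def restr_def by (subst emeasure_restricted) auto

lemma emeasure_coupling: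
  assumes "\<rho> \<in> couplings \<alpha> \<beta>" "A \<in> sets borel"
  shows "emeasure \<rho> (A \<times> UNIV) = emeasure \<alpha> A" "emeasure \<rho> (UNIV \<times> A) = emeasure \<beta> A"
proof -
  have s: "sets \<rho> = sets borel" "space \<rho> = UNIV"
    using assms sets_eq_imp_space_eq[of \<rho> borel] by (auto simp: couplings_def)
  have m: "fst \<in> borel_measurable \<rho>" "snd \<in> borel_measurable \<rho>"
    by (simp_all add: measurable_cong_sets[OF s(1) refl] borel_prod[symmetric])
  have "emeasure (distr \<rho> borel fst) A = emeasure \<rho> (A \<times> UNIV)"
    using assms(2) m by (subst emeasure_distr) (auto simp: s intro!: arg_cong[where f="emeasure \<rho>"])
  moreover have "emeasure (distr \<rho> borel snd) A = emeasure \<rho> (UNIV \<times> A)"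
    using assms(2) m by (subst emeasure_distr) (auto simp: s intro!: arg_cong[where f="emeasure \<rho>"])
  ultimately show "emeasure \<rho> (A \<times> UNIV) = emeasure \<alpha> A" "emeasure \<rho> (UNIV \<times> A) = emeasure \<beta> A"
    using assms(1) by (auto simp: couplings_def marginalX_def marginalY_def)
qed

lemma emeasure_marginalY_restr:
  assumes s: "sets \<rho> = sets borel" and S: "S \<in> sets borel" "Y \<in> sets borel" and B: "B \<in> sets borel"
  shows "emeasure (marginalY (restr \<rho> (S \<times> Y))) B = emeasure \<rho> (S \<times> (Y \<inter> B))"
proof -
  have sp: "space \<rho> = UNIV" using sets_eq_imp_space_eq[OF s] by simp
  have m: "snd \<in> borel_measurable (restr \<rho> (S \<times> Y))"
    by (simp add: restr_def measurable_cong_sets[OF s refl] borel_prod[symmetric])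
  have "emeasure (marginalY (restr \<rho> (S \<times> Y))) B = emeasure (restr \<rho> (S \<times> Y)) (UNIV \<times> B)"
    unfolding marginalY_def using B m
    by (subst emeasure_distr) (auto simp: restr_def sp intro!: arg_cong[where f="emeasure (density \<rho> (indicator (S \<times> Y)))"])
  also have "\<dots> = emeasure \<rho> ((S \<times> Y) \<inter> (UNIV \<times> B))"
    unfolding restr_def using S B by (intro emeasure_restricted) (auto simp: s borel_Times)
  also have "(S \<times> Y) \<inter> (UNIV \<times> B) = S \<times> (Y \<inter> B)" by auto
  finally show ?thesis .
qed

lemma AE_null_setI: "N \<in> sets M \<Longrightarrow> emeasure M N = 0 \<Longrightarrow> (\<And>z. \<not> P z \<Longrightarrow> z \<in> N) \<Longrightarrow> AE z in M. P z"
  by (rule AE_I'[of N]) auto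

lemma uniform_plan_coupling:
  assumes "0 < n" "closed Y" "\<nu> \<in> prob_on Y" "\<rho> \<in> couplings \<mu> \<nu>"
  shows "uniform_plan n Y \<rho>"
  unfolding uniform_plan_def
proof (intro conjI allI impI)
  show s: "sets \<rho> = sets borel" using assms by (simp add: couplings_def)
  have sp: "space \<rho> = UNIV" using sets_eq_imp_space_eq[OF s] by simp
  show "finite_measure \<rho>"
    using emeasure_coupling(1)[OF assms(4), of UNIV] by (intro finite_measureI) (simp add: sp emeasure_mu)
  show "AE z in \<rho>. snd z \<in> Y"
  proof (rule AE_null_setI[of "UNIV \<times> - Y"])
    show "emeasure \<rho> (UNIV \<times> - Y) = 0"
      using emeasure_coupling(2)[OF assms(4), of "- Y"] assms(2,3) by (simp add: prob_on_def)
  qed (auto simp: s borel_Times assms(2))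
  show "AE z in \<rho>. fst z \<noteq> p" for p
  proof (rule AE_null_setI[of "{p} \<times> UNIV"])
    have "emeasure lborel (X \<inter> {p}) \<le> emeasure lborel {p}" by (intro emeasure_mono) auto
    then show "emeasure \<rho> ({p} \<times> UNIV) = 0"
      using emeasure_coupling(1)[OF assms(4), of "{p}"] by (simp add: emeasure_mu)
  qed (auto simp: s borel_Times)
  fix i assume "i < n"
  then have "X \<inter> cell n i = cell n i"
    by (auto simp: cell_def divide_simps)
  then show "emeasure \<rho> (cell n i \<times> UNIV) = ennreal (1 / real n)"
    using emeasure_coupling(1)[OF assms(4), of "cell n i"] assms(1)
    by (simp add: emeasure_mu) (simp add: cell_def divide_simps)
qed

text \<open>
  Multiplying by \<open>n\<close> normalizes because each cell has mass \<open>1 / n\<close>; the restriction to \<open>Y\<close> removes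
  only a null set.
\<close>

lemma cell_marginal_props:
  assumes u: "uniform_plan n Y \<rho>" and "closed Y" "i < n"
  shows "cell_marginal Y n \<rho> i \<in> prob_on Y" and "cdf (cell_marginal Y n \<rho> i) t = cell_cdf n \<rho> i t"
proof -
  have s: "sets \<rho> = sets borel" and aeY: "AE z in \<rho>. snd z \<in> Y" using u by (auto simp: uniform_plan_def)
  interpret finite_measure \<rho> using u by (simp add: uniform_plan_def)
  have em: "emeasure (cell_marginal Y n \<rho> i) B = of_nat n * emeasure \<rho> (cell n i \<times> (Y \<inter> B))" if "B \<in> sets borel" for B
    unfolding cell_marginal_def using that assms(2) by (simp add: emeasure_marginalY_restr[OF s])
  have em': "emeasure (cell_marginal Y n \<rho> i) B = of_nat n * emeasure \<rho> (cell n i \<times> B)" if "B \<in> sets borel" for B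
    unfolding em[OF that] using aeY assms(2) that
    by (intro arg_cong[where f="\<lambda>x. of_nat n * x"] emeasure_eq_AE) (auto simp: s borel_Times)
  have sc: "sets (cell_marginal Y n \<rho> i) = sets borel" "space (cell_marginal Y n \<rho> i) = UNIV"
    by (simp_all add: cell_marginal_def marginalY_def space_scale_measure)
  have "emeasure (cell_marginal Y n \<rho> i) UNIV = of_nat n * ennreal (1 / real n)"
    using u assms(3) by (subst em') (auto simp: uniform_plan_def)
  also have "\<dots> = 1" using assms(3) by (simp add: ennreal_of_nat_eq_real_of_nat ennreal_mult[symmetric])
  finally have "prob_space (cell_marginal Y n \<rho> i)" by (intro prob_spaceI) (simp add: sc)
  moreover have "emeasure (cell_marginal Y n \<rho> i) (- Y) = 0" using assms(2) by (subst em) auto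
  ultimately show "cell_marginal Y n \<rho> i \<in> prob_on Y" by (simp add: prob_on_def sc)
  show "cdf (cell_marginal Y n \<rho> i) t = cell_cdf n \<rho> i t"
    unfolding cdf_def cell_cdf_def measure_def[of "cell_marginal Y n \<rho> i"]
    by (subst em') (auto simp: emeasure_eq_measure enn2real_mult ennreal_of_nat_eq_real_of_nat ennreal_mult[symmetric])
qed

text \<open>
  Two pairs of consecutive indices whose first entries have the same parity share an index only if
  they coincide.
\<close>

lemma composite_partition_members:
  assumes "J \<in> composite_partition n k" "even n" "0 < n"
  shows "J \<subseteq> {..<n}" "finite J" "J' \<in> composite_partition n k \<Longrightarrow> i \<in> J \<Longrightarrow> i \<in> J' \<Longrightarrow> J = J'"
proof -
  show sub: "J \<subseteq> {..<n}" using assms by (auto simp: composite_partition_def partition_A_def partition_B_def split: if_splits)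
  then show "finite J" by (rule finite_subset) simp
  assume J': "J' \<in> composite_partition n k" "i \<in> J" "i \<in> J'"
  show "J = J'"
  proof (cases "odd k")
    case True
    then obtain j j' where "J = {j, j + 1}" "even j" "J' = {j', j' + 1}" "even j'"
      using assms(1) J'(1) by (auto simp: composite_partition_def partition_A_def)
    moreover from this have "j = j'" using J'(2,3) by (auto; presburger)
    ultimately show ?thesis by simp
  next
    case False
    obtain m where m: "n = 2 * m" using assms(2) by blast
    have form: "K = {0} \<or> K = {n - 1} \<or> (\<exists>j. K = {j, j + 1} \<and> odd j \<and> j + 1 < n - 1)" if "K \<in> composite_partition n k" for K
      using that False by (auto simp: composite_partition_def partition_B_def)
    show ?thesis
      using form[OF assms(1)] form[OF J'(1)] J'(2,3) assms(2,3) by (auto; presburger)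
  qed
qed

lemma finite_composite_partition: "even n \<Longrightarrow> 0 < n \<Longrightarrow> finite (composite_partition n k)"
  by (rule finite_subset[of _ "Pow {..<n}"]) (use composite_partition_members(1) in auto)

lemma composite_partition_covers:
  assumes "even n" "i < n"
  shows "\<exists>J\<in>composite_partition n k. i \<in> J"
proof (cases "odd k")
  case True
  show ?thesis
  proof (cases "even i")
    case True
    then have "i + 1 < n" using assms by presburger
    then have "{i, i + 1} \<in> composite_partition n k" using \<open>odd k\<close> True by (auto simp: composite_partition_def partition_A_def)
    then show ?thesis by blast
  next
    case False
    then obtain j where j: "i = j + 1" "even j" by (metis Suc_eq_plus1 even_Suc not0_implies_Suc odd_pos less_numeral_extra(3))
    then have "{j, j + 1} \<in> composite_partition n k" using \<open>odd k\<close> assms by (auto simp: composite_partition_def partition_A_def)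
    then show ?thesis using j by blast
  qed
next
  case False
  consider "i = 0" | "i = n - 1" | "odd i" "i < n - 1" | "even i" "0 < i" "i < n - 1" using assms by linarith
  then show ?thesis
  proof cases
    case 3
    then have "i + 1 < n - 1" using assms by presburger
    then have "{i, i + 1} \<in> composite_partition n k" using False 3 by (auto simp: composite_partition_def partition_B_def)
    then show ?thesis by blast
  next
    case 4
    then obtain j where j: "i = j + 1" "odd j" by (metis Suc_eq_plus1 even_Suc not0_implies_Suc less_numeral_extra(3))
    then have "{j, j + 1} \<in> composite_partition n k" using False 4 by (auto simp: composite_partition_def partition_B_def)
    then show ?thesis using j by blast
  qed (use False in \<open>auto simp: composite_partition_def partition_B_def\<close>)
qed

lemma cells_overlap_null:
  assumes "i \<noteq> j" "0 < n" shows "cell n i \<inter> cell n j \<subseteq> {real (max i j) / real n}"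
proof
  fix x assume "x \<in> cell n i \<inter> cell n j"
  then have "real i \<le> x * real n" "x * real n \<le> real i + 1" "real j \<le> x * real n" "x * real n \<le> real j + 1"
    using assms(2) by (auto simp: cell_def field_simps)
  then have "x * real n = real (max i j)" using assms(1) by linarith
  then show "x \<in> {real (max i j) / real n}" using assms(2) by (simp add: field_simps)
qed

lemma emeasure_composite_cell_disjoint:
  assumes "finite J" "i \<notin> J" "0 < n" shows "emeasure lborel (composite_cell n J \<inter> cell n i) = 0"
proof -
  have "composite_cell n J \<inter> cell n i \<subseteq> (\<lambda>j. real (max i j) / real n) ` J"
    using cells_overlap_null[of i _ n] assms by (force simp: composite_cell_def)
  then have "finite (composite_cell n J \<inter> cell n i)" using assms(1) by (metis finite_imageI finite_subset)
  then show ?thesis by (intro emeasure_lborel_countable countable_finite)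
qed


text \<open>
  One iteration: \<open>\<rho>\<close> is the previous plan, \<open>\<sigma> J\<close> the minimizer on the composite cell \<open>J\<close>, and \<open>\<rho>'\<close> the
  new plan.
\<close>

locale dd_step =
  fixes h :: "real \<Rightarrow> real" and c :: "real \<times> real \<Rightarrow> real" and Y :: "real set" and n k :: nat
    and \<rho> \<rho>' :: "(real \<times> real) measure" and \<sigma> :: "nat set \<Rightarrow> (real \<times> real) measure"
  assumes n: "even n" "0 < n" and Y: "compact Y" and h: "strictly_convex h"
    and c: "\<And>x y. x \<in> X \<Longrightarrow> y \<in> Y \<Longrightarrow> c (x, y) = h (x - y)"
    and prev: "uniform_plan n Y \<rho>"
    and minim: "\<And>J. J \<in> composite_partition n k \<Longrightarrow> is_cell_minimizer c Y n \<rho> J (\<sigma> J)"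
    and sum: "is_measure_sum (composite_partition n k) \<sigma> \<rho>'"
begin

lemma prev_props: "sets \<rho> = sets borel" "finite_measure \<rho>" "AE z in \<rho>. snd z \<in> Y"
    "AE z in \<rho>. fst z \<noteq> p" "i < n \<Longrightarrow> emeasure \<rho> (cell n i \<times> UNIV) = ennreal (1 / real n)"
  using prev by (auto simp: uniform_plan_def)

lemma closed_Y: "closed Y" using Y by (rule compact_imp_closed)

lemma cell_subset: "i < n \<Longrightarrow> cell n i \<subseteq> X"
  by (auto simp: cell_def divide_simps)

lemma composite_cell_subset: "J \<in> composite_partition n k \<Longrightarrow> composite_cell n J \<subseteq> X"
proof
  fix x assume "J \<in> composite_partition n k" "x \<in> composite_cell n J"
  then obtain i where "i < n" "x \<in> cell n i"
    using composite_partition_members(1)[OF _ n, of J k] by (auto simp: composite_cell_def)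
  then show "x \<in> X" using subsetD[OF cell_subset] by blast
qed

lemma sets_composite: "J \<in> composite_partition n k \<Longrightarrow> composite_cell n J \<in> sets borel"
  using composite_partition_members(2)[OF _ n] by (rule sets_composite_cell)

context
  fixes J assumes J: "J \<in> composite_partition n k"
begin

lemma coupling: "\<sigma> J \<in> couplings (restr \<mu> (composite_cell n J)) (marginalY (restr \<rho> (composite_cell n J \<times> Y)))"
  using minim[OF J] by (auto simp: is_cell_minimizer_def is_arg_min_def)

lemma sets_sigma: "sets (\<sigma> J) = sets borel" using coupling by (simp add: couplings_def)

lemma space_sigma: "space (\<sigma> J) = UNIV" using sets_eq_imp_space_eq[OF sets_sigma] by simp

lemma sigma_fst: "A \<in> sets borel \<Longrightarrow> emeasure (\<sigma> J) (A \<times> UNIV) = emeasure lborel (composite_cell n J \<inter> A)"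
proof -
  assume A: "A \<in> sets borel"
  have "emeasure (\<sigma> J) (A \<times> UNIV) = emeasure (restr \<mu> (composite_cell n J)) A"
    using emeasure_coupling(1)[OF coupling A] .
  also have "\<dots> = emeasure \<mu> (composite_cell n J \<inter> A)"
    unfolding restr_def using A sets_composite[OF J] by (intro emeasure_restricted) (auto simp: \<mu>_def restr_def)
  also have "\<dots> = emeasure lborel (X \<inter> (composite_cell n J \<inter> A))"
    using A sets_composite[OF J] by (intro emeasure_mu) auto
  also have "X \<inter> (composite_cell n J \<inter> A) = composite_cell n J \<inter> A" using composite_cell_subset[OF J] by auto
  finally show ?thesis .
qed

lemma sigma_snd: "B \<in> sets borel \<Longrightarrow> emeasure (\<sigma> J) (UNIV \<times> B) = emeasure \<rho> (composite_cell n J \<times> (Y \<inter> B))"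
  using emeasure_coupling(2)[OF coupling] emeasure_marginalY_restr[OF prev_props(1) sets_composite[OF J]] closed_Y by simp

lemma sigma_snd': "B \<in> sets borel \<Longrightarrow> emeasure (\<sigma> J) (UNIV \<times> B) = emeasure \<rho> (composite_cell n J \<times> B)"
  unfolding sigma_snd using prev_props(1,3) closed_Y sets_composite[OF J]
  by (intro emeasure_eq_AE) (auto simp: borel_Times)

lemma finite_sigma: "finite_measure (\<sigma> J)"
proof (intro finite_measureI)
  have "emeasure (\<sigma> J) (space (\<sigma> J)) = emeasure lborel (composite_cell n J \<inter> UNIV)"
    using sigma_fst[of UNIV] by (simp add: space_sigma)
  also have "\<dots> < \<infinity>"
    using composite_cell_subset[OF J] by (intro emeasure_bounded_finite) (auto intro: bounded_subset[of X])
  finally show "emeasure (\<sigma> J) (space (\<sigma> J)) \<noteq> \<infinity>" by simp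
qed

lemma sigma_AE: "AE z in \<sigma> J. snd z \<in> Y" "AE z in \<sigma> J. fst z \<in> composite_cell n J" "AE z in \<sigma> J. fst z \<noteq> p"
proof -
  show "AE z in \<sigma> J. snd z \<in> Y"
    using sigma_snd[of "- Y"] closed_Y
    by (intro AE_null_setI[of "UNIV \<times> - Y"]) (auto simp: sets_sigma borel_Times)
  show "AE z in \<sigma> J. fst z \<in> composite_cell n J"
    using sigma_fst[of "- composite_cell n J"] sets_composite[OF J]
    by (intro AE_null_setI[of "(- composite_cell n J) \<times> UNIV"]) (auto simp: sets_sigma borel_Times)
  have "emeasure lborel (composite_cell n J \<inter> {p}) = 0"
    by (intro emeasure_lborel_countable) auto
  then show "AE z in \<sigma> J. fst z \<noteq> p"
    using sigma_fst[of "{p}"]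
    by (intro AE_null_setI[of "{p} \<times> UNIV"]) (auto simp: sets_sigma borel_Times)
qed

text \<open>
  On \<open>X\<^sub>J \<times> Y\<close> the cost agrees with \<open>h (x - y)\<close>, which is bounded there and favours monotone couplings
  strictly.
\<close>

lemma sigma_no_crossing:
  "AE p in \<sigma> J \<Otimes>\<^sub>M \<sigma> J. \<not> (fst (fst p) - fst (snd p)) * (snd (fst p) - snd (snd p)) < 0"
proof -
  let ?S = "composite_cell n J"
  let ?G = "?S \<times> Y"
  define f where "f z = indicator ?G z * h (fst z - snd z)" for z
  have G[measurable]: "?G \<in> sets borel" using sets_composite[OF J] closed_Y by (simp add: borel_Times)
  have hc: "continuous_on A (\<lambda>z. h (fst z - snd z))" for A :: "(real \<times> real) set"
    by (rule continuous_on_compose2[OF strictly_convex_continuous[OF h]]) (auto intro!: continuous_intros)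
  have [measurable]: "(\<lambda>z. h (fst z - snd z)) \<in> borel_measurable borel"
    by (rule borel_measurable_continuous_onI[OF hc])
  have "compact (X \<times> Y)" using Y by (intro compact_Times) auto
  then have "bounded ((\<lambda>z. h (fst z - snd z)) ` (X \<times> Y))"
    by (intro compact_imp_bounded compact_continuous_image hc)
  then obtain C where C: "\<And>z. z \<in> X \<times> Y \<Longrightarrow> \<bar>h (fst z - snd z)\<bar> \<le> C"
    by (fastforce simp: bounded_iff)
  have LINT_eq: "(LINT z:?G|m. c z) = (LINT z|m. f z)" for m
    unfolding set_lebesgue_integral_def f_def using composite_cell_subset[OF J] c
    by (intro Bochner_Integration.integral_cong) (auto simp: indicator_def)
  have marg: "marginalX (\<sigma> J) = restr \<mu> ?S" "marginalY (\<sigma> J) = marginalY (restr \<rho> ?G)"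
    using coupling by (simp_all add: couplings_def)
  show ?thesis
  proof (rule minimizer_no_crossing[where f = f and G = ?G and C = "\<bar>C\<bar>", OF finite_sigma sets_sigma])
    show "f \<in> borel_measurable borel" unfolding f_def by measurable
    show "\<bar>f z\<bar> \<le> \<bar>C\<bar>" for z
      using C[of z] composite_cell_subset[OF J] by (auto simp: f_def indicator_def)
    show "AE z in \<sigma> J. z \<in> ?G" using sigma_AE(1,2) by eventually_elim (auto simp: mem_Times_iff)
    show "f (x, y') + f (x', y) < f (x, y) + f (x', y')"
      if "(x, y) \<in> ?G" "(x', y') \<in> ?G" "x < x'" "y' < y" for x y x' y'
      using strictly_convex_swap[OF h that(3,4)] that(1,2) by (simp add: f_def)
    show "(LINT z|\<sigma> J. f z) \<le> (LINT z|\<rho>. f z)"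
      if "\<rho> \<in> couplings (marginalX (\<sigma> J)) (marginalY (\<sigma> J))" for \<rho>
      using minim[OF J] that unfolding marg by (auto simp: is_cell_minimizer_def is_arg_min_def LINT_eq not_less)
  qed (use G in simp)
qed

lemma cell_in_composite: "i \<in> J \<Longrightarrow> composite_cell n J \<inter> cell n i = cell n i"
  by (auto simp: composite_cell_def)

end

lemma emeasure_cell: "emeasure lborel (cell n i) = ennreal (1 / real n)"
  using n by (simp add: cell_def divide_simps)

text \<open>
  The other composite cells meet this cell in at most finitely many points of
  \<open>X\<close>, where the first marginal has no mass.
\<close>

lemma sum_on_cell:
  assumes J: "J \<in> composite_partition n k" and i: "i \<in> J" and B: "B \<in> sets borel"
  shows "emeasure \<rho>' (cell n i \<times> B) = emeasure (\<sigma> J) (cell n i \<times> B)"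
proof -
  have "emeasure \<rho>' (cell n i \<times> B) = (\<Sum>J'\<in>composite_partition n k. emeasure (\<sigma> J') (cell n i \<times> B))"
    using sum B by (simp add: is_measure_sum_def borel_Times)
  also have "\<dots> = (\<Sum>J'\<in>{J}. emeasure (\<sigma> J') (cell n i \<times> B))"
  proof (rule sum.mono_neutral_right)
    show "finite (composite_partition n k)" by (rule finite_composite_partition[OF n])
    show "{J} \<subseteq> composite_partition n k" using J by simp
    show "\<forall>J'\<in>composite_partition n k - {J}. emeasure (\<sigma> J') (cell n i \<times> B) = 0"
    proof
      fix J' assume J': "J' \<in> composite_partition n k - {J}"
      then have "i \<notin> J'" using composite_partition_members(3)[OF J n, of J' i] i by auto
      then have "emeasure lborel (composite_cell n J' \<inter> cell n i) = 0"
        using composite_partition_members(2)[OF _ n] J' n(2) by (intro emeasure_composite_cell_disjoint) auto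
      moreover have "emeasure (\<sigma> J') (cell n i \<times> B) \<le> emeasure (\<sigma> J') (cell n i \<times> UNIV)"
        using J' sets_sigma[of J'] by (intro emeasure_mono) (auto simp: borel_Times)
      ultimately show "emeasure (\<sigma> J') (cell n i \<times> B) = 0"
        using J' sigma_fst[of J' "cell n i"] by simp
    qed
  qed
  finally show ?thesis by simp
qed

lemma step_uniform: "uniform_plan n Y \<rho>'"
  unfolding uniform_plan_def
proof (intro conjI allI impI)
  let ?P = "composite_partition n k"
  show s: "sets \<rho>' = sets borel" using sum by (simp add: is_measure_sum_def)
  have sp: "space \<rho>' = UNIV" using sets_eq_imp_space_eq[OF s] by simp
  have em: "emeasure \<rho>' B = (\<Sum>J\<in>?P. emeasure (\<sigma> J) B)" if "B \<in> sets borel" for B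
    using sum that by (simp add: is_measure_sum_def)
  have "emeasure \<rho>' UNIV = (\<Sum>J\<in>?P. ennreal (measure (\<sigma> J) UNIV))"
    unfolding em[of UNIV, simplified] by (intro sum.cong refl finite_measure.emeasure_eq_measure finite_sigma)
  then have "emeasure \<rho>' (space \<rho>') = ennreal (\<Sum>J\<in>?P. measure (\<sigma> J) UNIV)"
    by (simp add: sp)
  then show "finite_measure \<rho>'" by (intro finite_measureI) simp
  have null: "AE z in \<rho>'. Q z" if "{z. \<not> Q z} \<in> sets borel" "\<And>J. J \<in> ?P \<Longrightarrow> AE z in \<sigma> J. Q z" for Q
  proof (rule AE_null_setI[of "{z. \<not> Q z}"])
    have "emeasure (\<sigma> J) {z. \<not> Q z} = 0" if J: "J \<in> ?P" for J
    proof -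
      have "emeasure (\<sigma> J) {z. \<not> Q z} = emeasure (\<sigma> J) {}"
        using \<open>{z. \<not> Q z} \<in> sets borel\<close> that(1) \<open>\<And>J. J \<in> ?P \<Longrightarrow> AE z in \<sigma> J. Q z\<close>[OF J]
        by (intro emeasure_eq_AE) (auto simp: sets_sigma[OF J])
      then show ?thesis by simp
    qed
    then show "emeasure \<rho>' {z. \<not> Q z} = 0" using that(1) by (simp add: em)
  qed (use that s in auto)
  have eqs: "{z :: real \<times> real. \<not> snd z \<in> Y} = UNIV \<times> - Y" "{z :: real \<times> real. fst z = p} = {p} \<times> UNIV" for p
    by auto
  show "AE z in \<rho>'. snd z \<in> Y" using closed_Y by (intro null sigma_AE) (simp_all add: eqs borel_Times)
  show "AE z in \<rho>'. fst z \<noteq> p" for p by (intro null sigma_AE) (simp_all add: eqs(2) borel_Times)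
  fix i assume "i < n"
  then obtain J where "J \<in> ?P" "i \<in> J" using composite_partition_covers[OF n(1)] by blast
  then show "emeasure \<rho>' (cell n i \<times> UNIV) = ennreal (1 / real n)"
    by (simp add: sum_on_cell sigma_fst cell_in_composite emeasure_cell)
qed

lemma step_singleton:
  assumes J: "{i} \<in> composite_partition n k"
  shows "cell_cdf n \<rho>' i t = cell_cdf n \<rho> i t"
proof -
  have S: "composite_cell n {i} = cell n i" by (simp add: composite_cell_def)
  have "emeasure \<rho>' (cell n i \<times> {..t}) = emeasure (\<sigma> {i}) (cell n i \<times> {..t})"
    by (rule sum_on_cell[OF J]) auto
  also have "\<dots> = emeasure (\<sigma> {i}) (UNIV \<times> {..t})"
    using sigma_AE(2)[OF J] by (intro emeasure_eq_AE) (auto simp: S sets_sigma[OF J] borel_Times)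
  also have "\<dots> = emeasure \<rho> (cell n i \<times> {..t})" by (simp add: sigma_snd'[OF J] S)
  finally show ?thesis by (simp add: cell_cdf_def measure_def)
qed

lemma emeasure_adjacent_cells:
  assumes "sets m = sets borel" "AE z in m. fst z \<noteq> real (i + 1) / real n" "B \<in> sets borel"
  shows "emeasure m ((cell n i \<union> cell n (i + 1)) \<times> B) = emeasure m (cell n i \<times> B) + emeasure m (cell n (i + 1) \<times> B)"
proof -
  let ?q = "real (i + 1) / real n"
  let ?H = "{real i / real n..<?q}"
  have "real i / real n \<le> ?q" by (simp add: divide_right_mono)
  moreover have "?q \<le> (real (i + 1) + 1) / real n" by (simp add: divide_right_mono)
  ultimately have "(cell n i \<union> cell n (i + 1)) = ?H \<union> cell n (i + 1)"
    by (auto simp: cell_def add.commute)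
  then have "emeasure m ((cell n i \<union> cell n (i + 1)) \<times> B) = emeasure m ((?H \<times> B) \<union> (cell n (i + 1) \<times> B))"
    by (simp add: Sigma_Un_distrib1)
  also have "\<dots> = emeasure m (?H \<times> B) + emeasure m (cell n (i + 1) \<times> B)"
    using assms by (intro plus_emeasure[symmetric]) (auto simp: borel_Times cell_def)
  also have "emeasure m (?H \<times> B) = emeasure m (cell n i \<times> B)"
    using assms by (intro emeasure_eq_AE) (auto simp: borel_Times cell_def add.commute elim!: eventually_mono)
  finally show ?thesis .
qed

text \<open>
  Let \<open>q\<close> be the common endpoint of the two cells. Points to the left of \<open>q\<close> and above \<open>t\<close> cross all
  points to the right of \<open>q\<close> and at most \<open>t\<close>, so one of these two sets is null: either the left cell
  is entirely below \<open>t\<close> or the right cell is entirely above.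
\<close>

lemma step_pair:
  assumes "{i, i + 1} \<in> composite_partition n k"
  shows "half_split (cell_cdf n \<rho> i t) (cell_cdf n \<rho> (i + 1) t) (cell_cdf n \<rho>' i t) (cell_cdf n \<rho>' (i + 1) t)"
proof -
  define K where "K = {i, i + 1}"
  have J: "K \<in> composite_partition n k" and in_K: "i \<in> K" "i + 1 \<in> K" using assms by (auto simp: K_def)
  let ?q = "real (i + 1) / real n"
  interpret S: finite_measure "\<sigma> K" by (rule finite_sigma[OF J])
  interpret R: finite_measure \<rho> by (rule prev_props)
  have S: "composite_cell n K = cell n i \<union> cell n (i + 1)" by (simp add: composite_cell_def K_def)
  let ?u = "measure (\<sigma> K) (cell n i \<times> {..t})" and ?w = "measure (\<sigma> K) (cell n (i + 1) \<times> {..t})"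
  have new: "measure \<rho>' (cell n i \<times> {..t}) = ?u" "measure \<rho>' (cell n (i + 1) \<times> {..t}) = ?w"
    using sum_on_cell[OF J in_K(1), of "{..t}"] sum_on_cell[OF J in_K(2), of "{..t}"] by (simp_all add: measure_def)
  have "emeasure (\<sigma> K) (cell n i \<times> {..t}) + emeasure (\<sigma> K) (cell n (i + 1) \<times> {..t})
      = emeasure (\<sigma> K) (composite_cell n K \<times> {..t})"
    unfolding S by (intro emeasure_adjacent_cells[symmetric] sets_sigma[OF J] sigma_AE(3)[OF J]) simp
  also have "\<dots> = emeasure (\<sigma> K) (UNIV \<times> {..t})"
    using sigma_AE(2)[OF J] sets_composite[OF J] by (intro emeasure_eq_AE) (auto simp: sets_sigma[OF J] borel_Times)
  also have "\<dots> = emeasure \<rho> (composite_cell n K \<times> {..t})" by (simp add: sigma_snd'[OF J])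
  also have "\<dots> = emeasure \<rho> (cell n i \<times> {..t}) + emeasure \<rho> (cell n (i + 1) \<times> {..t})"
    unfolding S using prev_props by (intro emeasure_adjacent_cells) auto
  finally have total: "?u + ?w = measure \<rho> (cell n i \<times> {..t}) + measure \<rho> (cell n (i + 1) \<times> {..t})"
    by (simp add: S.emeasure_eq_measure R.emeasure_eq_measure ennreal_plus[symmetric] del: ennreal_plus)
  have full: "measure (\<sigma> K) (cell n j \<times> UNIV) = 1 / real n" if "j \<in> K" for j
    using sigma_fst[OF J, of "cell n j"] that by (simp add: cell_in_composite[OF J] emeasure_cell measure_def)
  have half: "?u \<le> 1 / real n" "?w \<le> 1 / real n"
    using S.finite_measure_mono[of "cell n i \<times> {..t}" "cell n i \<times> UNIV"]
      S.finite_measure_mono[of "cell n (i + 1) \<times> {..t}" "cell n (i + 1) \<times> UNIV"] full in_K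
    by (auto simp: sets_sigma[OF J] borel_Times)
  let ?P = "{..<?q} \<times> {t<..}" and ?R = "{?q<..} \<times> {..t}"
  have PR: "?P \<in> sets (\<sigma> K)" "?R \<in> sets (\<sigma> K)" by (auto simp: sets_sigma[OF J] borel_Times)
  have "emeasure (\<sigma> K \<Otimes>\<^sub>M \<sigma> K) (?P \<times> ?R) = emeasure (\<sigma> K \<Otimes>\<^sub>M \<sigma> K) {}"
  proof (rule emeasure_eq_AE)
    show "AE p in \<sigma> K \<Otimes>\<^sub>M \<sigma> K. p \<in> ?P \<times> ?R \<longleftrightarrow> p \<in> {}"
      using sigma_no_crossing[OF J] by eventually_elim (auto simp: mult_less_0_iff)
  qed (use PR in auto)
  then have "emeasure (\<sigma> K) ?P * emeasure (\<sigma> K) ?R = 0"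
    using PR by (simp add: S.emeasure_pair_measure_Times)
  then consider "emeasure (\<sigma> K) ?P = 0" | "emeasure (\<sigma> K) ?R = 0" by auto
  then have saturated: "?u = 1 / real n \<or> ?w = 0"
  proof cases
    case 1
    then have aeN: "AE z in \<sigma> K. z \<notin> ?P" using PR by (intro AE_not_in) auto
    have "emeasure (\<sigma> K) (cell n i \<times> {..t}) = emeasure (\<sigma> K) (cell n i \<times> UNIV)"
    proof (rule emeasure_eq_AE[rotated])
      show "AE z in \<sigma> K. z \<in> cell n i \<times> {..t} \<longleftrightarrow> z \<in> cell n i \<times> UNIV"
        using sigma_AE(3)[OF J, of ?q] aeN
        by eventually_elim (auto simp: cell_def add.commute not_le)
    qed (auto simp: sets_sigma[OF J] borel_Times)
    then show ?thesis using full in_K by (simp add: measure_def)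
  next
    case 2
    then have aeN: "AE z in \<sigma> K. z \<notin> ?R" using PR by (intro AE_not_in) auto
    have "emeasure (\<sigma> K) (cell n (i + 1) \<times> {..t}) = emeasure (\<sigma> K) {}"
    proof (rule emeasure_eq_AE[rotated])
      show "AE z in \<sigma> K. z \<in> cell n (i + 1) \<times> {..t} \<longleftrightarrow> z \<in> {}"
        using sigma_AE(3)[OF J, of ?q] aeN
        by eventually_elim (auto simp: cell_def add.commute not_le)
    qed (auto simp: sets_sigma[OF J] borel_Times)
    then show ?thesis by (simp add: measure_def)
  qed
  define u w where "u = real n * ?u" and "w = real n * ?w"
  have "u = 1 \<or> w = 0" using saturated n by (auto simp: u_def w_def)
  moreover have "0 \<le> w" "u \<le> 1" using half n by (simp_all add: u_def w_def field_simps)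
  moreover have "cell_cdf n \<rho> i t + cell_cdf n \<rho> (i + 1) t = u + w"
    using total by (simp add: u_def w_def cell_cdf_def distrib_left[symmetric])
  moreover have "cell_cdf n \<rho>' i t = u" "cell_cdf n \<rho>' (i + 1) t = w"
    by (simp_all only: cell_cdf_def new u_def w_def)
  ultimately show ?thesis unfolding half_split_def by auto
qed

end

section \<open>Least measures dominating subadditive set functions\<close>

lemma measure_from_emeasure:
  assumes "f {} = 0"
    and add: "\<And>A. range A \<subseteq> sets R \<Longrightarrow> disjoint_family A \<Longrightarrow> (\<Sum>i. f (A i)) = f (\<Union>i. A i)"
  shows "\<exists>m. sets m = sets R \<and> (\<forall>B\<in>sets R. emeasure m B = f B)"
proof -
  let ?m = "measure_of (space R) (sets R) f"
  have "positive (sets R) f" using assms(1) by (simp add: positive_def)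
  moreover have "countably_additive (sets R) f" using add by (simp add: countably_additive_def)
  ultimately have "emeasure ?m B = f B" if "B \<in> sets R" for B
    using that by (intro emeasure_measure_of_sigma sets.sigma_algebra_axioms)
  then show ?thesis by (intro exI[of _ ?m]) simp
qed

context
  fixes R :: "'a measure" and F :: "('a set \<Rightarrow> ennreal) set" and dom :: "'a measure \<Rightarrow> bool"
  assumes subadd: "\<And>f A B. f \<in> F \<Longrightarrow> A \<in> sets R \<Longrightarrow> B \<in> sets R \<Longrightarrow> f (A \<union> B) \<le> f A + f B"
    and dom: "\<And>m. dom m \<longleftrightarrow> sets m = sets R \<and> finite_measure m \<and> (\<forall>f\<in>F. \<forall>B\<in>sets R. f B \<le> emeasure m B)"
begin

text \<open>
  Take the smaller of the two measures on each part of a Hahn decomposition. Finite subadditivity is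
  what makes the result dominating again.
\<close>

lemma dominating_inf:
  assumes "dom m1" "dom m2"
  shows "\<exists>m. dom m \<and> (\<forall>B\<in>sets R. emeasure m B \<le> emeasure m1 B \<and> emeasure m B \<le> emeasure m2 B)"
proof -
  have s1: "sets m1 = sets R" and s2: "sets m2 = sets R" and f1: "finite_measure m1" and f2: "finite_measure m2"
    using assms by (auto simp: dom)
  interpret M1: finite_measure m1 by fact
  interpret M2: finite_measure m2 by fact
  obtain Y where Y: "Y \<in> sets R"
    and le1: "\<And>B. B \<in> sets R \<Longrightarrow> B \<subseteq> Y \<Longrightarrow> emeasure m2 B \<le> emeasure m1 B"
    and le2: "\<And>B. B \<in> sets R \<Longrightarrow> B \<inter> Y = {} \<Longrightarrow> emeasure m1 B \<le> emeasure m2 B"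
    using finite_unsigned_Hahn_decomposition[OF f1 f2] by (auto simp: s1 s2)
  let ?f = "\<lambda>B. emeasure m2 (B \<inter> Y) + emeasure m1 (B - Y)"
  have "\<exists>m. sets m = sets R \<and> (\<forall>B\<in>sets R. emeasure m B = ?f B)"
  proof (rule measure_from_emeasure)
    fix A :: "nat \<Rightarrow> 'a set" assume A: "range A \<subseteq> sets R" "disjoint_family A"
    have "(\<Sum>i. ?f (A i)) = (\<Sum>i. emeasure m2 (A i \<inter> Y)) + (\<Sum>i. emeasure m1 (A i - Y))"
      by (rule suminf_add[symmetric]) auto
    also have "(\<Sum>i. emeasure m2 (A i \<inter> Y)) = emeasure m2 (\<Union>i. A i \<inter> Y)"
      using A Y s2 by (intro suminf_emeasure) (auto simp: disjoint_family_on_def)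
    also have "(\<Sum>i. emeasure m1 (A i - Y)) = emeasure m1 (\<Union>i. A i - Y)"
      using A Y s1 by (intro suminf_emeasure) (auto simp: disjoint_family_on_def)
    finally show "(\<Sum>i. ?f (A i)) = ?f (\<Union>i. A i)" by simp
  qed simp
  then obtain m where sm: "sets m = sets R" and m: "\<And>B. B \<in> sets R \<Longrightarrow> emeasure m B = ?f B" by auto
  have split: "emeasure m' B = emeasure m' (B \<inter> Y) + emeasure m' (B - Y)"
    if "sets m' = sets R" "B \<in> sets R" for m' B
    using that Y plus_emeasure[of "B \<inter> Y" m' "B - Y"] by (simp add: Int_Diff_disjoint Int_Diff_Un)
  have le: "emeasure m B \<le> emeasure m1 B \<and> emeasure m B \<le> emeasure m2 B" if B: "B \<in> sets R" for B
  proof -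
    have "emeasure m2 (B \<inter> Y) \<le> emeasure m1 (B \<inter> Y)" "emeasure m1 (B - Y) \<le> emeasure m2 (B - Y)"
      using B Y by (auto intro: le1 le2)
    then show ?thesis
      unfolding m[OF B] split[OF s1 B] split[OF s2 B] by (simp add: add_mono)
  qed
  have "dom m"
    unfolding dom
  proof (intro conjI ballI)
    show "sets m = sets R" by fact
    have "space m = space m1" using sm s1 by (simp cong: sets_eq_imp_space_eq)
    then have "emeasure m (space m) \<le> emeasure m1 (space m1)"
      using le[of "space m1"] s1 sets.top[of m1] by simp
    then show "finite_measure m"
      by (intro finite_measureI) (auto simp: top_unique)
    fix f B assume f: "f \<in> F" and B: "B \<in> sets R"
    have "f B = f ((B \<inter> Y) \<union> (B - Y))" by (simp add: Int_Diff_Un)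
    also have "\<dots> \<le> f (B \<inter> Y) + f (B - Y)" using f B Y by (intro subadd) auto
    also have "\<dots> \<le> emeasure m2 (B \<inter> Y) + emeasure m1 (B - Y)"
      using assms f B Y by (intro add_mono) (auto simp: dom)
    finally show "f B \<le> emeasure m B" by (simp add: m[OF B])
  qed
  with le show ?thesis by blast
qed

text \<open>
  Monotone convergence along the sequence turns countable additivity of the measures into countable
  additivity of their pointwise infimum.
\<close>

lemma dominating_decreasing_limit:
  assumes "\<And>k. dom (n k)" and dec: "\<And>k B. B \<in> sets R \<Longrightarrow> emeasure (n (Suc k)) B \<le> emeasure (n k) B"
  shows "\<exists>m. dom m \<and> (\<forall>k. \<forall>B\<in>sets R. emeasure m B \<le> emeasure (n k) B)"
proof -
  have s: "sets (n k) = sets R" and fin: "finite_measure (n k)" for k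
    using assms(1) by (auto simp: dom)
  let ?f = "\<lambda>B. INF k. emeasure (n k) B"
  have "\<exists>m. sets m = sets R \<and> (\<forall>B\<in>sets R. emeasure m B = ?f B)"
  proof (rule measure_from_emeasure)
    fix A :: "nat \<Rightarrow> 'a set" assume A: "range A \<subseteq> sets R" "disjoint_family A"
    have sum: "(\<integral>\<^sup>+i. emeasure (n k) (A i) \<partial>count_space UNIV) = emeasure (n k) (\<Union>i. A i)" for k
      unfolding nn_integral_count_space_nat using A s by (intro suminf_emeasure) auto
    have "(\<Sum>i. ?f (A i)) = (\<integral>\<^sup>+i. ?f (A i) \<partial>count_space UNIV)"
      by (simp add: nn_integral_count_space_nat)
    also have "\<dots> = (INF k. \<integral>\<^sup>+i. emeasure (n k) (A i) \<partial>count_space UNIV)"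
    proof (rule nn_integral_monotone_convergence_INF_decseq)
      show "decseq (\<lambda>k i. emeasure (n k) (A i))"
        using A dec by (intro decseq_SucI le_funI) auto
      show "(\<integral>\<^sup>+i. emeasure (n 0) (A i) \<partial>count_space UNIV) < \<infinity>"
        unfolding sum using finite_measure.emeasure_finite[OF fin[of 0]] by (simp add: less_top)
    qed auto
    finally show "(\<Sum>i. ?f (A i)) = ?f (\<Union>i. A i)" by (simp add: sum)
  qed simp
  then obtain m where sm: "sets m = sets R" and m: "\<And>B. B \<in> sets R \<Longrightarrow> emeasure m B = ?f B" by auto
  have le: "emeasure m B \<le> emeasure (n k) B" if "B \<in> sets R" for B k
    unfolding m[OF that] by (rule INF_lower) simp
  have "dom m" unfolding dom
  proof (intro conjI ballI)
    show "sets m = sets R" by fact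
    have "space m = space (n 0)" using sm s by (simp cong: sets_eq_imp_space_eq)
    then have "emeasure m (space m) \<le> emeasure (n 0) (space (n 0))"
      using le[of "space (n 0)" 0] s sets.top[of "n 0"] by simp
    then show "finite_measure m"
      using finite_measure.emeasure_finite[OF fin[of 0]]
      by (intro finite_measureI) (auto simp: top_unique)
    fix f B assume "f \<in> F" "B \<in> sets R"
    then show "f B \<le> emeasure m B" using assms(1) by (auto simp: m dom intro!: INF_greatest)
  qed
  with le show ?thesis by blast
qed

text \<open>
  Among the dominating measures choose one, \<open>m\<close>, of minimal total mass. Its infimum with any other
  dominating measure lies below \<open>m\<close> and has at least the mass of \<open>m\<close>, so it agrees with \<open>m\<close>.
\<close>

lemma least_dominating_measure:
  assumes "dom m0"
  shows "\<exists>m. dom m \<and> (\<forall>m'. dom m' \<longrightarrow> m \<le> m')"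
proof -
  let ?mass = "\<lambda>m. emeasure m (space R)"
  have ne: "?mass ` {m. dom m} \<noteq> {}" using assms by auto
  obtain a :: "nat \<Rightarrow> ennreal" where a: "range a \<subseteq> ?mass ` {m. dom m}" "Inf (?mass ` {m. dom m}) = (INF i. a i)"
    using ennreal_Inf_countable_INF[OF ne] by auto
  have "\<exists>m. dom m \<and> ?mass m = a i" for i
    using subsetD[OF a(1) rangeI[of a i]] by auto
  then obtain q where q: "\<And>i. dom (q i)" "\<And>i. ?mass (q i) = a i" by metis
  have "\<exists>n. \<forall>k. (dom (n k) \<and> ?mass (n k) \<le> a k) \<and> (\<forall>B\<in>sets R. emeasure (n (Suc k)) B \<le> emeasure (n k) B)"
  proof (rule dependent_nat_choice)
    show "\<exists>m. dom m \<and> ?mass m \<le> a 0" using q by (metis order_refl)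
    fix m k assume m: "dom m \<and> ?mass m \<le> a k"
    obtain p where p: "dom p" "\<And>B. B \<in> sets R \<Longrightarrow> emeasure p B \<le> emeasure m B \<and> emeasure p B \<le> emeasure (q (Suc k)) B"
      using dominating_inf[of m "q (Suc k)"] m q(1) by blast
    then show "\<exists>p. (dom p \<and> ?mass p \<le> a (Suc k)) \<and> (\<forall>B\<in>sets R. emeasure p B \<le> emeasure m B)"
      using q(2)[of "Suc k"] p(1) p(2)[OF sets.top] by (intro exI[of _ p]) (simp add: p(2))
  qed
  then obtain n where n: "\<And>k. dom (n k)" "\<And>k. ?mass (n k) \<le> a k"
    "\<And>k B. B \<in> sets R \<Longrightarrow> emeasure (n (Suc k)) B \<le> emeasure (n k) B" by auto
  \<comment> \<open>the chain stays below a minimizing sequence, so its limit has minimal mass\<close>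
  obtain m where m: "dom m" "\<And>k B. B \<in> sets R \<Longrightarrow> emeasure m B \<le> emeasure (n k) B"
    using dominating_decreasing_limit[of n] n by blast
  have "?mass m \<le> (INF i. a i)"
    using m(2)[of "space R"] n(2) by (intro INF_greatest) (meson order_trans sets.top)
  then have minimal: "?mass m \<le> ?mass p" if "dom p" for p
    using that unfolding a(2)[symmetric] by (auto intro: order_trans INF_lower)
  have "m \<le> m'" if m': "dom m'" for m'
  proof -
    have s: "sets m = sets R" "sets m' = sets R" using m(1) m' by (auto simp: dom)
    obtain p where p: "dom p" "\<And>B. B \<in> sets R \<Longrightarrow> emeasure p B \<le> emeasure m B \<and> emeasure p B \<le> emeasure m' B"
      using dominating_inf[OF m(1) m'] by blast
    have sp: "sets p = sets R" using p(1) by (simp add: dom)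
    interpret M: finite_measure m using m(1) by (simp add: dom)
    have "emeasure m B \<le> emeasure m' B" if B: "B \<in> sets R" for B
    proof -
      have c: "emeasure l B + emeasure l (space R - B) = ?mass l" if "sets l = sets R" for l
        using B that plus_emeasure[of B l "space R - B"] sets.sets_into_space[OF B]
        by (simp add: sets.compl_sets Un_absorb1)
      have "emeasure m B + emeasure m (space R - B) \<le> emeasure p B + emeasure p (space R - B)"
        using minimal[OF p(1)] by (simp add: c[OF s(1)] c[OF sp])
      also have "\<dots> \<le> emeasure p B + emeasure m (space R - B)"
        using p(2)[of "space R - B"] B by (intro add_left_mono) auto
      finally have "emeasure m B \<le> emeasure p B"
        using M.emeasure_finite[of "space R - B"]
        by (metis add.commute ennreal_add_left_cancel_le infinity_ennreal_def)
      with p(2)[OF B] show ?thesis by (meson order_trans)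
    qed
    then show ?thesis using s by (simp add: le_measure)
  qed
  with m(1) show ?thesis by blast
qed

end

section \<open>Variation of real functions on open sets\<close>

text \<open>
  Addition of extended nonnegative reals is continuous along decreasing sequences, and every infimum
  over a nonempty set is the limit of such a sequence.
\<close>

lemma le_INF_add_INF:
  fixes c :: ennreal
  assumes "\<And>i j. i \<in> I \<Longrightarrow> j \<in> J \<Longrightarrow> c \<le> f i + g j"
  shows "c \<le> (INF i\<in>I. f i) + (INF j\<in>J. g j)"
proof (cases "I = {} \<or> J = {}")
  case False
  then have ne: "f ` I \<noteq> {}" "g ` J \<noteq> {}" by auto
  obtain a :: "nat \<Rightarrow> ennreal" where a: "range a \<subseteq> f ` I" "Inf (f ` I) = (INF i. a i)"
    using ennreal_Inf_countable_INF[OF ne(1)] by auto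
  obtain b :: "nat \<Rightarrow> ennreal" where b: "range b \<subseteq> g ` J" "Inf (g ` J) = (INF i. b i)"
    using ennreal_Inf_countable_INF[OF ne(2)] by auto
  have "c \<le> a i + b j" for i j
    using subsetD[OF a(1) rangeI[of a i]] subsetD[OF b(1) rangeI[of b j]] assms by auto
  then have "c \<le> (INF j. (INF i. a i + b j))" by (intro INF_greatest) auto
  also have "\<dots> = (INF i. a i) + (INF j. b j)"
    by (simp add: INF_ennreal_add_const INF_ennreal_const_add)
  finally show ?thesis by (simp add: a(2) b(2))
qed (auto simp: top_unique)

lemma continuous_has_antiderivative:
  fixes f :: "real \<Rightarrow> real"
  assumes "continuous_on UNIV f"
  obtains F where "\<And>x. (F has_real_derivative f x) (at x)"
proof -
  have "\<exists>F. \<forall>x :: real. -\<infinity> < ereal x \<longrightarrow> ereal x < \<infinity> \<longrightarrow> (F has_vector_derivative f x) (at x)"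
    using assms by (intro einterval_antiderivative) (auto simp: continuous_on_eq_continuous_at)
  then show ?thesis
    using that by (auto simp: has_real_derivative_iff_has_vector_derivative)
qed

lemma test_functionsI:
  assumes "\<And>x. (\<psi> has_real_derivative D x) (at x)" "continuous_on UNIV D"
    and K: "compact K" "K \<subseteq> A" "\<And>x. x \<notin> K \<Longrightarrow> \<psi> x = 0" and "\<And>x. \<bar>\<psi> x\<bar> \<le> 1"
  shows "\<psi> \<in> test_functions A"
proof -
  have "closure {x. \<psi> x \<noteq> 0} \<subseteq> K"
    using K by (intro closure_minimal compact_imp_closed) auto
  moreover have "compact (closure {x. \<psi> x \<noteq> 0})"
    using compact_Int_closed[OF K(1), of "closure {x. \<psi> x \<noteq> 0}"] calculation by (simp add: Int_absorb1)
  moreover have "\<psi> C1_differentiable_on UNIV"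
    using assms(1,2) unfolding C1_differentiable_on_def has_real_derivative_iff_has_vector_derivative by blast
  ultimately show ?thesis using K assms by (auto simp: test_functions_def)
qed

text \<open>
  Off its closed support a test function is locally zero, so its derivative vanishes there too.
\<close>

lemma test_functionsE:
  assumes "\<psi> \<in> test_functions A"
  obtains D K where "\<And>x. (\<psi> has_real_derivative D x) (at x)" "continuous_on UNIV D" "deriv \<psi> = D"
    "compact K" "K \<subseteq> A" "\<And>x. x \<notin> K \<Longrightarrow> \<psi> x = 0" "\<And>x. x \<notin> K \<Longrightarrow> D x = 0" "\<And>x. \<bar>\<psi> x\<bar> \<le> 1"
proof -
  define K where "K = closure {x. \<psi> x \<noteq> 0}"
  from assms obtain D where D: "\<And>x. (\<psi> has_real_derivative D x) (at x)" "continuous_on UNIV D"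
    by (auto simp: test_functions_def C1_differentiable_on_def has_real_derivative_iff_has_vector_derivative)
  have z: "\<psi> x = 0" if "x \<notin> K" for x using that closure_subset[of "{x. \<psi> x \<noteq> 0}"] unfolding K_def by auto
  have "D x = 0" if "x \<notin> K" for x
  proof -
    have 0: "open (- K)" "x \<in> - K" using that by (auto simp: K_def)
    have "((\<lambda>_. 0) has_real_derivative 0) (at x)" by simp
    then have "(\<psi> has_real_derivative 0) (at x)"
      by (rule has_field_derivative_transform_within_open[OF _ 0]) (use z in auto)
    then show ?thesis by (rule DERIV_unique[OF D(1)])
  qed
  moreover have "deriv \<psi> = D" using D(1) by (auto intro: DERIV_imp_deriv)
  moreover have "compact K" "K \<subseteq> A" "\<And>x. \<bar>\<psi> x\<bar> \<le> 1"
    using assms by (auto simp: test_functions_def K_def)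
  ultimately show ?thesis using that D z by blast
qed

lemma test_functions_mono: "A \<subseteq> B \<Longrightarrow> test_functions A \<subseteq> test_functions B"
  by (auto simp: test_functions_def)

text \<open>
  A \<open>C\<^sup>1\<close> substitute for the indicator of \<open>S\<close>, with derivative \<open>D\<close> and a transition zone of width less
  than \<open>d\<close> around \<open>S\<close>.
\<close>

definition smooth_plateau :: "(real \<Rightarrow> real) \<Rightarrow> (real \<Rightarrow> real) \<Rightarrow> real set \<Rightarrow> real \<Rightarrow> bool" where
  "smooth_plateau \<eta> D S d \<longleftrightarrow> (\<forall>x. (\<eta> has_real_derivative D x) (at x)) \<and> continuous_on UNIV D \<and>
    (\<forall>x. 0 \<le> \<eta> x \<and> \<eta> x \<le> 1) \<and> (\<forall>x. infdist x S \<le> d / 6 \<longrightarrow> \<eta> x = 1) \<and> (\<forall>x. 5 * d / 6 \<le> infdist x S \<longrightarrow> \<eta> x = 0)"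

text \<open>
  The sliding mean over windows of radius \<open>d / 6\<close> of a continuous function is continuously
  differentiable, and takes its values among those of the function on the window.
\<close>

lemma smooth_plateau_exists:
  assumes "0 < d" shows "\<exists>\<eta> D. smooth_plateau \<eta> D S d"
proof -
  \<comment> \<open>equal to one within distance \<open>d / 3\<close> of \<open>S\<close> and to zero beyond \<open>2 d / 3\<close>; the mean over radius \<open>d / 6\<close> costs another \<open>d / 6\<close> on either side\<close>
  define f where "f x = max 0 (min 1 (2 - 3 * infdist x S / d))" for x
  have cf: "continuous_on UNIV f"
    unfolding f_def using assms by (intro continuous_intros) auto
  obtain F where F: "\<And>x. (F has_real_derivative f x) (at x)"
    using continuous_has_antiderivative[OF cf] by blast
  define \<eta> where "\<eta> x = (F (x + d / 6) - F (x - d / 6)) / (d / 3)" for x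
  define D where "D x = (f (x + d / 6) - f (x - d / 6)) / (d / 3)" for x
  have mean: "\<exists>z. \<bar>x - z\<bar> < d / 6 \<and> \<eta> x = f z" for x
  proof -
    obtain z where "x - d / 6 < z" "z < x + d / 6" "F (x + d / 6) - F (x - d / 6) = (x + d / 6 - (x - d / 6)) * f z"
      using MVT2[of "x - d / 6" "x + d / 6" F f] F assms by auto
    then have "\<bar>x - z\<bar> < d / 6 \<and> \<eta> x = f z" using assms by (intro conjI) (linarith, simp add: \<eta>_def)
    then show ?thesis by blast
  qed
  have lip: "\<bar>infdist x S - infdist z S\<bar> \<le> \<bar>x - z\<bar>" for x z
    using infdist_triangle_abs[of x S z] by (simp add: dist_real_def)
  have "smooth_plateau \<eta> D S d" unfolding smooth_plateau_def
  proof (intro conjI allI impI)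
    fix x
    have "((\<lambda>x. F (x + d / 6)) has_real_derivative f (x + d / 6)) (at x)"
      "((\<lambda>x. F (x - d / 6)) has_real_derivative f (x - d / 6)) (at x)"
      using F[of "x + d / 6"] F[of "x - d / 6"] DERIV_shift[of F _ x "d / 6"] DERIV_shift[of F _ x "- (d / 6)"]
      by simp_all
    then show "(\<eta> has_real_derivative D x) (at x)"
      unfolding \<eta>_def D_def by (intro DERIV_cdivide DERIV_diff)
    obtain z where z: "\<bar>x - z\<bar> < d / 6" "\<eta> x = f z" using mean by blast
    show "0 \<le> \<eta> x" "\<eta> x \<le> 1" by (auto simp: z f_def)
    show "\<eta> x = 1" if "infdist x S \<le> d / 6"
    proof -
      have "3 * infdist z S \<le> d" using that z lip[of x z] by linarith
      then have "3 * infdist z S / d \<le> 1" using assms by simp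
      then show ?thesis by (simp add: z f_def)
    qed
    show "\<eta> x = 0" if "5 * d / 6 \<le> infdist x S"
    proof -
      have "2 * d \<le> 3 * infdist z S" using that z lip[of x z] by linarith
      then have "2 \<le> 3 * infdist z S / d" using assms by (simp add: field_simps)
      then show ?thesis by (simp add: z f_def)
    qed
  next
    show "continuous_on UNIV D"
      unfolding D_def using assms
      by (intro continuous_intros continuous_on_compose2[OF cf]) auto
  qed
  then show ?thesis by blast
qed

text \<open>
  Only the compact part \<open>S\<close> of the support that misses \<open>A2\<close> has to be carried by \<open>A1\<close>. It has positive
  distance from the part that misses \<open>A1\<close>, and a plateau around \<open>S\<close> of this width splits the test function.
\<close>

lemma test_function_partition:
  assumes "open A1" "open A2" "\<psi> \<in> test_functions (A1 \<union> A2)"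
  obtains \<psi>1 \<psi>2 where "\<psi>1 \<in> test_functions A1" "\<psi>2 \<in> test_functions A2"
    "\<And>x. deriv \<psi> x = deriv \<psi>1 x + deriv \<psi>2 x"
proof -
  obtain D K where D: "\<And>x. (\<psi> has_real_derivative D x) (at x)" "continuous_on UNIV D" "deriv \<psi> = D"
    and K: "compact K" "K \<subseteq> A1 \<union> A2" "\<And>x. x \<notin> K \<Longrightarrow> \<psi> x = 0" and b: "\<And>x. \<bar>\<psi> x\<bar> \<le> 1"
    using test_functionsE[OF assms(3)] by metis
  show ?thesis
  proof (cases "K \<subseteq> A2")
    case True
    have "(\<lambda>_. 0) \<in> test_functions A1" by (rule test_functionsI[where D="\<lambda>_. 0" and K="{}"]) auto
    moreover have "\<psi> \<in> test_functions A2" by (rule test_functionsI[where D=D and K=K]) (use D K b True in auto)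
    ultimately show ?thesis using that by simp
  next
    case False
    define S where "S = K - A2"
    have S: "compact S" "S \<noteq> {}" "closed S" using False K(1) assms
      by (auto simp: S_def Diff_eq intro: compact_Int_closed compact_imp_closed)
    have T: "closed (K - A1)" using K(1) assms
      by (auto simp: Diff_eq intro: closed_Int compact_imp_closed)
    have "S \<inter> (K - A1) = {}" using K by (auto simp: S_def)
    then obtain d where d: "0 < d" "\<And>x y. x \<in> S \<Longrightarrow> y \<in> K - A1 \<Longrightarrow> d \<le> dist x y"
      using separate_compact_closed[OF S(1) T] by blast
    obtain \<eta> D' where "smooth_plateau \<eta> D' S d" using smooth_plateau_exists[OF d(1)] by blast
    then have \<eta>: "\<And>x. (\<eta> has_real_derivative D' x) (at x)" "continuous_on UNIV D'"
      "\<And>x. 0 \<le> \<eta> x \<and> \<eta> x \<le> 1" "\<And>x. infdist x S \<le> d / 6 \<Longrightarrow> \<eta> x = 1" "\<And>x. 5 * d / 6 \<le> infdist x S \<Longrightarrow> \<eta> x = 0"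
      by (auto simp: smooth_plateau_def)
    have cont: "continuous_on UNIV \<psi>" "continuous_on UNIV \<eta>"
      using D(1) \<eta>(1) by (auto intro!: continuous_at_imp_continuous_on DERIV_isCont)
    have inf: "continuous_on UNIV (\<lambda>x. infdist x S)" by (intro continuous_intros)
    let ?E1 = "\<lambda>x. D' x * \<psi> x + D x * \<eta> x" and ?E2 = "\<lambda>x. D x - (D' x * \<psi> x + D x * \<eta> x)"
    have d1: "((\<lambda>x. \<eta> x * \<psi> x) has_real_derivative ?E1 x) (at x)" for x
      using DERIV_mult[OF \<eta>(1) D(1)] by simp
    have d2: "((\<lambda>x. \<psi> x - \<eta> x * \<psi> x) has_real_derivative ?E2 x) (at x)" for x
      by (intro DERIV_diff D(1) d1)
    have bnd: "\<bar>\<eta> x * \<psi> x\<bar> \<le> 1" "\<bar>\<psi> x - \<eta> x * \<psi> x\<bar> \<le> 1" for x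
    proof -
      show "\<bar>\<eta> x * \<psi> x\<bar> \<le> 1" using \<eta>(3)[of x] b[of x] by (simp add: abs_mult mult_le_one)
      have "\<psi> x - \<eta> x * \<psi> x = (1 - \<eta> x) * \<psi> x" by (simp add: algebra_simps)
      then show "\<bar>\<psi> x - \<eta> x * \<psi> x\<bar> \<le> 1" using \<eta>(3)[of x] b[of x] by (simp add: abs_mult mult_le_one)
    qed
    have "(\<lambda>x. \<eta> x * \<psi> x) \<in> test_functions A1"
    proof (rule test_functionsI[OF d1])
      show "continuous_on UNIV ?E1" by (intro continuous_intros \<eta>(2) D(2) cont)
      show "compact (K \<inter> {x. infdist x S \<le> 5 * d / 6})"
        by (intro compact_Int_closed K(1) closed_Collect_le inf continuous_intros)
      show "K \<inter> {x. infdist x S \<le> 5 * d / 6} \<subseteq> A1"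
      proof safe
        fix x assume x: "x \<in> K" "infdist x S \<le> 5 * d / 6"
        show "x \<in> A1"
        proof (rule ccontr)
          assume "x \<notin> A1"
          then have "d \<le> infdist x S"
            using x d(2)[of _ x] S(2) by (simp add: infdist_notempty dist_commute cINF_greatest)
          with x(2) d(1) show False by simp
        qed
      qed
      show "\<eta> x * \<psi> x = 0" if "x \<notin> K \<inter> {x. infdist x S \<le> 5 * d / 6}" for x
        using that K(3)[of x] \<eta>(5)[of x] by auto
    qed (rule bnd)
    moreover have "(\<lambda>x. \<psi> x - \<eta> x * \<psi> x) \<in> test_functions A2"
    proof (rule test_functionsI[OF d2])
      show "continuous_on UNIV ?E2" by (intro continuous_intros \<eta>(2) D(2) cont)
      show "compact (K \<inter> {x. d / 6 \<le> infdist x S})"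
        by (intro compact_Int_closed K(1) closed_Collect_le inf continuous_intros)
      show "K \<inter> {x. d / 6 \<le> infdist x S} \<subseteq> A2"
      proof safe
        fix x assume x: "x \<in> K" "d / 6 \<le> infdist x S"
        show "x \<in> A2"
        proof (rule ccontr)
          assume "x \<notin> A2"
          then have "infdist x S = 0" using x by (intro infdist_zero) (simp add: S_def)
          with x(2) d(1) show False by simp
        qed
      qed
      show "\<psi> x - \<eta> x * \<psi> x = 0" if "x \<notin> K \<inter> {x. d / 6 \<le> infdist x S}" for x
        using that K(3)[of x] \<eta>(4)[of x] by auto
    qed (rule bnd)
    moreover have "deriv \<psi> x = deriv (\<lambda>x. \<eta> x * \<psi> x) x + deriv (\<lambda>x. \<psi> x - \<eta> x * \<psi> x) x" for x
      using DERIV_imp_deriv[OF d1, of x] DERIV_imp_deriv[OF d2, of x] by (simp add: D(3))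
    ultimately show ?thesis by (rule that)
  qed
qed

text \<open>
  The composition of a Lipschitz function with a kernel is only controlled where the kernel is, and
  variations are formed on the open subsets of \<open>\<Omega>\<close>.
\<close>

locale bounded_measurable_on =
  fixes \<Omega> :: "real set" and v :: "real \<Rightarrow> real" and C :: real
  assumes open_domain: "open \<Omega>"
    and measurable: "set_borel_measurable borel \<Omega> v"
    and bounded: "\<And>x. x \<in> \<Omega> \<Longrightarrow> \<bar>v x\<bar> \<le> C"
begin

text \<open>
  The second part removes the domain of integration, so that integrals over different open sets
  can be compared.
\<close>

lemma integrable_deriv_test_function:
  assumes "A \<subseteq> \<Omega>" "open A" "\<psi> \<in> test_functions A"
  shows "integrable lborel (\<lambda>x. indicator \<Omega> x * v x * deriv \<psi> x)"
    and "(LBINT x:A. v x * deriv \<psi> x) = (LBINT x. indicator \<Omega> x * v x * deriv \<psi> x)"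
proof -
  obtain D K where D: "continuous_on UNIV D" "deriv \<psi> = D"
    and K: "compact K" "K \<subseteq> A" "\<And>x. x \<notin> K \<Longrightarrow> D x = 0"
    using test_functionsE[OF assms(3)] by metis
  have "integrable lborel (\<lambda>x. (indicator K x *\<^sub>R D x) * C)"
    using borel_integrable_compact[OF K(1), of D] D(1)
    by (intro integrable_mult_left) (auto intro: continuous_on_subset)
  then show "integrable lborel (\<lambda>x. indicator \<Omega> x * v x * deriv \<psi> x)"
  proof (rule Bochner_Integration.integrable_bound)
    have [measurable]: "(\<lambda>x. indicator \<Omega> x * v x) \<in> borel_measurable borel" "D \<in> borel_measurable borel"
      using measurable D(1) by (auto simp: set_borel_measurable_def borel_measurable_continuous_onI)
    show "(\<lambda>x. indicator \<Omega> x * v x * deriv \<psi> x) \<in> borel_measurable lborel" unfolding D(2) by simp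
    have "\<bar>indicator \<Omega> x * v x * D x\<bar> \<le> \<bar>indicator K x * D x * C\<bar>" for x
    proof (cases "x \<in> K")
      case True
      then have "x \<in> \<Omega>" using K assms by auto
      have "\<bar>v x\<bar> * \<bar>D x\<bar> \<le> \<bar>C\<bar> * \<bar>D x\<bar>"
        using bounded[OF \<open>x \<in> \<Omega>\<close>] by (intro mult_right_mono) auto
      then show ?thesis using True \<open>x \<in> \<Omega>\<close> by (simp add: abs_mult mult.commute)
    qed (simp add: K)
    then show "AE x in lborel. norm (indicator \<Omega> x * v x * deriv \<psi> x) \<le> norm ((indicator K x *\<^sub>R D x) * C)"
      by (simp add: D(2))
  qed
  show "(LBINT x:A. v x * deriv \<psi> x) = (LBINT x. indicator \<Omega> x * v x * deriv \<psi> x)"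
    unfolding set_lebesgue_integral_def
    using K assms by (intro Bochner_Integration.integral_cong) (auto simp: indicator_def D(2))
qed

lemma variation_open_mono:
  assumes "A \<subseteq> B" "B \<subseteq> \<Omega>" "open A" "open B"
  shows "variation_open v A \<le> variation_open v B"
  unfolding variation_open_def
proof (rule SUP_mono)
  fix \<psi> assume \<psi>: "\<psi> \<in> test_functions A"
  then have "\<psi> \<in> test_functions B" using test_functions_mono assms(1) by blast
  moreover have "(LBINT x:A. v x * deriv \<psi> x) = (LBINT x:B. v x * deriv \<psi> x)"
    using integrable_deriv_test_function(2)[of A \<psi>] integrable_deriv_test_function(2)[of B \<psi>] \<psi> calculation assms by auto
  ultimately show "\<exists>\<psi>'\<in>test_functions B. ennreal (LBINT x:A. v x * deriv \<psi> x) \<le> ennreal (LBINT x:B. v x * deriv \<psi>' x)"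
    by auto
qed

lemma variation_open_subadditive:
  assumes A: "A1 \<subseteq> \<Omega>" "A2 \<subseteq> \<Omega>" "open A1" "open A2"
  shows "variation_open v (A1 \<union> A2) \<le> variation_open v A1 + variation_open v A2"
  unfolding variation_open_def
proof (rule SUP_least)
  fix \<psi> assume \<psi>: "\<psi> \<in> test_functions (A1 \<union> A2)"
  obtain \<psi>1 \<psi>2 where 1: "\<psi>1 \<in> test_functions A1" and 2: "\<psi>2 \<in> test_functions A2"
    and d: "\<And>x. deriv \<psi> x = deriv \<psi>1 x + deriv \<psi>2 x"
    using test_function_partition[OF A(3,4) \<psi>] by blast
  have "(LBINT x:A1 \<union> A2. v x * deriv \<psi> x) = (LBINT x. indicator \<Omega> x * v x * deriv \<psi> x)"
    using A \<psi> by (intro integrable_deriv_test_function(2)) auto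
  also have "\<dots> = (LBINT x:A1. v x * deriv \<psi>1 x) + (LBINT x:A2. v x * deriv \<psi>2 x)"
    using integrable_deriv_test_function[OF A(1,3) 1] integrable_deriv_test_function[OF A(2,4) 2]
    by (simp add: d distrib_left)
  finally have "ennreal (LBINT x:A1 \<union> A2. v x * deriv \<psi> x)
      = ennreal ((LBINT x:A1. v x * deriv \<psi>1 x) + (LBINT x:A2. v x * deriv \<psi>2 x))" by simp
  also have "\<dots> \<le> ennreal (max 0 (LBINT x:A1. v x * deriv \<psi>1 x) + max 0 (LBINT x:A2. v x * deriv \<psi>2 x))"
    by (intro ennreal_leI) simp
  also have "\<dots> = ennreal (LBINT x:A1. v x * deriv \<psi>1 x) + ennreal (LBINT x:A2. v x * deriv \<psi>2 x)"
    by (simp add: ennreal_plus max_def ennreal_neg)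
  also have "\<dots> \<le> (SUP \<psi>\<in>test_functions A1. ennreal (LBINT x:A1. v x * deriv \<psi> x))
      + (SUP \<psi>\<in>test_functions A2. ennreal (LBINT x:A2. v x * deriv \<psi> x))"
    by (intro add_mono SUP_upper 1 2)
  finally show "ennreal (LBINT x:A1 \<union> A2. v x * deriv \<psi> x) \<le> \<dots>" .
qed

text \<open>
  Enlarging an open set only adds test functions, so the infimum over open supersets does not fall
  below the value of the set itself.
\<close>

lemma variation_open_le_variation_measure:
  assumes "open A" "A \<subseteq> \<Omega>" shows "variation_open v A \<le> variation_measure \<Omega> v A"
  unfolding variation_measure_def using assms by (auto intro!: INF_greatest variation_open_mono)

lemma variation_measure_subadditive:
  "variation_measure \<Omega> v (B1 \<union> B2) \<le> variation_measure \<Omega> v B1 + variation_measure \<Omega> v B2"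
proof -
  let ?O = "\<lambda>B. {A. open A \<and> B \<subseteq> A \<and> A \<subseteq> \<Omega>}"
  have "variation_measure \<Omega> v (B1 \<union> B2) \<le> variation_open v A1 + variation_open v A2"
    if "A1 \<in> ?O B1" "A2 \<in> ?O B2" for A1 A2
  proof -
    have "variation_measure \<Omega> v (B1 \<union> B2) \<le> variation_open v (A1 \<union> A2)"
      unfolding variation_measure_def using that by (intro INF_lower) auto
    also have "\<dots> \<le> variation_open v A1 + variation_open v A2"
      using that by (intro variation_open_subadditive) auto
    finally show ?thesis .
  qed
  then show ?thesis
    unfolding variation_measure_def[of \<Omega> v B1] variation_measure_def[of \<Omega> v B2]
    by (intro le_INF_add_INF) simp
qed

end

section \<open>Differences of cell means and variation\<close>

context
  fixes F q :: "real \<Rightarrow> real" and \<alpha> \<beta> :: real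
  assumes le: "\<alpha> \<le> \<beta>" and F: "\<And>x. (F has_real_derivative q x) (at x)"
    and q: "\<And>x. 0 \<le> q x \<and> q x \<le> 1" "\<And>x. x \<notin> {\<alpha><..<\<beta>} \<Longrightarrow> q x = 0"
begin

lemma bump_primitive_mean:
  assumes "x \<le> y" shows "\<exists>z. (x < y \<longrightarrow> x < z \<and> z < y) \<and> F y - F x = (y - x) * q z"
  using assms MVT2[of x y F q] F by (cases "x = y") auto

lemma bump_primitive_below: "x \<le> \<alpha> \<Longrightarrow> F x = F \<alpha>"
  using bump_primitive_mean[of x \<alpha>] q(2) by (cases "x = \<alpha>") auto

lemma bump_primitive_above: "\<beta> \<le> x \<Longrightarrow> F x = F \<beta>"
  using bump_primitive_mean[of \<beta> x] q(2) by (cases "x = \<beta>") auto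

lemma bump_primitive_mono: "x \<le> y \<Longrightarrow> 0 \<le> F y - F x"
  using bump_primitive_mean[of x y] q(1) by (metis diff_ge_0_iff_ge mult_nonneg_nonneg)

lemma bump_primitive_increment:
  assumes "x \<le> y" shows "F y - F x \<le> \<beta> - \<alpha>"
proof -
  obtain z where z: "F \<beta> - F \<alpha> = (\<beta> - \<alpha>) * q z" using bump_primitive_mean[OF le] by blast
  have "(\<beta> - \<alpha>) * q z \<le> (\<beta> - \<alpha>) * 1" using q(1) le by (intro mult_left_mono) auto
  moreover have "F y \<le> F \<beta>"
    using bump_primitive_mono[of y \<beta>] bump_primitive_above[of y] by (cases "y \<le> \<beta>") auto
  moreover have "F \<alpha> \<le> F x"
  proof (cases "x \<le> \<alpha>")
    case True
    from bump_primitive_below[OF this] show ?thesis by linarith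
  next
    case False
    then have "\<alpha> \<le> x" by simp
    from bump_primitive_mono[OF this] show ?thesis by linarith
  qed
  ultimately show ?thesis using z by simp
qed

end

text \<open>
  Formally this is the test function with derivative \<open>1/e\<close> on \<open>(a, a + e)\<close> and \<open>-1/e\<close> on the translate by
  \<open>s\<close>, a trapezoid with values in \<open>[0, 1]\<close>. To stay continuously differentiable and compactly supported,
  the indicator of \<open>(a, a + e)\<close> is replaced by continuous functions that increase to it.
\<close>

lemma (in bounded_measurable_on) interval_mean_difference_le:
  assumes e: "0 < e" and s: "0 \<le> s" and sub: "{a<..<a + s + e} \<subseteq> \<Omega>"
    and V: "variation_open v {a<..<a + s + e} \<le> ennreal M" and M: "0 \<le> M"
  shows "(LBINT x:{a<..<a + e}. v x) - (LBINT x:{a + s<..<a + s + e}. v x) \<le> e * M"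
proof -
  \<comment> \<open>\<open>q k\<close> vanishes within \<open>\<delta> k\<close> of the ends of \<open>(a, a + e)\<close>, which keeps the support of the test function compact in the open interval\<close>
  define \<delta> where "\<delta> k = e / (2 * (real k + 1))" for k
  define q where "q k t = max 0 (min 1 (min (t - a) (a + e - t) / \<delta> k - 1))" for k t
  have \<delta>: "0 < \<delta> k" "\<delta> k \<le> e / 2" for k using e by (auto simp: \<delta>_def field_simps)
  have cq: "continuous_on UNIV (q k)" for k
    unfolding q_def using \<delta>(1)[of k] by (intro continuous_intros) auto
  have q01: "0 \<le> q k t \<and> q k t \<le> 1" for k t by (auto simp: q_def)
  have qout: "q k t = 0" if "t \<notin> {a + \<delta> k<..<a + e - \<delta> k}" for k t
  proof -
    have "min (t - a) (a + e - t) \<le> \<delta> k" using that by (auto simp: min_def)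
    then have "min (t - a) (a + e - t) / \<delta> k \<le> 1" using \<delta>(1)[of k] by simp
    then show ?thesis by (simp add: q_def)
  qed
  have lim: "(\<lambda>k. q k t) \<longlonglongrightarrow> indicator {a<..<a + e} t" for t
  proof (cases "t \<in> {a<..<a + e}")
    case True
    let ?c = "min (t - a) (a + e - t)"
    have c: "0 < ?c" using True by auto
    have "(\<lambda>k. e / (real k + 1)) \<longlonglongrightarrow> 0"
      using tendsto_mult_right_zero[OF LIMSEQ_inverse_real_of_nat, of e] by (simp add: divide_inverse add.commute)
    then have "\<forall>\<^sub>F k in sequentially. e / (real k + 1) < ?c" using c by (rule order_tendstoD)
    then have "\<forall>\<^sub>F k in sequentially. q k t = 1"
    proof eventually_elim
      case (elim k)
      have "2 * \<delta> k = e / (real k + 1)" by (simp add: \<delta>_def field_simps)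
      with elim have "2 * \<delta> k < ?c" by (simp only:)
      then have "2 < ?c / \<delta> k" using \<delta>(1)[of k] by (simp add: field_simps del: min_less_iff_conj)
      then show ?case by (simp add: q_def)
    qed
    then show ?thesis using True by (simp add: tendsto_eventually)
  next
    case False
    then have "q k t = 0" for k using qout[of t k] \<delta>(1)[of k] by auto
    then show ?thesis using False by simp
  qed
  let ?w = "\<lambda>x. indicator \<Omega> x * v x"
  have [measurable]: "?w \<in> borel_measurable borel"
    using measurable by (auto simp: set_borel_measurable_def)
  have [measurable]: "q k \<in> borel_measurable borel" for k using cq by (rule borel_measurable_continuous_onI)
  have step: "(LBINT x. ?w x * (q k x - q k (x - s))) \<le> e * M" for k
  proof -
    obtain F where F: "\<And>x. (F has_real_derivative q k x) (at x)"
      using continuous_has_antiderivative[OF cq] by blast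
    have \<delta>e: "a + \<delta> k \<le> a + e - \<delta> k" using \<delta>(2)[of k] by simp
    note Fprops = bump_primitive_below[OF \<delta>e F q01 qout] bump_primitive_above[OF \<delta>e F q01 qout]
      bump_primitive_mono[OF \<delta>e F q01 qout] bump_primitive_increment[OF \<delta>e F q01 qout]
    \<comment> \<open>a difference of a primitive with its own translate: it vanishes on both sides, and lies in \<open>[0, 1]\<close> because the primitive increases by at most \<open>e\<close>\<close>
    define \<psi> where "\<psi> x = (F x - F (x - s)) / e" for x
    define D where "D x = (q k x - q k (x - s)) / e" for x
    have dpsi: "(\<psi> has_real_derivative D x) (at x)" for x
    proof -
      have "((\<lambda>x. F (x - s)) has_real_derivative q k (x - s)) (at x)"
        using F[of "x - s"] DERIV_shift[of F _ x "- s"] by simp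
      then show ?thesis unfolding \<psi>_def D_def by (intro DERIV_cdivide DERIV_diff F)
    qed
    have "\<psi> \<in> test_functions {a<..<a + s + e}"
    proof (rule test_functionsI[OF dpsi])
      show "continuous_on UNIV D"
        unfolding D_def using e by (intro continuous_intros cq continuous_on_compose2[OF cq]) auto
      show "compact {a + \<delta> k..a + s + e - \<delta> k}" by simp
      show "{a + \<delta> k..a + s + e - \<delta> k} \<subseteq> {a<..<a + s + e}" using \<delta>(1)[of k] by auto
      show "\<psi> x = 0" if "x \<notin> {a + \<delta> k..a + s + e - \<delta> k}" for x
      proof (cases "x \<le> a + \<delta> k")
        case True
        then show ?thesis using Fprops(1)[of x] Fprops(1)[of "x - s"] s by (simp add: \<psi>_def)
      next
        case False
        then have "a + e - \<delta> k \<le> x - s" using that by auto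
        then show ?thesis using Fprops(2)[of x] Fprops(2)[of "x - s"] s by (simp add: \<psi>_def)
      qed
      show "\<bar>\<psi> x\<bar> \<le> 1" for x
        using Fprops(3)[of "x - s" x] Fprops(4)[of "x - s" x] s e \<delta>(1)[of k] by (simp add: \<psi>_def)
    qed
    note \<psi> = this
    have "(LBINT x:{a<..<a + s + e}. v x * deriv \<psi> x) = (LBINT x. ?w x * D x)"
      using integrable_deriv_test_function(2)[OF sub _ \<psi>] DERIV_imp_deriv[OF dpsi] by simp
    then have "ennreal (LBINT x. ?w x * D x) = ennreal (LBINT x:{a<..<a + s + e}. v x * deriv \<psi> x)" by simp
    also have "\<dots> \<le> variation_open v {a<..<a + s + e}"
      unfolding variation_open_def by (rule SUP_upper[OF \<psi>])
    also have "\<dots> \<le> ennreal M" by fact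
    finally have "(LBINT x. ?w x * D x) \<le> M" using M by simp
    moreover have "(LBINT x. ?w x * D x) = (LBINT x. ?w x * (q k x - q k (x - s))) / e"
      by (simp add: D_def)
    ultimately show ?thesis using e by (simp add: pos_divide_le_eq mult.commute[of e])
  qed
  have "(\<lambda>k. LBINT x. ?w x * (q k x - q k (x - s)))
      \<longlonglongrightarrow> (LBINT x. ?w x * (indicator {a<..<a + e} x - indicator {a<..<a + e} (x - s)))"
  proof (rule integral_dominated_convergence[where w="\<lambda>x. indicator {a..a + s + e} x * (2 * \<bar>C\<bar>)"])
    show "AE x in lborel. (\<lambda>k. ?w x * (q k x - q k (x - s))) \<longlonglongrightarrow> ?w x * (indicator {a<..<a + e} x - indicator {a<..<a + e} (x - s))"
      by (intro AE_I2 tendsto_intros lim)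
    show "AE x in lborel. norm (?w x * (q k x - q k (x - s))) \<le> indicator {a..a + s + e} x * (2 * \<bar>C\<bar>)" for k
    proof (intro AE_I2)
      fix x
      have w: "\<bar>?w x\<bar> \<le> \<bar>C\<bar>" using bounded[of x] by (auto simp: indicator_def)
      show "norm (?w x * (q k x - q k (x - s))) \<le> indicator {a..a + s + e} x * (2 * \<bar>C\<bar>)"
      proof (cases "x \<in> {a..a + s + e}")
        case True
        have "\<bar>q k x - q k (x - s)\<bar> \<le> 2" using q01[of k x] q01[of k "x - s"] by linarith
        then have "\<bar>?w x\<bar> * \<bar>q k x - q k (x - s)\<bar> \<le> \<bar>C\<bar> * 2" using w by (intro mult_mono) auto
        then show ?thesis using True by (simp add: abs_mult mult.commute)
      next
        case False
        then have "q k x = 0" "q k (x - s) = 0" using s \<delta>(1)[of k] by (auto intro!: qout)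
        then show ?thesis using False by simp
      qed
    qed
    show "integrable lborel (\<lambda>x. indicator {a..a + s + e} x * (2 * \<bar>C\<bar>))"
      using e s by (intro integrable_mult_left integrable_real_indicator) simp_all
  qed measurable
  then have "(LBINT x. ?w x * (indicator {a<..<a + e} x - indicator {a<..<a + e} (x - s))) \<le> e * M"
    by (rule LIMSEQ_le_const2) (use step in auto)
  moreover have "(LBINT x. ?w x * (indicator {a<..<a + e} x - indicator {a<..<a + e} (x - s)))
      = (LBINT x. ?w x * indicator {a<..<a + e} x) - (LBINT x. ?w x * indicator {a + s<..<a + s + e} x)"
  proof -
    have i: "integrable lborel (\<lambda>x. ?w x * indicator {c<..<d} x)" for c d
    proof (rule integrableI_bounded_set[where A="{c<..<d}" and B="\<bar>C\<bar>"])
      show "AE x in lborel. x \<in> {c<..<d} \<longrightarrow> norm (?w x * indicator {c<..<d} x) \<le> \<bar>C\<bar>"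
        using bounded by (intro AE_I2) (force simp: indicator_def)
    qed (use emeasure_bounded_finite[of "{c<..<d}"] in auto)
    have "indicator {a<..<a + e} (x - s) = (indicator {a + s<..<a + s + e} x :: real)" for x
      by (auto simp: indicator_def)
    then show ?thesis using i by (simp add: right_diff_distrib)
  qed
  moreover have "(LBINT x. ?w x * indicator {c<..<d} x) = (LBINT x:{c<..<d}. v x)" if "{c<..<d} \<subseteq> \<Omega>" for c d
    unfolding set_lebesgue_integral_def using that
    by (intro Bochner_Integration.integral_cong) (auto simp: indicator_def)
  moreover have "{a<..<a + e} \<subseteq> \<Omega>" "{a + s<..<a + s + e} \<subseteq> \<Omega>" using sub s e by auto
  ultimately show ?thesis by simp
qed


lemma (in bounded_measurable_on) integrable_on_interval:
  assumes "{a<..<b} \<subseteq> \<Omega>" shows "set_integrable lborel {a<..<b} v"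
  unfolding set_integrable_def
proof (rule integrableI_bounded_set[where A="{a<..<b}" and B="\<bar>C\<bar>"])
  have "(\<lambda>x. indicator {a<..<b} x *\<^sub>R (indicator \<Omega> x *\<^sub>R v x)) \<in> borel_measurable lborel"
    using borel_measurable_scaleR[OF borel_measurable_indicator[of "{a<..<b}" borel] measurable[unfolded set_borel_measurable_def]]
    by simp
  then show "(\<lambda>x. indicator {a<..<b} x *\<^sub>R v x) \<in> borel_measurable lborel"
    by (rule measurable_cong[THEN iffD1, rotated]) (use assms in \<open>auto simp: indicator_def\<close>)
  show "AE x in lborel. x \<in> {a<..<b} \<longrightarrow> norm (indicator {a<..<b} x *\<^sub>R v x) \<le> \<bar>C\<bar>"
    using bounded assms by (intro AE_I2) (force simp: indicator_def)
qed (use emeasure_bounded_finite[of "{a<..<b}"] in auto)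

lemma (in bounded_measurable_on) integral_subdivide:
  assumes "0 \<le> \<delta>" "{a<..<a + real N * \<delta>} \<subseteq> \<Omega>"
  shows "(LBINT x:{a<..<a + real N * \<delta>}. v x) = (\<Sum>j<N. LBINT x:{a + real j * \<delta><..<a + real (Suc j) * \<delta>}. v x)"
  using assms(2)
proof (induction N)
  case (Suc N)
  let ?b = "a + real N * \<delta>" and ?c = "a + real (Suc N) * \<delta>"
  have le: "a \<le> ?b" "?b \<le> ?c" using assms(1) by (auto simp: algebra_simps)
  have sub: "{a<..<?b} \<subseteq> \<Omega>" "{?b<..<?c} \<subseteq> \<Omega>"
    using le Suc.prems by (auto intro!: subsetD[OF Suc.prems] simp del: of_nat_Suc)
  have "(LBINT x:{a<..<?c}. v x) = (LBINT x:{a<..<?b} \<union> {?b<..<?c}. v x)"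
    unfolding set_lebesgue_integral_def
  proof (rule Bochner_Integration.integral_cong_AE)
    show "(\<lambda>x. indicator {a<..<?c} x *\<^sub>R v x) \<in> borel_measurable lborel"
      using integrable_on_interval[OF Suc.prems] by (simp add: set_integrable_def)
    have "set_integrable lborel ({a<..<?b} \<union> {?b<..<?c}) v"
      using sub by (intro set_integrable_Un integrable_on_interval) auto
    then show "(\<lambda>x. indicator ({a<..<?b} \<union> {?b<..<?c}) x *\<^sub>R v x) \<in> borel_measurable lborel"
      by (simp add: set_integrable_def)
    show "AE x in lborel. indicator {a<..<?c} x *\<^sub>R v x = indicator ({a<..<?b} \<union> {?b<..<?c}) x *\<^sub>R v x"
      using AE_lborel_singleton[of ?b] by eventually_elim (use le in \<open>auto simp: indicator_def\<close>)
  qed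
  also have "\<dots> = (LBINT x:{a<..<?b}. v x) + (LBINT x:{?b<..<?c}. v x)"
    using sub by (intro set_integral_Un integrable_on_interval) auto
  finally show ?case using Suc.IH[OF sub(1)] by simp
qed (simp add: set_lebesgue_integral_def)

lemma sum_nat_blocks: "(\<Sum>i<p. \<Sum>j<N. g (i * N + j)) = (\<Sum>l<p * N. g l)" for g :: "nat \<Rightarrow> real"
proof (induction p)
  case (Suc p)
  have "(\<Sum>l<p * N + M. g l) = (\<Sum>l<p * N. g l) + (\<Sum>j<M. g (p * N + j))" for M
    by (induction M) auto
  from this[of N] Suc show ?case by (simp add: add.commute)
qed simp

text \<open>
  The index \<open>l\<close> of an interval containing a given point is confined to a window of length \<open>K\<close>, so no point
  is covered more than \<open>K\<close> times.
\<close>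

lemma overlapping_intervals_sum_le:
  fixes m :: "real measure"
  assumes "0 < \<delta>" and fin: "finite_measure m"
    and A: "\<And>l. l < L \<Longrightarrow> {real l * \<delta><..<real (l + K) * \<delta>} \<in> sets m"
  shows "(\<Sum>l<L. measure m {real l * \<delta><..<real (l + K) * \<delta>}) \<le> real K * measure m (space m)"
proof -
  interpret finite_measure m by fact
  let ?A = "\<lambda>l. {real l * \<delta><..<real (l + K) * \<delta>}"
  have count: "(\<Sum>l<L. indicator (?A l) t) \<le> real K" for t
  proof -
    let ?S = "{l. l < L \<and> t \<in> ?A l}"
    have "(\<Sum>l<L. indicator (?A l) t) = real (card ?S)"
      by (simp add: indicator_def sum.If_cases Int_def lessThan_def)
    also have "card ?S \<le> K"
    proof (cases "?S = {}")
      case False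
      define l0 where "l0 = Min ?S"
      have "finite ?S" by simp
      then have l0: "l0 \<in> ?S" "\<And>l. l \<in> ?S \<Longrightarrow> l0 \<le> l"
        using Min_in[of ?S] Min_le[of ?S] False unfolding l0_def by blast+
      have "?S \<subseteq> {l0..<l0 + K}"
      proof
        fix l assume l: "l \<in> ?S"
        then have "real l * \<delta> < t" "t < real (l0 + K) * \<delta>" using l0(1) by auto
        then have "real l * \<delta> < real (l0 + K) * \<delta>" by (rule less_trans)
        then have "l < l0 + K" using \<open>0 < \<delta>\<close> by (simp only: mult_less_cancel_right_pos of_nat_less_iff)
        then show "l \<in> {l0..<l0 + K}" using l0(2)[OF l] by simp
      qed
      from card_mono[OF _ this] show ?thesis by simp
    next
      case True
      then show ?thesis unfolding True by simp
    qed
    finally show ?thesis by simp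
  qed
  have "(\<Sum>l<L. measure m (?A l)) = (\<Sum>l<L. LINT t|m. indicator (?A l) t)"
    using A by (intro sum.cong) (auto simp: emeasure_eq_measure)
  also have "\<dots> = (LINT t|m. (\<Sum>l<L. indicator (?A l) t))"
    using A by (intro Bochner_Integration.integral_sum[symmetric] integrable_real_indicator) (auto simp: emeasure_eq_measure)
  also have "\<dots> \<le> (LINT t|m. real K)"
    using A count by (intro integral_mono Bochner_Integration.integrable_sum integrable_real_indicator) (auto simp: emeasure_eq_measure)
  also have "\<dots> = real K * measure m (space m)" by simp
  finally show ?thesis .
qed

text \<open>
  Comparing whole cells would lose a factor: the intervals spanned by the cells \<open>i\<close> and \<open>i + 2\<close> overlap three
  times. Pieces of length \<open>\<delta> = 1 / (n N)\<close> at distance \<open>2 N \<delta>\<close> span intervals of \<open>2 N + 1\<close> pieces, and the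
  overlap times \<open>n \<delta>\<close> is \<open>2 + 1 / N\<close>.
\<close>

lemma skip_cell_differences_le:
  fixes v :: "nat \<Rightarrow> real \<Rightarrow> real" and m :: "real measure"
  assumes n: "2 \<le> n" and bm: "\<And>i. bounded_measurable_on {0<..<1} (v i) (C i)"
    and m: "finite_measure m" "sets m = sets (restrict_space borel {0<..<1})"
    and V: "\<And>i A. open A \<Longrightarrow> A \<subseteq> {0<..<1} \<Longrightarrow> variation_open (v i) A \<le> emeasure m A"
  shows "(\<Sum>i<n - 2. real n * ((LBINT x:{real i / real n<..<(real i + 1) / real n}. v i x)
      - (LBINT x:{real (i + 2) / real n<..<(real (i + 2) + 1) / real n}. v i x))) \<le> 2 * measure m {0<..<1}" (is "?S \<le> 2 * ?M")
proof -
  interpret finite_measure m by fact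
  have sp: "space m = {0<..<1}" using sets_eq_imp_space_eq[OF m(2)] by (simp add: space_restrict_space)
  have bound: "?S \<le> (2 + 1 / real N) * ?M" if N: "0 < N" for N
  proof -
    define \<delta> where "\<delta> = 1 / (real n * real N)"
    have \<delta>: "0 < \<delta>" using n N by (simp add: \<delta>_def)
    have nN: "real n * real N * \<delta> = 1" using n N by (simp add: \<delta>_def)
    let ?A = "\<lambda>l. {real l * \<delta><..<real (l + (2 * N + 1)) * \<delta>}"
    have inside: "{real l * \<delta><..<real l' * \<delta>} \<subseteq> {0<..<1}" if "l' \<le> n * N" for l l'
    proof -
      have "real l' * \<delta> \<le> real (n * N) * \<delta>" using that \<delta> by (intro mult_right_mono) (auto simp del: of_nat_mult)
      also have "\<dots> = 1" using nN by simp
      finally have "real l' * \<delta> \<le> 1" .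
      moreover have "0 \<le> real l * \<delta>" using \<delta> by simp
      ultimately show ?thesis by auto
    qed
    have pt: "real k / real n = real (k * N) * \<delta>" for k
      using n N by (simp add: \<delta>_def)
    have cell: "(LBINT x:{real i / real n<..<(real i + 1) / real n}. v i' x)
        = (\<Sum>j<N. LBINT x:{real (i * N + j) * \<delta><..<real (i * N + j) * \<delta> + \<delta>}. v i' x)" if "i < n" for i i'
    proof -
      interpret bounded_measurable_on "{0<..<1}" "v i'" "C i'" by (rule bm)
      have "Suc i * N \<le> n * N" using that by (intro mult_le_mono1) simp
      from inside[OF this, of "i * N"] 
      have "{real (i * N) * \<delta><..<real (i * N) * \<delta> + real N * \<delta>} \<subseteq> {0<..<1}" by (simp add: algebra_simps)
      from integral_subdivide[OF _ this] \<delta> show ?thesis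
        using pt[of i] pt[of "Suc i"] by (simp add: algebra_simps)
    qed
    have small: "(LBINT x:{real l * \<delta><..<real l * \<delta> + \<delta>}. v i x) - (LBINT x:{real (l + 2 * N) * \<delta><..<real (l + 2 * N) * \<delta> + \<delta>}. v i x)
        \<le> \<delta> * measure m (?A l)" if l: "l < (n - 2) * N" for l i
    proof -
      interpret bounded_measurable_on "{0<..<1}" "v i" "C i" by (rule bm)
      obtain p where p: "n = p + 2" using n by (metis le_add_diff_inverse2)
      have "l + (2 * N + 1) \<le> n * N" using l by (simp add: p algebra_simps)
      from inside[OF this, of l] have sub: "?A l \<subseteq> {0<..<1}" .
      have e: "?A l = {real l * \<delta><..<real l * \<delta> + 2 * real N * \<delta> + \<delta>}" by (simp add: algebra_simps)
      have "variation_open (v i) (?A l) \<le> ennreal (measure m (?A l))"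
        using V[OF _ sub] by (simp add: emeasure_eq_measure)
      then show ?thesis
        using interval_mean_difference_le[of \<delta> "2 * real N * \<delta>" "real l * \<delta>" "measure m (?A l)"] \<delta> sub
        unfolding e by (simp add: algebra_simps)
    qed
    have "?S \<le> (\<Sum>i<n - 2. real n * (\<Sum>j<N. \<delta> * measure m (?A (i * N + j))))"
    proof (intro sum_mono mult_left_mono)
      fix i assume i: "i \<in> {..<n - 2}"
      have "(LBINT x:{real i / real n<..<(real i + 1) / real n}. v i x) - (LBINT x:{real (i + 2) / real n<..<(real (i + 2) + 1) / real n}. v i x)
          = (\<Sum>j<N. (LBINT x:{real (i * N + j) * \<delta><..<real (i * N + j) * \<delta> + \<delta>}. v i x)
            - (LBINT x:{real (i * N + j + 2 * N) * \<delta><..<real (i * N + j + 2 * N) * \<delta> + \<delta>}. v i x))"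
        using i cell[of i i] cell[of "i + 2" i] by (simp add: sum_subtractf algebra_simps)
      also have "\<dots> \<le> (\<Sum>j<N. \<delta> * measure m (?A (i * N + j)))"
      proof (rule sum_mono, rule small)
        fix j assume "j \<in> {..<N}"
        then have "i * N + j < Suc i * N" by simp
        also have "\<dots> \<le> (n - 2) * N" using i by (intro mult_le_mono1) simp
        finally show "i * N + j < (n - 2) * N" .
      qed
      finally show "(LBINT x:{real i / real n<..<(real i + 1) / real n}. v i x) - (LBINT x:{real (i + 2) / real n<..<(real (i + 2) + 1) / real n}. v i x) \<le> \<dots>" .
    qed simp
    also have "\<dots> = real n * \<delta> * (\<Sum>l<(n - 2) * N. measure m (?A l))"
      unfolding sum_nat_blocks[symmetric] by (simp add: sum_distrib_left algebra_simps)
    also have "\<dots> \<le> real n * \<delta> * (real (2 * N + 1) * measure m (space m))"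
    proof (intro mult_left_mono overlapping_intervals_sum_le \<delta> m(1))
      fix l assume "l < (n - 2) * N"
      obtain p where p: "n = p + 2" using n by (metis le_add_diff_inverse2)
      have "l + (2 * N + 1) \<le> n * N" using \<open>l < (n - 2) * N\<close> by (simp add: p algebra_simps)
      from inside[OF this, of l] show "?A l \<in> sets m"
        by (auto simp: m(2) sets_restrict_space_iff)
    qed (use \<delta> in auto)
    also have "\<dots> = (2 + 1 / real N) * ?M"
      using n N by (simp add: sp \<delta>_def field_simps)
    finally show ?thesis .
  qed
  have "(\<lambda>N. (2 + 1 / real (Suc N)) * ?M) \<longlonglongrightarrow> (2 + 0) * ?M"
    using LIMSEQ_inverse_real_of_nat by (intro tendsto_intros) (simp add: inverse_eq_divide)
  then have "?S \<le> (2 + 0) * ?M"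
    by (rule LIMSEQ_le_const) (intro exI[of _ 0] allI impI bound, simp)
  then show ?thesis by simp
qed

section \<open>Lipschitz functions of a kernel and the metric total variation\<close>

lemma prob_on_real_distribution: "\<alpha> \<in> prob_on Y \<Longrightarrow> real_distribution \<alpha>"
  by (auto simp: prob_on_def real_distribution_def real_distribution_axioms_def sets_eq_imp_space_eq)

lemma prob_on_cdf_outside:
  assumes "\<alpha> \<in> prob_on Y" "Y \<subseteq> {a..b}" "closed Y"
  shows "t < a \<Longrightarrow> cdf \<alpha> t = 0" "b \<le> t \<Longrightarrow> cdf \<alpha> t = 1"
proof -
  interpret real_distribution \<alpha> by (rule prob_on_real_distribution[OF assms(1)])
  have ae: "measure \<alpha> (- Y) = 0" using assms(1) by (simp add: prob_on_def measure_def)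
  have mY: "- Y \<in> events" using assms(3) by simp
  show "cdf \<alpha> t = 0" if "t < a"
  proof -
    have "measure \<alpha> {..t} \<le> measure \<alpha> (- Y)"
      using that assms(2) mY by (intro finite_measure_mono) auto
    then show ?thesis using ae by (simp add: cdf_def measure_le_0_iff)
  qed
  show "cdf \<alpha> t = 1" if "b \<le> t"
  proof -
    have "{..t} \<union> - Y = UNIV" using that assms(2) by force
    then have "1 = measure \<alpha> ({..t} \<union> - Y)" using prob_space by (simp add: space_eq_univ)
    also have "\<dots> \<le> measure \<alpha> {..t} + measure \<alpha> (- Y)"
      using mY by (intro measure_Un_le) auto
    finally show ?thesis using ae prob_le_1[of "{..t}"] by (simp add: cdf_def)
  qed
qed

text \<open>
  The integral counts, for each point \<open>z\<close> of the mass, the levels \<open>t\<close> at distance at most \<open>\<Delta>\<close> from \<open>z\<close>.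
\<close>

lemma nn_integral_cdf_window:
  assumes "real_distribution \<alpha>" "0 \<le> \<Delta>"
  shows "(\<integral>\<^sup>+t. ennreal (cdf \<alpha> (t + \<Delta>) - cdf \<alpha> (t - \<Delta>)) \<partial>lborel) = ennreal (2 * \<Delta>)"
proof -
  interpret real_distribution \<alpha> by fact
  have "ennreal (2 * \<Delta>) = (\<integral>\<^sup>+z. ennreal \<bar>(z - \<Delta>) - (z + \<Delta>)\<bar> \<partial>\<alpha>)"
    using assms(2) emeasure_space_1 by (simp add: abs_if)
  also have "\<dots> = (\<integral>\<^sup>+t. emeasure \<alpha> {z \<in> space \<alpha>. min (z - \<Delta>) (z + \<Delta>) \<le> t \<and> t < max (z - \<Delta>) (z + \<Delta>)} \<partial>lborel)"
    by (rule layer_cake_abs_diff) (auto intro: sigma_finite_measure_axioms)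
  also have "\<dots> = (\<integral>\<^sup>+t. ennreal (cdf \<alpha> (t + \<Delta>) - cdf \<alpha> (t - \<Delta>)) \<partial>lborel)"
  proof (intro nn_integral_cong)
    fix t
    have "{z \<in> space \<alpha>. min (z - \<Delta>) (z + \<Delta>) \<le> t \<and> t < max (z - \<Delta>) (z + \<Delta>)} = {t - \<Delta><..t + \<Delta>}"
      using assms(2) by (auto simp: min_def max_def)
    moreover have "cdf \<alpha> (t + \<Delta>) - cdf \<alpha> (t - \<Delta>) = measure \<alpha> {t - \<Delta><..t + \<Delta>}"
      using assms(2) cdf_diff_eq[of "t - \<Delta>" "t + \<Delta>"] by (cases "\<Delta> = 0") auto
    ultimately show "emeasure \<alpha> {z \<in> space \<alpha>. min (z - \<Delta>) (z + \<Delta>) \<le> t \<and> t < max (z - \<Delta>) (z + \<Delta>)}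
        = ennreal (cdf \<alpha> (t + \<Delta>) - cdf \<alpha> (t - \<Delta>))"
      by (simp add: emeasure_eq_measure)
  qed
  finally show ?thesis ..
qed

text \<open>
  Between two grid points the distribution functions are trapped by their values at the ends, so their difference
  exceeds the difference on the grid by at most the mass in a window of radius \<open>\<Delta> = (b - a) / N\<close> around
  the level. These excesses integrate to \<open>2 \<Delta>\<close>.
\<close>

lemma wasserstein_le_grid:
  assumes \<alpha>: "\<alpha> \<in> prob_on Y" and \<beta>: "\<beta> \<in> prob_on Y" and Y: "Y \<subseteq> {a..b}" "closed Y" "a \<le> b" and N: "0 < N" and "0 \<le> \<eta>"
    and grid: "\<And>j. j \<le> N \<Longrightarrow> \<bar>cdf \<alpha> (a + real j * ((b - a) / real N)) - cdf \<beta> (a + real j * ((b - a) / real N))\<bar> \<le> \<eta>"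
  shows "wasserstein \<alpha> \<beta> \<le> ennreal (2 * ((b - a) / real N) + \<eta> * (b - a))"
proof -
  let ?\<Delta> = "(b - a) / real N"
  have d: "real_distribution \<alpha>" "real_distribution \<beta>" using \<alpha> \<beta> by (auto intro: prob_on_real_distribution)
  interpret A: cdf_distribution \<alpha> using d by (simp add: cdf_distribution_def)
  interpret B: cdf_distribution \<beta> using d by (simp add: cdf_distribution_def)
  have "wasserstein \<alpha> \<beta> = (\<integral>\<^sup>+t. ennreal \<bar>cdf \<alpha> t - cdf \<beta> t\<bar> \<partial>lborel)" using d by (rule wasserstein_eq_cdf)
  also have "\<dots> \<le> (\<integral>\<^sup>+t. ennreal (cdf \<alpha> (t + ?\<Delta>) - cdf \<alpha> (t - ?\<Delta>)) + ennreal \<eta> * indicator {a..b} t \<partial>lborel)"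
  proof (rule nn_integral_mono)
    fix t
    have D0: "0 \<le> ?\<Delta>" using Y by simp
    have w: "0 \<le> cdf \<alpha> (t + ?\<Delta>) - cdf \<alpha> (t - ?\<Delta>)" using A.cdf_nondecreasing[of "t - ?\<Delta>" "t + ?\<Delta>"] D0 by simp
    consider "t < a" | "b \<le> t" | "a \<le> t" "t < b" by linarith
    then show "ennreal \<bar>cdf \<alpha> t - cdf \<beta> t\<bar> \<le> ennreal (cdf \<alpha> (t + ?\<Delta>) - cdf \<alpha> (t - ?\<Delta>)) + ennreal \<eta> * indicator {a..b} t"
    proof cases
      case 1 then show ?thesis using prob_on_cdf_outside(1)[OF \<alpha> Y(1,2)] prob_on_cdf_outside(1)[OF \<beta> Y(1,2)] by simp
    next
      case 2 then show ?thesis using prob_on_cdf_outside(2)[OF \<alpha> Y(1,2)] prob_on_cdf_outside(2)[OF \<beta> Y(1,2)] by simp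
    next
      case 3
      then have D: "0 < ?\<Delta>" using N by simp
      define j where "j = nat \<lfloor>(t - a) / ?\<Delta>\<rfloor>"
      have fl: "real j = of_int \<lfloor>(t - a) / ?\<Delta>\<rfloor>" using 3 D by (simp add: j_def)
      have "real j \<le> (t - a) / ?\<Delta>" "(t - a) / ?\<Delta> < real j + 1" unfolding fl by linarith+
      then have j: "a + real j * ?\<Delta> \<le> t" "t < a + real (Suc j) * ?\<Delta>"
        unfolding pos_le_divide_eq[OF D] pos_divide_less_eq[OF D] by (auto simp: algebra_simps)
      have "real j * ?\<Delta> < real N * ?\<Delta>" using j(1) 3 N by simp
      then have jN: "Suc j \<le> N" using D by (simp only: mult_less_cancel_right_pos of_nat_less_iff Suc_le_eq)
      have "cdf \<beta> (a + real j * ?\<Delta>) \<le> cdf \<beta> t" "cdf \<beta> t \<le> cdf \<beta> (a + real (Suc j) * ?\<Delta>)"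
        using j by (auto intro: B.cdf_nondecreasing)
      moreover have "cdf \<alpha> (t - ?\<Delta>) \<le> cdf \<alpha> (a + real j * ?\<Delta>)" "cdf \<alpha> (a + real (Suc j) * ?\<Delta>) \<le> cdf \<alpha> (t + ?\<Delta>)"
         "cdf \<alpha> (t - ?\<Delta>) \<le> cdf \<alpha> t" "cdf \<alpha> t \<le> cdf \<alpha> (t + ?\<Delta>)"
      proof -
        have "real (Suc j) * ?\<Delta> = real j * ?\<Delta> + ?\<Delta>"
          by (simp only: of_nat_Suc distrib_right mult_1_left add.commute)
        then have "t - ?\<Delta> \<le> a + real j * ?\<Delta>" "a + real (Suc j) * ?\<Delta> \<le> t + ?\<Delta>" "t - ?\<Delta> \<le> t" "t \<le> t + ?\<Delta>"
          using j D by linarith+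
        then show "cdf \<alpha> (t - ?\<Delta>) \<le> cdf \<alpha> (a + real j * ?\<Delta>)" "cdf \<alpha> (a + real (Suc j) * ?\<Delta>) \<le> cdf \<alpha> (t + ?\<Delta>)"
          "cdf \<alpha> (t - ?\<Delta>) \<le> cdf \<alpha> t" "cdf \<alpha> t \<le> cdf \<alpha> (t + ?\<Delta>)"
          by (blast intro: A.cdf_nondecreasing)+
      qed
      ultimately have "\<bar>cdf \<alpha> t - cdf \<beta> t\<bar> \<le> cdf \<alpha> (t + ?\<Delta>) - cdf \<alpha> (t - ?\<Delta>) + \<eta>"
        using grid[of j] grid[OF jN] jN by linarith
      then have "ennreal \<bar>cdf \<alpha> t - cdf \<beta> t\<bar> \<le> ennreal (cdf \<alpha> (t + ?\<Delta>) - cdf \<alpha> (t - ?\<Delta>) + \<eta>)" by (rule ennreal_leI)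
      also have "\<dots> = ennreal (cdf \<alpha> (t + ?\<Delta>) - cdf \<alpha> (t - ?\<Delta>)) + ennreal \<eta> * indicator {a..b} t"
        using 3 w \<open>0 \<le> \<eta>\<close> by (simp add: ennreal_plus)
      finally show ?thesis .
    qed
  qed
  also have "\<dots> = (\<integral>\<^sup>+t. ennreal (cdf \<alpha> (t + ?\<Delta>) - cdf \<alpha> (t - ?\<Delta>)) \<partial>lborel) + (\<integral>\<^sup>+t. ennreal \<eta> * indicator {a..b} t \<partial>lborel)"
    by (intro nn_integral_add) measurable
  also have "\<dots> = ennreal (2 * ?\<Delta>) + ennreal \<eta> * ennreal (b - a)"
    using Y(3) by (simp add: nn_integral_cdf_window[OF d(1)] nn_integral_cmult_indicator)
  also have "\<dots> = ennreal (2 * ?\<Delta> + \<eta> * (b - a))"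
    using Y(3) \<open>0 \<le> \<eta>\<close> by (subst ennreal_plus) (auto simp: ennreal_mult)
  finally show ?thesis .
qed

locale compact_disintegration =
  fixes Y :: "real set" and \<kappa> :: "real \<Rightarrow> real measure" and a b :: real
  assumes Y: "Y \<subseteq> {a..b}" "closed Y" "a \<le> b"
    and kernel: "\<kappa> \<in> restrict_space borel X \<rightarrow>\<^sub>M prob_algebra borel"
    and fibre: "\<And>x. x \<in> X \<Longrightarrow> \<kappa> x \<in> prob_on Y"
begin

lemma measurable_cdf_kernel: "(\<lambda>x. cdf (\<kappa> x) t) \<in> borel_measurable (restrict_space borel X)"
  unfolding cdf_def
  by (rule measurable_compose[OF measurable_prob_algebraD[OF kernel] measurable_measure_subprob_algebra]) simp

lemma lipschitz1D:
  assumes "\<phi> \<in> lipschitz1 (prob_on Y) wasserstein" "\<alpha> \<in> prob_on Y" "\<beta> \<in> prob_on Y" "wasserstein \<alpha> \<beta> \<le> ennreal r" "0 \<le> r"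
  shows "\<bar>\<phi> \<alpha> - \<phi> \<beta>\<bar> \<le> r"
proof -
  have "ennreal \<bar>\<phi> \<alpha> - \<phi> \<beta>\<bar> \<le> wasserstein \<alpha> \<beta>" using assms(1-3) by (auto simp: lipschitz1_def)
  also note assms(4)
  finally show ?thesis using assms(5) by simp
qed

text \<open>
  The distribution function of \<open>\<kappa> x\<close> rounded to multiples of \<open>1 / N\<close> on a grid of mesh \<open>(b - a) / N\<close>: a measurable
  description of \<open>\<kappa> x\<close> with countably many values that determines it up to a distance \<open>O(1 / N)\<close>.
\<close>

definition grid_code :: "nat \<Rightarrow> real \<Rightarrow> int list" where
  "grid_code N x = map (\<lambda>j. \<lfloor>real N * cdf (\<kappa> x) (a + real j * ((b - a) / real N))\<rfloor>) [0..<Suc N]"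

lemma measurable_grid_code: "grid_code N \<in> restrict_space borel X \<rightarrow>\<^sub>M count_space UNIV"
proof -
  let ?R = "restrict_space borel X"
  have "grid_code N -` {l} \<inter> space ?R \<in> sets ?R" for l
  proof (cases "length l = Suc N")
    case True
    have m: "{x \<in> space ?R. \<lfloor>real N * cdf (\<kappa> x) (a + real j * ((b - a) / real N))\<rfloor> = l ! j} \<in> sets ?R" for j
      using measurable_cdf_kernel by measurable
    have "grid_code N x = l \<longleftrightarrow> (\<forall>j\<in>{..N}. \<lfloor>real N * cdf (\<kappa> x) (a + real j * ((b - a) / real N))\<rfloor> = l ! j)" for x
      using True by (auto simp add: grid_code_def list_eq_iff_nth_eq less_Suc_eq_le simp del: upt_Suc)
    then have "grid_code N -` {l} \<inter> space ?R
        = (\<Inter>j\<in>{..N}. {x \<in> space ?R. \<lfloor>real N * cdf (\<kappa> x) (a + real j * ((b - a) / real N))\<rfloor> = l ! j})"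
      by auto
    also have "\<dots> \<in> sets ?R" using m by (intro sets.finite_INT) auto
    finally show ?thesis .
  next
    case False
    then have "grid_code N -` {l} = {}" by (auto simp: grid_code_def)
    then show ?thesis by simp
  qed
  then show ?thesis by (subst measurable_count_space_eq2_countable) auto
qed

lemma wasserstein_le_same_grid_code:
  assumes "x \<in> X" "x' \<in> X" "grid_code N x = grid_code N x'" "0 < N"
  shows "wasserstein (\<kappa> x) (\<kappa> x') \<le> ennreal (3 * (b - a) / real N)"
proof -
  have "wasserstein (\<kappa> x) (\<kappa> x') \<le> ennreal (2 * ((b - a) / real N) + 1 / real N * (b - a))"
  proof (rule wasserstein_le_grid[OF fibre fibre Y])
    fix j assume "j \<le> N"
    let ?y = "a + real j * ((b - a) / real N)"
    have "grid_code N x ! j = grid_code N x' ! j" using assms(3) by simp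
    then have "\<lfloor>real N * cdf (\<kappa> x) ?y\<rfloor> = \<lfloor>real N * cdf (\<kappa> x') ?y\<rfloor>"
      using \<open>j \<le> N\<close> by (simp add: grid_code_def less_Suc_eq_le del: upt_Suc)
    then have "\<bar>real N * cdf (\<kappa> x) ?y - real N * cdf (\<kappa> x') ?y\<bar> \<le> 1" by linarith
    then have "real N * \<bar>cdf (\<kappa> x) ?y - cdf (\<kappa> x') ?y\<bar> \<le> 1" 
      by (simp add: abs_mult right_diff_distrib[symmetric])
    then show "\<bar>cdf (\<kappa> x) ?y - cdf (\<kappa> x') ?y\<bar> \<le> 1 / real N" using assms(4) by (simp add: field_simps)
  qed (use assms in auto)
  moreover have "2 * ((b - a) / real N) + 1 / real N * (b - a) = 3 * (b - a) / real N" by argo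
  ultimately show ?thesis by simp
qed

text \<open>
  Replacing \<open>\<kappa> x\<close> by a chosen fibre with the same code yields a function of the code, which is measurable
  whatever \<open>\<phi>\<close> is, and these functions converge uniformly to \<open>\<phi> \<circ> \<kappa>\<close>.
\<close>

lemma measurable_lipschitz_kernel:
  assumes \<phi>: "\<phi> \<in> lipschitz1 (prob_on Y) wasserstein"
  shows "\<phi> \<circ> \<kappa> \<in> borel_measurable (restrict_space borel X)"
proof (rule borel_measurable_LIMSEQ_real)
  define rep where "rep N l = (SOME x. x \<in> X \<and> grid_code N x = l)" for N l
  define g where "g N = (\<lambda>x. \<phi> (\<kappa> (rep (Suc N) (grid_code (Suc N) x))))" for N
  show "g N \<in> borel_measurable (restrict_space borel X)" for N
    unfolding g_def by (rule measurable_compose[OF measurable_grid_code]) simp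
  fix x assume "x \<in> space (restrict_space borel X)"
  then have x: "x \<in> X" by (simp add: space_restrict_space)
  have "\<bar>g N x - (\<phi> \<circ> \<kappa>) x\<bar> \<le> 3 * (b - a) / real (Suc N)" for N
  proof -
    have "\<exists>x'. x' \<in> X \<and> grid_code (Suc N) x' = grid_code (Suc N) x" using x by auto
    then have r: "rep (Suc N) (grid_code (Suc N) x) \<in> X" "grid_code (Suc N) (rep (Suc N) (grid_code (Suc N) x)) = grid_code (Suc N) x"
      unfolding rep_def by (metis (mono_tags, lifting) someI_ex)+
    show ?thesis
      using lipschitz1D[OF \<phi> fibre[OF r(1)] fibre[OF x] wasserstein_le_same_grid_code[OF r(1) x r(2)]] Y(3)
      by (simp add: g_def)
  qed
  then have "\<forall>\<^sub>F N in sequentially. norm (g N x - (\<phi> \<circ> \<kappa>) x) \<le> 3 * (b - a) / real (Suc N)"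
    by (intro always_eventually allI) (simp only: real_norm_def)
  moreover have "(\<lambda>N. 3 * (b - a) / real (Suc N)) \<longlonglongrightarrow> 0"
    using tendsto_mult_right_zero[OF LIMSEQ_inverse_real_of_nat, of "3 * (b - a)"] by (simp add: divide_inverse)
  ultimately have "(\<lambda>N. g N x - (\<phi> \<circ> \<kappa>) x) \<longlonglongrightarrow> 0"
    by (rule Lim_null_comparison)
  then show "(\<lambda>N. g N x) \<longlonglongrightarrow> (\<phi> \<circ> \<kappa>) x" by (rule LIM_zero_cancel)
qed

text \<open>
  The grid with a single cell; the constant is not sharp.
\<close>

lemma wasserstein_bounded:
  assumes "\<alpha> \<in> prob_on Y" "\<beta> \<in> prob_on Y" shows "wasserstein \<alpha> \<beta> \<le> ennreal (3 * (b - a))"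
proof -
  interpret A: real_distribution \<alpha> using assms by (auto intro: prob_on_real_distribution)
  interpret B: real_distribution \<beta> using assms by (auto intro: prob_on_real_distribution)
  have "\<bar>cdf \<alpha> t - cdf \<beta> t\<bar> \<le> 1" for t
    using A.cdf_nonneg[of t] B.cdf_nonneg[of t] A.cdf_bounded_prob[of t] B.cdf_bounded_prob[of t] by linarith
  from wasserstein_le_grid[OF assms Y, of 1 1] this show ?thesis by simp
qed

lemma bounded_measurable_lipschitz_kernel:
  assumes \<phi>: "\<phi> \<in> lipschitz1 (prob_on Y) wasserstein"
  shows "bounded_measurable_on {0<..<1} (\<phi> \<circ> \<kappa>) (\<bar>\<phi> (\<kappa> 0)\<bar> + 3 * (b - a))"
proof
  have "(\<lambda>x. indicator X x *\<^sub>R (\<phi> \<circ> \<kappa>) x) \<in> borel_measurable borel"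
    using measurable_lipschitz_kernel[OF \<phi>] by (subst (asm) borel_measurable_restrict_space_iff) auto
  then have "(\<lambda>x. indicator {0<..<1} x *\<^sub>R (indicator X x *\<^sub>R (\<phi> \<circ> \<kappa>) x)) \<in> borel_measurable borel"
    by (rule borel_measurable_scaleR[rotated]) measurable
  then show "set_borel_measurable borel {0<..<1} (\<phi> \<circ> \<kappa>)"
    unfolding set_borel_measurable_def
    by (rule measurable_cong[THEN iffD1, rotated]) (auto simp: indicator_def)
  fix x :: real assume "x \<in> {0<..<1}"
  then have "\<bar>\<phi> (\<kappa> x) - \<phi> (\<kappa> 0)\<bar> \<le> 3 * (b - a)"
    using Y(3) by (intro lipschitz1D[OF \<phi>] wasserstein_bounded fibre) auto
  then show "\<bar>(\<phi> \<circ> \<kappa>) x\<bar> \<le> \<bar>\<phi> (\<kappa> 0)\<bar> + 3 * (b - a)" by simp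
qed simp

text \<open>
  The least dominating measure exists as soon as there is a dominating one, so the definite description
  in the definition of the total variation denotes it.
\<close>

lemma WTV_attained:
  assumes "WTV Y \<kappa> \<noteq> \<infinity>"
  obtains m where "dominates_variation {0<..<1} (prob_on Y) wasserstein \<kappa> m" "WTV Y \<kappa> = emeasure m {0<..<1}"
proof -
  let ?dom = "dominates_variation {0<..<1} (prob_on Y) wasserstein \<kappa>"
  let ?F = "(\<lambda>\<phi>. variation_measure {0<..<1} (\<phi> \<circ> \<kappa>)) ` lipschitz1 (prob_on Y) wasserstein"
  have ex: "\<exists>m. ?dom m" using assms by (auto simp: WTV_def metric_total_variation_def split: if_splits)
  then obtain m0 where m0: "?dom m0" by blast
  have "\<exists>m. ?dom m \<and> (\<forall>m'. ?dom m' \<longrightarrow> m \<le> m')"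
  proof (rule least_dominating_measure[where dom = ?dom and F = ?F and R = "restrict_space borel {0<..<1}", OF _ _ m0])
    fix f A B assume "f \<in> ?F"
    then obtain \<phi> where \<phi>: "\<phi> \<in> lipschitz1 (prob_on Y) wasserstein" "f = variation_measure {0<..<1} (\<phi> \<circ> \<kappa>)" by auto
    interpret bounded_measurable_on "{0<..<1}" "\<phi> \<circ> \<kappa>" "\<bar>\<phi> (\<kappa> 0)\<bar> + 3 * (b - a)"
      by (rule bounded_measurable_lipschitz_kernel[OF \<phi>(1)])
    show "f (A \<union> B) \<le> f A + f B" unfolding \<phi>(2) by (rule variation_measure_subadditive)
  next
    show "?dom m \<longleftrightarrow> sets m = sets (restrict_space borel {0<..<1}) \<and> finite_measure m \<and>
        (\<forall>f\<in>?F. \<forall>B\<in>sets (restrict_space borel {0<..<1}). f B \<le> emeasure m B)" for m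
      by (auto simp: dominates_variation_def)
  qed
  then obtain m where m: "?dom m" "\<And>m'. ?dom m' \<Longrightarrow> m \<le> m'" by blast
  have "(LEAST m. ?dom m) = m" using m by (intro Least_equality)
  then have "WTV Y \<kappa> = emeasure m {0<..<1}"
    using ex by (simp add: WTV_def metric_total_variation_def)
  with m(1) show ?thesis by (rule that)
qed

end

section \<open>The initial plan\<close>

lemma finite_measure_restrict_lborel:
  assumes "A \<in> sets borel" "bounded A" shows "finite_measure (restrict_space lborel A)"
  using assms emeasure_bounded_finite[OF assms(2)]
  by (intro finite_measureI) (auto simp: space_restrict_space emeasure_restrict_space)

context compact_disintegration
begin

lemma measurable_cdf_kernel_joint:
  assumes "A \<in> sets borel" "A \<subseteq> X"
  shows "(\<lambda>(x, t). cdf (\<kappa> x) t) \<in> borel_measurable (restrict_space lborel A \<Otimes>\<^sub>M restrict_space lborel {a..b})"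
proof -
  let ?M1 = "restrict_space lborel A" and ?M2 = "restrict_space lborel {a..b}"
  have "\<kappa> \<in> restrict_space borel A \<rightarrow>\<^sub>M subprob_algebra borel"
    using measurable_restrict_mono[OF measurable_prob_algebraD[OF kernel] assms(2)] .
  then have K: "\<kappa> \<in> ?M1 \<rightarrow>\<^sub>M subprob_algebra borel"
    by (simp cong: measurable_cong_sets sets_restrict_space_cong)
  have [measurable]: "(\<lambda>p. snd p) \<in> borel_measurable (?M1 \<Otimes>\<^sub>M ?M2)"
    by (rule measurable_compose[OF measurable_snd]) (simp add: measurable_restrict_space1)
  have "(SIGMA p:space (?M1 \<Otimes>\<^sub>M ?M2). {..snd p}) = {q \<in> space ((?M1 \<Otimes>\<^sub>M ?M2) \<Otimes>\<^sub>M (borel :: real measure)). snd q \<le> snd (fst q)}"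
    by (auto simp: space_pair_measure)
  also have "\<dots> \<in> sets ((?M1 \<Otimes>\<^sub>M ?M2) \<Otimes>\<^sub>M borel)" by measurable
  finally have "(\<lambda>p. measure (\<kappa> (fst p)) {..snd p}) \<in> borel_measurable (?M1 \<Otimes>\<^sub>M ?M2)"
    by (rule measure_measurable_subprob_algebra2) (rule measurable_compose[OF measurable_fst K])
  then show ?thesis by (simp add: cdf_def case_prod_beta')
qed

lemma cdf_kernel_bounds: "x \<in> X \<Longrightarrow> 0 \<le> cdf (\<kappa> x) t \<and> cdf (\<kappa> x) t \<le> 1"
proof -
  assume "x \<in> X"
  then interpret real_distribution "\<kappa> x" using fibre by (auto intro: prob_on_real_distribution)
  show ?thesis using cdf_nonneg cdf_bounded_prob by auto
qed

lemma integral_weighted_cdf: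
  fixes s :: "real \<Rightarrow> real"
  assumes A: "A \<in> sets borel" "A \<subseteq> X" and s[measurable]: "s \<in> borel_measurable borel" "\<And>t. \<bar>s t\<bar> \<le> 1"
  shows "(LBINT x:A. (LINT t|restrict_space lborel {a..b}. s t * cdf (\<kappa> x) t))
      = (LINT t|restrict_space lborel {a..b}. s t * (LBINT x:A. cdf (\<kappa> x) t))"
    and "(\<lambda>t. LBINT x:A. cdf (\<kappa> x) t) \<in> borel_measurable (restrict_space lborel {a..b})"
    and "integrable (restrict_space lborel {a..b}) (\<lambda>t. s t * (LBINT x:A. cdf (\<kappa> x) t))"
proof -
  let ?M1 = "restrict_space lborel A" and ?M2 = "restrict_space lborel {a..b}"
  have bA: "bounded A" using A(2) by (rule bounded_subset[rotated]) simp
  interpret M1: finite_measure ?M1 by (intro finite_measure_restrict_lborel A bA)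
  interpret M2: finite_measure ?M2 by (intro finite_measure_restrict_lborel) auto
  interpret P: pair_sigma_finite ?M1 ?M2 ..
  interpret PF: finite_measure "?M1 \<Otimes>\<^sub>M ?M2"
    by (rule finite_measure_pair_measure) (rule M1.finite_measure_axioms M2.finite_measure_axioms)+
  note J[measurable] = measurable_cdf_kernel_joint[OF A]
  have sp: "space ?M1 = A" by (simp add: space_restrict_space)
  have toint: "(LBINT x:A. f x) = (LINT x|?M1. f x)" for f :: "real \<Rightarrow> real"
    using A(1) by (simp add: set_lebesgue_integral_def integral_restrict_space)
  have J2: "(\<lambda>(t, x). cdf (\<kappa> x) t) \<in> borel_measurable (?M2 \<Otimes>\<^sub>M ?M1)"
    using measurable_compose[OF measurable_pair_swap' J] by (simp add: case_prod_beta' split_beta')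
  have "(\<lambda>t. LINT x|?M1. cdf (\<kappa> x) t) \<in> borel_measurable ?M2"
    using M1.borel_measurable_lebesgue_integral[OF J2] by simp
  then show mt: "(\<lambda>t. LBINT x:A. cdf (\<kappa> x) t) \<in> borel_measurable ?M2"
    by (simp add: toint)
  have sM2[measurable]: "s \<in> borel_measurable ?M2" by (simp add: measurable_restrict_space1)
  have "(\<lambda>(x, t). s t * cdf (\<kappa> x) t) \<in> borel_measurable (?M1 \<Otimes>\<^sub>M ?M2)"
    using borel_measurable_times[OF measurable_compose[OF measurable_snd sM2] J] by (simp add: case_prod_beta')
  then have i: "integrable (?M1 \<Otimes>\<^sub>M ?M2) (\<lambda>(x, t). s t * cdf (\<kappa> x) t)"
  proof (rule PF.integrable_const_bound[where B=1, rotated], intro AE_I2)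
    fix p assume p: "p \<in> space (?M1 \<Otimes>\<^sub>M ?M2)"
    then have "fst p \<in> X" using A by (auto simp: space_pair_measure sp)
    from cdf_kernel_bounds[OF this, of "snd p"] s(2)[of "snd p"]
    show "norm (case p of (x, t) \<Rightarrow> s t * cdf (\<kappa> x) t) \<le> 1"
      by (simp add: case_prod_beta' abs_mult mult_le_one)
  qed
  have "(LBINT x:A. (LINT t|?M2. s t * cdf (\<kappa> x) t)) = (LINT t|?M2. (LINT x|?M1. s t * cdf (\<kappa> x) t))"
    unfolding toint by (rule P.Fubini_integral[OF i, symmetric])
  then show "(LBINT x:A. (LINT t|?M2. s t * cdf (\<kappa> x) t)) = (LINT t|?M2. s t * (LBINT x:A. cdf (\<kappa> x) t))"
    by (simp add: toint)
  have "integrable ?M2 (\<lambda>t. (LINT x|?M1. s t * cdf (\<kappa> x) t))"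
    using P.integrable_snd[OF i] by simp
  then show "integrable ?M2 (\<lambda>t. s t * (LBINT x:A. cdf (\<kappa> x) t))" by (simp add: toint)
qed

text \<open>
  These functionals are the Kantorovich potentials in disguise: integration by parts turns the
  integral of a 1-Lipschitz function into the integral of the distribution function against its derivative,
  up to sign and constants.
\<close>

lemma weighted_cdf_lipschitz:
  fixes s :: "real \<Rightarrow> real"
  assumes s[measurable]: "s \<in> borel_measurable borel" "\<And>t. \<bar>s t\<bar> \<le> 1"
  shows "(\<lambda>\<alpha>. LINT t|restrict_space lborel {a..b}. s t * cdf \<alpha> t) \<in> lipschitz1 (prob_on Y) wasserstein"
  unfolding lipschitz1_def
proof (intro CollectI ballI)
  fix \<alpha> \<beta> assume ab: "\<alpha> \<in> prob_on Y" "\<beta> \<in> prob_on Y"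
  let ?M2 = "restrict_space lborel {a..b}"
  interpret M2: finite_measure ?M2 by (intro finite_measure_restrict_lborel) auto
  interpret A: cdf_distribution \<alpha> using ab by (auto simp: cdf_distribution_def intro: prob_on_real_distribution)
  interpret B: cdf_distribution \<beta> using ab by (auto simp: cdf_distribution_def intro: prob_on_real_distribution)
  have [measurable]: "s \<in> borel_measurable ?M2" "cdf \<alpha> \<in> borel_measurable ?M2" "cdf \<beta> \<in> borel_measurable ?M2"
    by (simp_all add: measurable_restrict_space1)
  have i: "integrable ?M2 (\<lambda>t. s t * cdf \<alpha> t)" "integrable ?M2 (\<lambda>t. s t * cdf \<beta> t)"
    using s(2) A.cdf_bounded_prob A.cdf_nonneg B.cdf_bounded_prob B.cdf_nonneg
    by (auto intro!: M2.integrable_const_bound[where B=1] AE_I2 simp: abs_mult mult_le_one)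
  have "(LINT t|?M2. s t * cdf \<alpha> t) - (LINT t|?M2. s t * cdf \<beta> t) = (LINT t|?M2. s t * (cdf \<alpha> t - cdf \<beta> t))"
    using i by (simp add: right_diff_distrib)
  then have "ennreal \<bar>(LINT t|?M2. s t * cdf \<alpha> t) - (LINT t|?M2. s t * cdf \<beta> t)\<bar>
      = ennreal (norm (LINT t|?M2. s t * (cdf \<alpha> t - cdf \<beta> t)))" by simp
  also have "\<dots> \<le> (\<integral>\<^sup>+t. norm (s t * (cdf \<alpha> t - cdf \<beta> t)) \<partial>?M2)"
    using i by (intro integral_norm_bound_ennreal) (simp add: right_diff_distrib)
  also have "\<dots> \<le> (\<integral>\<^sup>+t. ennreal \<bar>cdf \<alpha> t - cdf \<beta> t\<bar> \<partial>?M2)"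
    using s(2) by (intro nn_integral_mono ennreal_leI) (simp add: abs_mult mult_left_le_one_le)
  also have "\<dots> = (\<integral>\<^sup>+t. ennreal \<bar>cdf \<alpha> t - cdf \<beta> t\<bar> * indicator {a..b} t \<partial>lborel)"
    by (simp add: nn_integral_restrict_space)
  also have "\<dots> \<le> (\<integral>\<^sup>+t. ennreal \<bar>cdf \<alpha> t - cdf \<beta> t\<bar> \<partial>lborel)"
    by (intro nn_integral_mono) (simp add: indicator_def)
  also have "\<dots> = wasserstein \<alpha> \<beta>"
    using ab by (intro wasserstein_eq_cdf[symmetric] prob_on_real_distribution)
  finally show "ennreal \<bar>(LINT t|?M2. s t * cdf \<alpha> t) - (LINT t|?M2. s t * cdf \<beta> t)\<bar> \<le> wasserstein \<alpha> \<beta>" .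
qed

text \<open>
  With the sign of the difference of two cell distribution functions as weight, the functional of
  \<open>weighted_cdf_lipschitz\<close> realizes their \<open>L\<^sup>1\<close> distance as a difference of cell means of a real function,
  to which \<open>skip_cell_differences_le\<close> applies.
\<close>

lemma initial_skip_variation_le:
  assumes n: "2 \<le> n"
  defines "G \<equiv> \<lambda>i t. real n * (LBINT x:{real i / real n<..<(real i + 1) / real n}. cdf (\<kappa> x) t)"
  shows "(\<Sum>i<n - 2. \<integral>\<^sup>+t. ennreal \<bar>G i t - G (i + 2) t\<bar> \<partial>restrict_space lborel {a..b}) \<le> 2 * WTV Y \<kappa>"
proof (cases "WTV Y \<kappa> = \<infinity>")
  case False
  then obtain m where m: "dominates_variation {0<..<1} (prob_on Y) wasserstein \<kappa> m" "WTV Y \<kappa> = emeasure m {0<..<1}"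
    by (rule WTV_attained)
  let ?M2 = "restrict_space lborel {a..b}"
  let ?c = "\<lambda>i. {real i / real n<..<(real i + 1) / real n}"
  have fm: "finite_measure m" "sets m = sets (restrict_space borel {0<..<1})"
    using m(1) by (auto simp: dominates_variation_def)
  interpret finite_measure m by fact
  have sub: "?c i \<subseteq> X" if "i < n" for i
  proof -
    have "(real i + 1) / real n \<le> 1" using that n by (simp add: divide_simps)
    moreover have "0 \<le> real i / real n" by simp
    ultimately show ?thesis by (meson atLeastAtMost_iff greaterThanLessThan_iff less_imp_le order_trans subsetI)
  qed
  define s where "s i = (\<lambda>t. indicator {a..b} t *\<^sub>R sgn (G i t - G (i + 2) t))" for i
  have mG: "G i \<in> borel_measurable ?M2" if "i < n" for i
    unfolding G_def using integral_weighted_cdf(2)[of "?c i" "\<lambda>_. 0"] sub[OF that] by simp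
  have ms: "s i \<in> borel_measurable borel" if "i < n - 2" for i
  proof -
    have [measurable]: "G i \<in> borel_measurable ?M2" "G (i + 2) \<in> borel_measurable ?M2"
      using that by (auto intro: mG)
    have "(\<lambda>t. sgn (G i t - G (i + 2) t)) \<in> borel_measurable ?M2" by measurable
    then have "(\<lambda>t. sgn (G i t - G (i + 2) t)) \<in> borel_measurable (restrict_space borel {a..b})"
      by (simp cong: measurable_cong_sets sets_restrict_space_cong)
    then show ?thesis
      unfolding s_def by (subst (asm) borel_measurable_restrict_space_iff) simp_all
  qed
  \<comment> \<open>only the indices \<open>i < n - 2\<close> matter; zero keeps the remaining weights measurable\<close>
  define s' where "s' i = (if i < n - 2 then s i else (\<lambda>_. 0))" for i
  have s': "s' i \<in> borel_measurable borel" "\<bar>s' i t\<bar> \<le> 1" for i t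
  proof -
    show "s' i \<in> borel_measurable borel" by (cases "i < n - 2") (simp_all add: s'_def ms)
    show "\<bar>s' i t\<bar> \<le> 1" by (simp add: s'_def s_def abs_mult abs_sgn_eq indicator_def)
  qed
  define \<phi> where "\<phi> i = (\<lambda>\<alpha>. LINT t|?M2. s' i t * cdf \<alpha> t)" for i
  have \<phi>: "\<phi> i \<in> lipschitz1 (prob_on Y) wasserstein" for i
    unfolding \<phi>_def by (rule weighted_cdf_lipschitz[OF s'])
  have V: "variation_open (\<phi> i \<circ> \<kappa>) A \<le> emeasure m A" if "open A" "A \<subseteq> {0<..<1}" for i A
  proof -
    interpret bounded_measurable_on "{0<..<1}" "\<phi> i \<circ> \<kappa>" "\<bar>\<phi> i (\<kappa> 0)\<bar> + 3 * (b - a)"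
      by (rule bounded_measurable_lipschitz_kernel[OF \<phi>])
    have "A \<in> sets m" using that by (auto simp: fm(2) sets_restrict_space_iff)
    then have "variation_measure {0<..<1} (\<phi> i \<circ> \<kappa>) A \<le> emeasure m A"
      using m(1) \<phi> by (auto simp: dominates_variation_def)
    with variation_open_le_variation_measure[OF that] show ?thesis by (rule order_trans)
  qed
  define T where "T i = real n * ((LBINT x:?c i. (\<phi> i \<circ> \<kappa>) x) - (LBINT x:?c (i + 2). (\<phi> i \<circ> \<kappa>) x))" for i
  have T: "(\<integral>\<^sup>+t. ennreal \<bar>G i t - G (i + 2) t\<bar> \<partial>?M2) = ennreal (T i) \<and> 0 \<le> T i" if i: "i < n - 2" for i
  proof -
    have lt: "i < n" "i + 2 < n" using i by auto
    note fub = integral_weighted_cdf[OF _ sub[OF lt(1)] s'[of i]] integral_weighted_cdf[OF _ sub[OF lt(2)] s'[of i]]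
    have e: "s' i t * (real n * (LBINT x:?c i. cdf (\<kappa> x) t)) - s' i t * (real n * (LBINT x:?c (i + 2). cdf (\<kappa> x) t)) = \<bar>G i t - G (i + 2) t\<bar>"
      if "t \<in> {a..b}" for t
    proof -
      have "s' i t = sgn (G i t - G (i + 2) t)" using i that by (simp add: s'_def s_def)
      then have "\<bar>G i t - G (i + 2) t\<bar> = s' i t * (G i t - G (i + 2) t)"
        by (simp only: abs_sgn mult.commute)
      then show ?thesis by (simp only: G_def right_diff_distrib)
    qed
    have int: "integrable ?M2 (\<lambda>t. s' i t * (real n * (LBINT x:?c i. cdf (\<kappa> x) t)) - s' i t * (real n * (LBINT x:?c (i + 2). cdf (\<kappa> x) t)))"
      using integrable_mult_left[OF fub(3), of "real n"] integrable_mult_left[OF fub(6), of "real n"]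
      by (intro Bochner_Integration.integrable_diff) (simp_all add: mult_ac)
    then have intG: "integrable ?M2 (\<lambda>t. \<bar>G i t - G (i + 2) t\<bar>)"
      by (rule Bochner_Integration.integrable_cong[THEN iffD1, rotated 2]) (simp, rule e, simp add: space_restrict_space)
    have "T i = real n * ((LINT t|?M2. s' i t * (LBINT x:?c i. cdf (\<kappa> x) t)) - (LINT t|?M2. s' i t * (LBINT x:?c (i + 2). cdf (\<kappa> x) t)))"
      unfolding T_def \<phi>_def comp_def using fub(1) fub(4) by simp
    also have "\<dots> = (LINT t|?M2. s' i t * (real n * (LBINT x:?c i. cdf (\<kappa> x) t)) - s' i t * (real n * (LBINT x:?c (i + 2). cdf (\<kappa> x) t)))"
      using fub(3) fub(6) by (simp add: right_diff_distrib mult.left_commute[of _ "real n"])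
    also have "\<dots> = (LINT t|?M2. \<bar>G i t - G (i + 2) t\<bar>)"
      by (rule Bochner_Integration.integral_cong) (simp, rule e, simp add: space_restrict_space)
    finally show ?thesis using intG by (simp add: nn_integral_eq_integral)
  qed
  then have "(\<Sum>i<n - 2. \<integral>\<^sup>+t. ennreal \<bar>G i t - G (i + 2) t\<bar> \<partial>?M2) = (\<Sum>i<n - 2. ennreal (T i))"
    by simp
  also have "\<dots> = ennreal (\<Sum>i<n - 2. T i)" using T by (intro sum_ennreal) simp
  also have "\<dots> \<le> ennreal (2 * measure m {0<..<1})"
    unfolding T_def
    by (intro ennreal_leI skip_cell_differences_le[OF n bounded_measurable_lipschitz_kernel[OF \<phi>] fm V])
  also have "\<dots> = 2 * WTV Y \<kappa>" by (simp add: m(2) emeasure_eq_measure ennreal_mult)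
  finally show ?thesis .
qed simp

end

section \<open>The bound along the iteration\<close>

text \<open>
  Disintegration expresses the mass of a rectangle by the fibres over the cell. The integral over the open
  cell is used because variations live on open sets.
\<close>

lemma (in compact_disintegration) initial_cell_cdf:
  assumes d: "is_disintegration Y \<rho> \<kappa>" and fin: "finite_measure \<rho>" and i: "i < n"
  shows "cell_cdf n \<rho> i t = real n * (LBINT x:{real i / real n<..<(real i + 1) / real n}. cdf (\<kappa> x) t)"
proof -
  interpret finite_measure \<rho> by fact
  define I where "I = {real i / real n<..<(real i + 1) / real n}"
  have [measurable]: "I \<in> sets borel" by (simp add: I_def)
  let ?w = "\<lambda>x. indicator X x *\<^sub>R cdf (\<kappa> x) t"
  let ?g = "\<lambda>x. indicator I x *\<^sub>R cdf (\<kappa> x) t"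
  have w: "?w \<in> borel_measurable borel"
    using measurable_cdf_kernel[of t] by (subst (asm) borel_measurable_restrict_space_iff) auto
  have sub: "cell n i \<subseteq> X" using i by (auto simp: cell_def divide_simps)
  have IX: "I \<subseteq> cell n i" by (auto simp: cell_def I_def)
  have "(\<lambda>x. indicator I x *\<^sub>R ?w x) \<in> borel_measurable borel"
    by (rule borel_measurable_scaleR[OF _ w]) simp
  then have g: "?g \<in> borel_measurable borel"
    by (rule measurable_cong[THEN iffD1, rotated]) (use subset_trans[OF IX sub] in \<open>auto simp: indicator_def\<close>)
  have "ennreal (measure \<rho> (cell n i \<times> {..t})) = emeasure \<rho> (cell n i \<times> {..t})"
    by (simp add: emeasure_eq_measure)
  also have "\<dots> = (\<integral>\<^sup>+x. emeasure (\<kappa> x) {..t} * indicator (cell n i) x \<partial>\<mu>)"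
    using d by (simp add: is_disintegration_def)
  also have "\<dots> = (\<integral>\<^sup>+x. ennreal (?w x) * indicator (cell n i) x \<partial>\<mu>)"
  proof (rule nn_integral_cong)
    fix x
    show "emeasure (\<kappa> x) {..t} * indicator (cell n i) x = ennreal (?w x) * indicator (cell n i) x"
    proof (cases "x \<in> cell n i")
      case True
      then have x: "x \<in> X" using sub by auto
      then interpret K: real_distribution "\<kappa> x" using fibre by (auto intro: prob_on_real_distribution)
      show ?thesis using True x by (simp add: cdf_def K.emeasure_eq_measure)
    qed simp
  qed
  also have "\<dots> = (\<integral>\<^sup>+x. indicator X x * (ennreal (?w x) * indicator (cell n i) x) \<partial>lborel)"
    unfolding \<mu>_def restr_def
    using w by (intro nn_integral_density borel_measurable_times measurable_compose[OF _ measurable_ennreal]) auto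
  also have "\<dots> = (\<integral>\<^sup>+x. ennreal (?g x) \<partial>lborel)"
  proof (rule nn_integral_cong_AE)
    show "AE x in lborel. indicator X x * (ennreal (?w x) * indicator (cell n i) x) = ennreal (?g x)"
      using AE_lborel_singleton[of "real i / real n"] AE_lborel_singleton[of "(real i + 1) / real n"]
    proof eventually_elim
      case (elim x)
      then have "x \<in> cell n i \<longleftrightarrow> x \<in> I" by (auto simp: cell_def I_def)
      then show ?case using sub by (auto simp: indicator_def)
    qed
  qed
  finally have eq: "ennreal (measure \<rho> (cell n i \<times> {..t})) = (\<integral>\<^sup>+x. ennreal (?g x) \<partial>lborel)" .
  have nonneg: "0 \<le> ?g x" for x
    using cdf_kernel_bounds[of x t] sub IX by (auto simp: indicator_def)
  have "integrable lborel ?g"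
    using g nonneg eq[symmetric] by (intro integrableI_nonneg) auto
  then have "(\<integral>\<^sup>+x. ennreal (?g x) \<partial>lborel) = ennreal (LBINT x. ?g x)"
    using nonneg by (intro nn_integral_eq_integral) auto
  with eq have "measure \<rho> (cell n i \<times> {..t}) = (LBINT x. ?g x)"
    using nonneg by (simp add: integral_nonneg_AE)
  then show ?thesis by (simp add: cell_cdf_def set_lebesgue_integral_def I_def)
qed

lemma cell_cdf_bounds:
  assumes "uniform_plan n Y \<rho>" "closed Y" "i < n"
  shows "0 \<le> cell_cdf n \<rho> i t \<and> cell_cdf n \<rho> i t \<le> 1"
proof -
  interpret real_distribution "cell_marginal Y n \<rho> i"
    by (rule prob_on_real_distribution[OF cell_marginal_props(1)[OF assms]])
  show ?thesis using cdf_nonneg[of t] cdf_bounded_prob[of t] by (simp add: cell_marginal_props(2)[OF assms])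
qed

definition padded_variation :: "nat \<Rightarrow> (real \<times> real) measure \<Rightarrow> real \<Rightarrow> real" where
  "padded_variation n \<rho> t = (\<Sum>j<n + 2. \<bar>pad n (\<lambda>i. cell_cdf n \<rho> i t) j - pad n (\<lambda>i. cell_cdf n \<rho> i t) (j + 2)\<bar>)"

lemma (in dd_step) padded_variation_decreases: "padded_variation n \<rho>' t \<le> padded_variation n \<rho> t"
  unfolding padded_variation_def
proof (rule padded_skip_variation_antimono[OF n])
  show "0 \<le> cell_cdf n \<rho> i t \<and> cell_cdf n \<rho> i t \<le> 1" if "i < n" for i
    using prev closed_Y that by (rule cell_cdf_bounds)
  show "(\<forall>i. even i \<longrightarrow> i + 1 < n \<longrightarrow> half_split (cell_cdf n \<rho> i t) (cell_cdf n \<rho> (i + 1) t) (cell_cdf n \<rho>' i t) (cell_cdf n \<rho>' (i + 1) t)) \<or>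
      (\<forall>i. odd i \<longrightarrow> i + 1 < n \<longrightarrow> half_split (cell_cdf n \<rho> i t) (cell_cdf n \<rho> (i + 1) t) (cell_cdf n \<rho>' i t) (cell_cdf n \<rho>' (i + 1) t)) \<and>
      cell_cdf n \<rho>' 0 t = cell_cdf n \<rho> 0 t \<and> cell_cdf n \<rho>' (n - 1) t = cell_cdf n \<rho> (n - 1) t"
  proof (cases "odd k")
    case True
    then have "{i, i + 1} \<in> composite_partition n k" if "even i" "i + 1 < n" for i
      using that by (auto simp: composite_partition_def partition_A_def)
    then show ?thesis using step_pair by blast
  next
    case False
    have "{i, i + 1} \<in> composite_partition n k" if "odd i" "i + 1 < n" for i
    proof -
      have "i + 1 < n - 1" using that n by presburger
      then show ?thesis using that False by (auto simp: composite_partition_def partition_B_def)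
    qed
    moreover have "{0} \<in> composite_partition n k" "{n - 1} \<in> composite_partition n k"
      using False by (auto simp: composite_partition_def partition_B_def)
    ultimately show ?thesis using step_pair step_singleton by blast
  qed
qed

lemma dd_iterates_invariant:
  assumes n: "even n" "0 < n" and Y: "compact Y" and h: "strictly_convex h"
    and c: "\<And>x y. x \<in> X \<Longrightarrow> y \<in> Y \<Longrightarrow> c (x, y) = h (x - y)"
    and init: "uniform_plan n Y \<pi>_init" and it: "is_dd_iterates c Y \<pi>_init n \<pi>"
  shows "uniform_plan n Y (\<pi> k) \<and> padded_variation n (\<pi> k) t \<le> padded_variation n \<pi>_init t"
proof (induction k)
  case 0
  have "\<pi> 0 = \<pi>_init" using it by (simp add: is_dd_iterates_def)
  then show ?case using init by simp
next
  case (Suc k)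
  have "1 \<le> Suc k" by simp
  then obtain \<sigma> where \<sigma>: "\<And>J. J \<in> composite_partition n (Suc k) \<Longrightarrow> is_cell_minimizer c Y n (\<pi> k) J (\<sigma> J)"
    "is_measure_sum (composite_partition n (Suc k)) \<sigma> (\<pi> (Suc k))"
    using it unfolding is_dd_iterates_def by (metis diff_Suc_1)
  interpret dd_step h c Y n "Suc k" "\<pi> k" "\<pi> (Suc k)" \<sigma>
    by unfold_locales (use n Y h c Suc \<sigma> in auto)
  show ?case using step_uniform padded_variation_decreases[of t] Suc by simp
qed

text \<open>
  Outside \<open>[a, b]\<close> all distribution functions of measures on \<open>Y\<close> agree, so the constant four is
  integrated over an interval of length \<open>b - a\<close> only.
\<close>

lemma WTVB_le_of_padded_variation:
  assumes n: "2 \<le> n" and Y: "Y \<subseteq> {a..b}" "closed Y" "a \<le> b"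
    and u: "uniform_plan n Y \<rho>" and u0: "uniform_plan n Y \<rho>0"
    and le: "\<And>t. padded_variation n \<rho> t \<le> padded_variation n \<rho>0 t"
  shows "WTVB Y n \<rho> \<le> (\<Sum>i<n - 2. \<integral>\<^sup>+t. ennreal \<bar>cell_cdf n \<rho>0 i t - cell_cdf n \<rho>0 (i + 2) t\<bar> \<partial>restrict_space lborel {a..b}) + 4 * ennreal (b - a)"
proof -
  let ?M = "restrict_space lborel {a..b}"
  have mono: "cell_cdf n \<rho>' i \<in> borel_measurable ?M" if "uniform_plan n Y \<rho>'" "i < n" for \<rho>' i
  proof -
    interpret cdf_distribution "cell_marginal Y n \<rho>' i"
      using prob_on_real_distribution[OF cell_marginal_props(1)[OF that(1) Y(2) that(2)]]
      by (simp add: cdf_distribution_def)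
    have "cdf (cell_marginal Y n \<rho>' i) = cell_cdf n \<rho>' i"
      using cell_marginal_props(2)[OF that(1) Y(2) that(2)] by auto
    then show ?thesis using measurable_C by (simp add: measurable_restrict_space1)
  qed
  have W: "wasserstein (cell_marginal Y n \<rho> i) (cell_marginal Y n \<rho> (i + 2))
      = (\<integral>\<^sup>+t. ennreal \<bar>cell_cdf n \<rho> i t - cell_cdf n \<rho> (i + 2) t\<bar> \<partial>?M)" if "i < n - 2" for i
  proof -
    have lt: "i < n" "i + 2 < n" using that by auto
    note p = cell_marginal_props[OF u Y(2) lt(1)] cell_marginal_props[OF u Y(2) lt(2)]
    have "wasserstein (cell_marginal Y n \<rho> i) (cell_marginal Y n \<rho> (i + 2))
        = (\<integral>\<^sup>+t. ennreal \<bar>cell_cdf n \<rho> i t - cell_cdf n \<rho> (i + 2) t\<bar> \<partial>lborel)"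
      unfolding p(2,4)[symmetric] using p(1,3) by (intro wasserstein_eq_cdf prob_on_real_distribution)
    also have "\<dots> = (\<integral>\<^sup>+t. ennreal \<bar>cell_cdf n \<rho> i t - cell_cdf n \<rho> (i + 2) t\<bar> * indicator {a..b} t \<partial>lborel)"
    proof (rule nn_integral_cong)
      fix t
      show "ennreal \<bar>cell_cdf n \<rho> i t - cell_cdf n \<rho> (i + 2) t\<bar> = ennreal \<bar>cell_cdf n \<rho> i t - cell_cdf n \<rho> (i + 2) t\<bar> * indicator {a..b} t"
        using prob_on_cdf_outside[OF p(1) Y(1,2), of t] prob_on_cdf_outside[OF p(3) Y(1,2), of t]
        unfolding p(2,4) by (cases "t < a"; cases "b \<le> t") (auto simp: indicator_def)
    qed
    also have "\<dots> = (\<integral>\<^sup>+t. ennreal \<bar>cell_cdf n \<rho> i t - cell_cdf n \<rho> (i + 2) t\<bar> \<partial>?M)"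
      by (simp add: nn_integral_restrict_space)
    finally show ?thesis .
  qed
  have m: "(\<lambda>t. ennreal \<bar>cell_cdf n \<rho>' i t - cell_cdf n \<rho>' (i + 2) t\<bar>) \<in> borel_measurable ?M"
    if "uniform_plan n Y \<rho>'" "i \<in> {..<n - 2}" for \<rho>' i
  proof -
    have "i < n" "i + 2 < n" using that(2) by auto
    then show ?thesis using mono[OF that(1)] by measurable
  qed
  have "WTVB Y n \<rho> = (\<Sum>i<n - 2. \<integral>\<^sup>+t. ennreal \<bar>cell_cdf n \<rho> i t - cell_cdf n \<rho> (i + 2) t\<bar> \<partial>?M)"
    unfolding WTVB_def by (intro sum.cong refl W) simp
  also have "\<dots> = (\<integral>\<^sup>+t. (\<Sum>i<n - 2. ennreal \<bar>cell_cdf n \<rho> i t - cell_cdf n \<rho> (i + 2) t\<bar>) \<partial>?M)"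
    by (intro nn_integral_sum[symmetric] m u)
  also have "\<dots> \<le> (\<integral>\<^sup>+t. (\<Sum>i<n - 2. ennreal \<bar>cell_cdf n \<rho>0 i t - cell_cdf n \<rho>0 (i + 2) t\<bar>) + 4 \<partial>?M)"
  proof (rule nn_integral_mono)
    fix t
    have "(\<Sum>i<n - 2. \<bar>cell_cdf n \<rho> i t - cell_cdf n \<rho> (i + 2) t\<bar>) \<le> padded_variation n \<rho> t"
      unfolding padded_variation_def by (rule padded_skip_variation_bounds(1)[OF n cell_cdf_bounds[OF u Y(2)]])
    also have "\<dots> \<le> padded_variation n \<rho>0 t" by (rule le)
    also have "\<dots> \<le> (\<Sum>i<n - 2. \<bar>cell_cdf n \<rho>0 i t - cell_cdf n \<rho>0 (i + 2) t\<bar>) + 4"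
      unfolding padded_variation_def by (rule padded_skip_variation_bounds(2)[OF n cell_cdf_bounds[OF u0 Y(2)]])
    finally have "ennreal (\<Sum>i<n - 2. \<bar>cell_cdf n \<rho> i t - cell_cdf n \<rho> (i + 2) t\<bar>)
        \<le> ennreal ((\<Sum>i<n - 2. \<bar>cell_cdf n \<rho>0 i t - cell_cdf n \<rho>0 (i + 2) t\<bar>) + 4)"
      by (rule ennreal_leI)
    also have "\<dots> = ennreal (\<Sum>i<n - 2. \<bar>cell_cdf n \<rho>0 i t - cell_cdf n \<rho>0 (i + 2) t\<bar>) + 4"
      by (subst ennreal_plus) (auto intro: sum_nonneg)
    finally show "(\<Sum>i<n - 2. ennreal \<bar>cell_cdf n \<rho> i t - cell_cdf n \<rho> (i + 2) t\<bar>)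
        \<le> (\<Sum>i<n - 2. ennreal \<bar>cell_cdf n \<rho>0 i t - cell_cdf n \<rho>0 (i + 2) t\<bar>) + 4"
      by (simp add: sum_ennreal)
  qed
  also have "\<dots> = (\<integral>\<^sup>+t. (\<Sum>i<n - 2. ennreal \<bar>cell_cdf n \<rho>0 i t - cell_cdf n \<rho>0 (i + 2) t\<bar>) \<partial>?M) + (\<integral>\<^sup>+t. 4 \<partial>?M)"
    by (intro nn_integral_add borel_measurable_sum m u0) simp_all
  also have "(\<integral>\<^sup>+t. (\<Sum>i<n - 2. ennreal \<bar>cell_cdf n \<rho>0 i t - cell_cdf n \<rho>0 (i + 2) t\<bar>) \<partial>?M)
      = (\<Sum>i<n - 2. \<integral>\<^sup>+t. ennreal \<bar>cell_cdf n \<rho>0 i t - cell_cdf n \<rho>0 (i + 2) t\<bar> \<partial>?M)"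
    by (intro nn_integral_sum m u0)
  also have "(\<integral>\<^sup>+t. 4 \<partial>?M) = 4 * ennreal (b - a)"
    using Y(3) by (simp add: space_restrict_space emeasure_restrict_space)
  finally show ?thesis .
qed

theorem proposition4p16:
  fixes Y :: "real set" and h :: "real \<Rightarrow> real" and c :: "real \<times> real \<Rightarrow> real"
    and \<nu> :: "real measure" and \<pi>_init :: "(real \<times> real) measure"
    and \<kappa> :: "real \<Rightarrow> real measure"
    and \<pi> :: "nat \<Rightarrow> nat \<Rightarrow> (real \<times> real) measure"
  assumes "compact Y"
    and "strictly_convex h"
    and "\<And>x y. x \<in> X \<Longrightarrow> y \<in> Y \<Longrightarrow> c (x, y) = h (x - y)"
    and "C1_on (X \<times> Y) c"
    and "\<nu> \<in> prob_on Y"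
    and "\<pi>_init \<in> couplings \<mu> \<nu>"
    and "is_disintegration Y \<pi>_init \<kappa>"
    and "\<And>n. 0 < n \<Longrightarrow> even n \<Longrightarrow> is_dd_iterates c Y \<pi>_init n (\<pi> n)"
  shows "\<forall>n k. 0 < n \<longrightarrow> even n \<longrightarrow>
    WTVB Y n (\<pi> n k) \<le> 2 * WTV Y \<kappa> + 4 * ennreal (diameter Y)"
proof (intro allI impI)
  fix n k :: nat assume n: "0 < n" "even n"
  then have n2: "2 \<le> n" by presburger
  have closed: "closed Y" using assms(1) by (rule compact_imp_closed)
  have "Y \<noteq> {}"
  proof
    assume "Y = {}"
    then have "emeasure \<nu> (space \<nu>) = 0" using assms(5) by (auto simp: prob_on_def dest: sets_eq_imp_space_eq)
    moreover have "prob_space \<nu>" using assms(5) by (simp add: prob_on_def)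
    ultimately show False using prob_space.emeasure_space_1 by fastforce
  qed
  define a b where "a = Inf Y" and "b = Sup Y"
  have bdd: "bounded Y" using assms(1) by (rule compact_imp_bounded)
  have bounds: "bdd_below Y" "bdd_above Y"
    using bdd by (auto intro: bounded_imp_bdd_below bounded_imp_bdd_above)
  have ab: "a \<in> Y" "b \<in> Y" "Y \<subseteq> {a..b}"
    using closed_contains_Inf[OF \<open>Y \<noteq> {}\<close> bounds(1) closed]
      closed_contains_Sup[OF \<open>Y \<noteq> {}\<close> bounds(2) closed] bounds
    by (auto simp: a_def b_def intro: cInf_lower cSup_upper)
  then have "a \<le> b" by auto
  have diam: "b - a \<le> diameter Y"
    using diameter_bounded_bound[OF bdd ab(2,1)] by (simp add: dist_real_def)
  interpret compact_disintegration Y \<kappa> a b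
    by unfold_locales (use ab closed \<open>a \<le> b\<close> assms(7) in \<open>auto simp: is_disintegration_def\<close>)
  have u0: "uniform_plan n Y \<pi>_init"
    using n(1) closed assms(5,6) by (rule uniform_plan_coupling)
  note inv = dd_iterates_invariant[OF n(2,1) assms(1-3) u0 assms(8)[OF n]]
  have "WTVB Y n (\<pi> n k) \<le> (\<Sum>i<n - 2. \<integral>\<^sup>+t. ennreal \<bar>cell_cdf n \<pi>_init i t - cell_cdf n \<pi>_init (i + 2) t\<bar> \<partial>restrict_space lborel {a..b}) + 4 * ennreal (b - a)"
    using inv by (intro WTVB_le_of_padded_variation[OF n2 Y] u0) auto
  also have "\<dots> \<le> 2 * WTV Y \<kappa> + 4 * ennreal (b - a)"
  proof (rule add_right_mono)
    have fin: "finite_measure \<pi>_init" using u0 by (simp add: uniform_plan_def)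
    show "(\<Sum>i<n - 2. \<integral>\<^sup>+t. ennreal \<bar>cell_cdf n \<pi>_init i t - cell_cdf n \<pi>_init (i + 2) t\<bar> \<partial>restrict_space lborel {a..b}) \<le> 2 * WTV Y \<kappa>"
      using initial_skip_variation_le[OF n2] by (simp add: initial_cell_cdf[OF assms(7) fin])
  qed
  also have "\<dots> \<le> 2 * WTV Y \<kappa> + 4 * ennreal (diameter Y)"
    using diam by (intro add_left_mono mult_left_mono ennreal_leI) auto
  finally show "WTVB Y n (\<pi> n k) \<le> 2 * WTV Y \<kappa> + 4 * ennreal (diameter Y)" .
qed

end
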